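(* Let $n\geq 2$ be an integer and $q:=2^n$. For $a\in\mathbb{F}_q^\times$ let $U_a^q:=\{x^2+ax \mid x\in\mathbb{F}_q\}$ and $O_a^q:=\{x+ax^{-1}\mid x\in\mathbb{F}_q^\times\}$. Let $\mathcal{D}_q^u:=(\mathbb{F}_q^\times,\mathcal{B}_q^u)$ and $\mathcal{D}_q^o:=(\mathbb{F}_q^\times,\mathcal{B}_q^o)$ be the two incidence structures with $\mathcal{B}_q^u:=\{(U_a^q)^\times : a\in\mathbb{F}_q^\times\}$ and $\mathcal{B}_q^o:=\{(O_a^q)^\times : a\in\mathbb{F}_q^\times\}$. Then the following hold. (i) $\mathcal{D}_q^u$ and $\mathcal{D}_q^o$ are $2$-$(q-1,\frac{q}{2}-1,\frac{q}{4}-1)$ designs. Moreover, $\mathcal{D}_q^o$ is design-isomorphic to the dual of $\mathcal{D}_q^u$. Thus, the two full automorphism groups $\mathrm{Aut}(\mathcal{D}_q^u)$ and $\mathrm{Aut}(\mathcal{D}_q^o)$ are isomorphic. (ii) $\mathrm{Aut}(\mathcal{D}_q^u)=\mathrm{GL}_{\mathbb{F}_2}(\mathbb{F}_q)\cong \mathrm{GL}_n(2)$, where $\mathbb{F}_q$ is considered as an $\mathbb{F}_2$-vector space. (iii) Both $\mathrm{Aut}(\mathcal{D}_q^u)$ and $\mathrm{Aut}(\mathcal{D}_q^o)$ are primitive maximal subgroups of the alternating group $\mathrm{Alt}(\mathbb{F}_q^\times)$. Furthermore, let $H$ be either $\mathrm{Aut}(\mathcal{D}_q^u)$ or $\mathrm{Aut}(\mathcal{D}_q^o)$.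 Then the stabilizer of a point and the stabilizer of a block in $H$ are both isomorphic to $2^{n-1}{:}\mathrm{GL}_{n-1}(2)$. If $n=2$, then these two stabilizers are conjugate in $H$. If $n\geq 3$, then these two stabilizers are not conjugate in $H$.
   Context: For $S\subseteq\mathbb{F}_q$, $S^\times:=S\setminus\{0\}$. An incidence structure $(\mathcal{P},\mathcal{B})$ with point set $\mathcal{P}$ and block set $\mathcal{B}$ (here blocks are subsets of $\mathcal{P}$, with incidence given by membership) is a $t$-$(v,k,\lambda)$ design if $|\mathcal{P}|=v$, every block is incident with precisely $k$ points, and every $t$ distinct points are together incident with precisely $\lambda$ blocks ($\lambda=0$ is allowed). The dual of $(\mathcal{P},\mathcal{B})$ has point set $\mathcal{B}$ and block set $\mathcal{P}$, with $B\in\mathcal{B}$ incident with $p\in\mathcal{P}$ in the dual if and only if $p$ is incident with $B$ in the original structure; a block $p$ of the dual is viewed as the set $\{B\in\mathcal{B}: p\in B\}$. A design isomorphism $(\mathcal{P},\mathcal{B})\to(\mathcal{P}',\mathcal{B}')$ is a bijection $\sigma:\mathcal{P}\to\mathcal{P}'$ such that $\sigma(B)\in\mathcal{B}'$ for every $B\in\mathcal{B}$; an automorphism is an isomorphism from a design to itself, and $\mathrm{Aut}(\mathcal{D})$ (the full automorphism group) is the group of all automorphisms of $\mathcal{D}$ under composition, here a subgroup of the symmetric group $\mathrm{Sym}(\mathbb{F}_q^\times)$. $\mathrm{GL}_{\mathbb{F}_2}(\mathbb{F}_q)$ is the group of $\mathbb{F}_2$-linear automorphisms of $\mathbb{F}_q$,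 regarded as a subgroup of $\mathrm{Sym}(\mathbb{F}_q^\times)$ by restriction to $\mathbb{F}_q^\times$. $\mathrm{GL}_m(2)$ is the group of invertible $m\times m$ matrices over $\mathbb{F}_2$. $2^{m}{:}\mathrm{GL}_{m}(2)$ denotes the semidirect product $\mathbb{F}_2^{m}\rtimes\mathrm{GL}_{m}(2)$ with respect to the natural action. "Primitive" refers to the action on $\mathbb{F}_q^\times$. The stabilizer of a block is its setwise stabilizer; points and blocks are those of the design of which $H$ is the automorphism group.
   Formalization: In (iii), being a maximal subgroup of Alt(F_q^×) is claimed only for n ≥ 3; for n = 2 it is false, since both automorphism groups equal Sym(3), which is not contained in Alt(3). Primitivity and everything else is kept for all n ≥ 2. *)

theory Defs
  imports
    "HOL-Algebra.Group_Action"
    "HOL-Algebra.Sym_Groups"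
    "HOL-Combinatorics.Permutations"
    "HOL-Library.Cardinality"
    "HOL-Library.Disjoint_Sets"
    "HOL-Library.Z2"
    "Jordan_Normal_Form.Matrix"
begin

section \<open>Incidence structures\<close>

text \<open>A pair (points, blocks), the blocks being sets of points.\<close>

type_synonym 'p incidence = "'p set \<times> 'p set set"

definition is_design :: "nat \<Rightarrow> nat \<Rightarrow> nat \<Rightarrow> nat \<Rightarrow> 'p incidence \<Rightarrow> bool" where
  "is_design t v k l D \<longleftrightarrow>
     finite (fst D) \<and> card (fst D) = v \<and>
     (\<forall>B\<in>snd D. B \<subseteq> fst D \<and> card B = k) \<and>
     (\<forall>T. T \<subseteq> fst D \<and> card T = t \<longrightarrow> card {B\<in>snd D. T \<subseteq> B} = l)"

definition dual :: "'p incidence \<Rightarrow> 'p set incidence" where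
  "dual D = (snd D, (\<lambda>p. {B\<in>snd D. p \<in> B}) ` fst D)"

definition design_iso :: "'p incidence \<Rightarrow> 'r incidence \<Rightarrow> ('p \<Rightarrow> 'r) \<Rightarrow> bool" where
  "design_iso D E \<sigma> \<longleftrightarrow>
     bij_betw \<sigma> (fst D) (fst E) \<and> (\<forall>B\<in>snd D. \<sigma> ` B \<in> snd E)"

definition design_isomorphic :: "'p incidence \<Rightarrow> 'r incidence \<Rightarrow> bool" where
  "design_isomorphic D E \<longleftrightarrow> (\<exists>\<sigma>. design_iso D E \<sigma>)"

section \<open>Permutation groups\<close>

text \<open>
  As for the library's groups \<open>sym_group n\<close> and \<open>alt_group n\<close>, a permutation of a set \<open>S\<close> is a
  function on the whole type that is the identity outside \<open>S\<close>.
\<close>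

definition sym_group_on :: "'p set \<Rightarrow> ('p \<Rightarrow> 'p) monoid" where
  "sym_group_on S = \<lparr>carrier = {\<sigma>. \<sigma> permutes S}, monoid.mult = (\<circ>), one = id\<rparr>"

definition alt_group_on :: "'p set \<Rightarrow> ('p \<Rightarrow> 'p) monoid" where
  "alt_group_on S = (sym_group_on S)\<lparr>carrier := {\<sigma>. \<sigma> permutes S \<and> evenperm \<sigma>}\<rparr>"

definition Aut :: "'p incidence \<Rightarrow> ('p \<Rightarrow> 'p) set" where
  "Aut D = {\<sigma>. \<sigma> permutes fst D \<and> design_iso D D \<sigma>}"

definition aut_group :: "'p incidence \<Rightarrow> ('p \<Rightarrow> 'p) monoid" where
  "aut_group D = (sym_group_on (fst D))\<lparr>carrier := Aut D\<rparr>"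

definition primitive_on :: "'p set \<Rightarrow> ('p \<Rightarrow> 'p) set \<Rightarrow> bool" where
  "primitive_on S G \<longleftrightarrow>
     S \<noteq> {} \<and>
     (\<forall>x\<in>S. \<forall>y\<in>S. \<exists>g\<in>G. g x = y) \<and>
     (\<forall>Q. partition_on S Q \<and> (\<forall>g\<in>G. \<forall>C\<in>Q. g ` C \<in> Q) \<longrightarrow>
          Q = {S} \<or> Q = (\<lambda>x. {x}) ` S)"

definition maximal_subgroup :: "'g set \<Rightarrow> ('g, 'b) monoid_scheme \<Rightarrow> bool" where
  "maximal_subgroup M G \<longleftrightarrow>
     subgroup M G \<and> M \<noteq> carrier G \<and>
     (\<forall>K. subgroup K G \<and> M \<subseteq> K \<longrightarrow> K = M \<or> K = carrier G)"

definition conjugate_in :: "('g, 'b) monoid_scheme \<Rightarrow> 'g set \<Rightarrow> 'g set \<Rightarrow> bool" where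
  "conjugate_in G K L \<longleftrightarrow>
     (\<exists>g\<in>carrier G. L = g <#\<^bsub>G\<^esub> K #>\<^bsub>G\<^esub> (inv\<^bsub>G\<^esub> g))"

definition point_stabilizer :: "('p \<Rightarrow> 'p) monoid \<Rightarrow> 'p \<Rightarrow> ('p \<Rightarrow> 'p) set" where
  "point_stabilizer H p = stabilizer H (\<lambda>g. g) p"

definition block_stabilizer :: "('p \<Rightarrow> 'p) monoid \<Rightarrow> 'p set \<Rightarrow> ('p \<Rightarrow> 'p) set" where
  "block_stabilizer H B = stabilizer H (\<lambda>g. image g) B"

lemma group_sym_group_on: "group (sym_group_on S)"
proof (rule groupI)
  fix g assume "g \<in> carrier (sym_group_on S)"
  then have p: "g permutes S" by (simp add: sym_group_on_def)
  show "\<exists>h\<in>carrier (sym_group_on S). h \<otimes>\<^bsub>sym_group_on S\<^esub> g = \<one>\<^bsub>sym_group_on S\<^esub>"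
    using permutes_inv[OF p] permutes_inv_o(2)[OF p]
    by (intro bexI[of _ "Hilbert_Choice.inv g"]) (simp_all add: sym_group_on_def)
qed (simp_all add: sym_group_on_def permutes_compose permutes_id comp_assoc)

lemma subgroup_Aut:
  assumes "finite (fst D)" and "\<And>B. B \<in> snd D \<Longrightarrow> B \<subseteq> fst D"
  shows "subgroup (Aut D) (sym_group_on (fst D))"
proof (rule group.subgroupI[OF group_sym_group_on])
  show "Aut D \<subseteq> carrier (sym_group_on (fst D))"
    by (auto simp: Aut_def sym_group_on_def)
  show "Aut D \<noteq> {}"
    using permutes_id[of "fst D"] by (auto simp: Aut_def design_iso_def intro!: exI[of _ id])
next
  fix g assume g: "g \<in> Aut D"
  then have p: "g permutes fst D" and im: "\<And>B. B \<in> snd D \<Longrightarrow> g ` B \<in> snd D"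
    by (auto simp: Aut_def design_iso_def)
  have "snd D \<subseteq> Pow (fst D)" using assms(2) by blast
  then have fin: "finite (snd D)" using assms(1) finite_subset by blast
  have "inj_on (image g) (snd D)"
    using permutes_inj[OF p] by (auto simp: inj_on_def inj_image_eq_iff)
  then have surj: "image g ` snd D = snd D"
    using endo_inj_surj[OF fin] im by blast
  have i: "Hilbert_Choice.inv g \<circ> g = id"
    by (rule permutes_inv_o(2)[OF p])
  have "Hilbert_Choice.inv g ` B \<in> snd D" if "B \<in> snd D" for B
  proof -
    have "B \<in> image g ` snd D" unfolding surj by (rule that)
    then obtain C where C: "C \<in> snd D" "B = g ` C" by (elim imageE) (rule that)
    have "Hilbert_Choice.inv g ` B = (Hilbert_Choice.inv g \<circ> g) ` C"
      unfolding C(2) by (rule image_comp)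
    then have "Hilbert_Choice.inv g ` B = C" unfolding i by simp
    with C show ?thesis by simp
  qed
  then have inv_in: "Hilbert_Choice.inv g \<in> Aut D"
    using permutes_inv[OF p] permutes_imp_bij[OF permutes_inv[OF p]]
    by (simp add: Aut_def design_iso_def)
  have "inv\<^bsub>sym_group_on (fst D)\<^esub> g = Hilbert_Choice.inv g"
    by (rule group.inv_equality[OF group_sym_group_on])
       (use i p permutes_inv[OF p] in \<open>simp_all add: sym_group_on_def\<close>)
  with inv_in show "inv\<^bsub>sym_group_on (fst D)\<^esub> g \<in> Aut D" by simp
next
  fix g h assume "g \<in> Aut D" "h \<in> Aut D"
  then have p: "g permutes fst D" "h permutes fst D"
    and g: "\<And>B. B \<in> snd D \<Longrightarrow> g ` B \<in> snd D"
    and h: "\<And>B. B \<in> snd D \<Longrightarrow> h ` B \<in> snd D"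
    by (simp_all add: Aut_def design_iso_def)
  have im: "(g \<circ> h) ` B \<in> snd D" if "B \<in> snd D" for B
    using g[OF h[OF that]] unfolding image_comp .
  have "(g \<circ> h) permutes fst D" using permutes_compose[OF p(2) p(1)] .
  then show "g \<otimes>\<^bsub>sym_group_on (fst D)\<^esub> h \<in> Aut D"
    using im permutes_imp_bij by (simp add: Aut_def design_iso_def sym_group_on_def)
qed

section \<open>Linear groups over the field with two elements\<close>

definition GL2 :: "nat \<Rightarrow> bit mat monoid" where
  "GL2 m = units_of (ring_mat TYPE(bit) m ())"

definition semidirect ::
  "('g, 'b) monoid_scheme \<Rightarrow> ('h, 'c) monoid_scheme \<Rightarrow> ('h \<Rightarrow> 'g \<Rightarrow> 'g) \<Rightarrow> ('g \<times> 'h) monoid" where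
  "semidirect N K \<phi> =
     \<lparr>carrier = carrier N \<times> carrier K,
      monoid.mult = (\<lambda>(v, a) (w, b). (v \<otimes>\<^bsub>N\<^esub> \<phi> a w, a \<otimes>\<^bsub>K\<^esub> b)),
      one = (\<one>\<^bsub>N\<^esub>, \<one>\<^bsub>K\<^esub>)\<rparr>"

definition AGL2 :: "nat \<Rightarrow> (bit vec \<times> bit mat) monoid" where
  "AGL2 m = semidirect (monoid_vec TYPE(bit) m) (GL2 m) (*\<^sub>v)"

text \<open>Scalar multiplication of \<open>\<bbbF>\<^sub>2\<close> on a field of characteristic 2.\<close>

definition scale2 :: "bit \<Rightarrow> 'a::field \<Rightarrow> 'a" where
  "scale2 c x = of_bool (c = 1) * x"

lemma vector_space_scale2:
  assumes "(1::'a::field) + 1 = 0"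
  shows "vector_space (scale2 :: bit \<Rightarrow> 'a \<Rightarrow> 'a)"
proof
  fix a b :: bit and x y :: 'a
  have "x + x = 0" using assms by (metis distrib_left mult.right_neutral mult_zero_right)
  then show "scale2 (a + b) x = scale2 a x + scale2 b x"
    by (cases a; cases b) (auto simp: scale2_def)
  show "scale2 a (x + y) = scale2 a x + scale2 a y"
    by (simp add: scale2_def distrib_left)
  show "scale2 a (scale2 b x) = scale2 (a * b) x"
    by (cases a; cases b) (simp_all add: scale2_def)
  show "scale2 1 x = x"
    by (simp add: scale2_def)
qed

text \<open>
  A linear automorphism fixes 0, so it is itself a permutation of the nonzero elements in the
  sense of \<^const>\<open>sym_group_on\<close>; no restriction is needed.
\<close>

definition GL_F2 :: "('a::field \<Rightarrow> 'a) set" where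
  "GL_F2 = {f. Vector_Spaces.linear scale2 scale2 f \<and> bij f}"

section \<open>The two incidence structures\<close>

definition nonzero :: "'a::zero set \<Rightarrow> 'a set" where
  "nonzero S = S - {0}"

definition U_set :: "'a::field \<Rightarrow> 'a set" where
  "U_set a = {x\<^sup>2 + a * x | x. x \<in> UNIV}"

definition O_set :: "'a::field \<Rightarrow> 'a set" where
  "O_set a = {x + a * inverse x | x. x \<in> nonzero UNIV}"

definition D_u :: "'a::field incidence" where
  "D_u = (nonzero UNIV, {nonzero (U_set a) | a. a \<in> nonzero UNIV})"

definition D_o :: "'a::field incidence" where
  "D_o = (nonzero UNIV, {nonzero (O_set a) | a. a \<in> nonzero UNIV})"

end

theory Submission
  imports Defs
begin

text \<open>
  The field is used mainly as an elementary abelian \<open>2\<close>-group \<open>V\<close> of order \<open>2\<^sup>n\<close>.  The set \<open>U\<^sub>1\<close> of all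
  \<open>x\<^sup>2 + x\<close> is an additive subgroup of index two, so ``\<open>y x\<close> does not lie in \<open>U\<^sub>1\<close>'' is a symmetric
  bilinear form with values in \<open>\<bbbF>\<^sub>2\<close>.  It is perfect (\<open>inj_form\<close>, \<open>injective_form_perfect\<close>): if
  multiplication by \<open>c\<close> preserves \<open>U\<^sub>1\<close>, then it permutes the \<open>q/2 - 1\<close> nonzero elements of \<open>U\<^sub>1\<close>, hence
  \<open>c\<close> to the power \<open>q/2 - 1\<close> is \<open>1\<close>, and since also \<open>c\<close> to the power \<open>q - 1\<close> is \<open>1\<close>, \<open>c = 1\<close>.  Now
  \<open>U\<^sub>a\<close> is the hyperplane orthogonal to \<open>1/a\<^sup>2\<close>, and \<open>y\<close> lies in \<open>O\<^sub>a\<close> exactly if \<open>a\<close> lies in \<open>U\<^sub>y\<close>, that is,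
  if \<open>1/y\<^sup>2\<close> is orthogonal to \<open>a\<close>.  So the first structure is the design of nonzero vectors and
  hyperplanes of \<open>V\<close>, and the second is its image under the inverse of the permutation \<open>y \<mapsto> 1/y\<^sup>2\<close>.
  All assertions are therefore proved for the image of the hyperplane design under an arbitrary
  permutation \<open>s\<close> of the nonzero vectors (locale \<open>transported_design\<close>), where conjugation by \<open>s\<close>
  reduces them to the hyperplane design itself.

  An automorphism of the hyperplane design preserves intersections of hyperplanes, in particular the
  lines \<open>{x, y, x + y}\<close>, and so is linear (\<open>hyperplane_automorphisms\<close>).  The stabilizer of a hyperplane
  \<open>H\<close> is faithful on the complement of \<open>H\<close>, which is an affine space over \<open>H\<close>; this gives the affine
  group.  The map sending \<open>f\<close> to its inverse adjoint with respect to the form is an automorphism of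
  the linear group that exchanges stabilizers of points with stabilizers of hyperplanes.  A hyperplane
  stabilizer fixes no nonzero vector if \<open>n \<ge> 3\<close>, so it is not conjugate to a point stabilizer; for
  \<open>n = 2\<close> a block is a single point.

  The substantial part is maximality (\<open>intermediate_group\<close>).  Let \<open>G\<close> be a group of permutations of the
  nonzero vectors that contains the linear group properly.  Call a set \<open>F\<close> of fewer than half of the
  points flat if the pointwise stabilizer of \<open>F\<close> in \<open>G\<close> is transitive on the remaining points.  Proper
  subspaces are flat, because transvections move any point off a subspace to any other one while
  fixing the subspace.  Flat sets are closed under intersection (\<open>flat_Int\<close>), so small sets have a flat
  closure.  By induction on \<open>k\<close> every set of \<open>k < 2\<^sup>n\<^sup>-\<^sup>1\<close> points is flat: if this first fails at \<open>k\<close>, then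
  \<open>G\<close> is transitive on \<open>k\<close>-sets, and the closures of \<open>k\<close>-sets are the blocks of a Steiner system in which
  any \<open>k\<close> points lie in a unique block.  Choose \<open>d\<close> with \<open>2\<^sup>d \<le> k < 2\<^sup>d\<^sup>+\<^sup>1\<close>; a block that contains \<open>k\<close> points of a
  subspace is contained in that subspace.  A counting bound (\<open>steiner_bound\<close>) within subspaces of
  dimensions \<open>d + 1\<close> and \<open>d + 2\<close> leaves only \<open>k = 2\<^sup>d\<^sup>+\<^sup>1 - 2\<close>, since for \<open>k = 2\<^sup>d\<^sup>+\<^sup>1 - 1\<close> the
  nonzero part of a subspace is a flat \<open>k\<close>-set.  For \<open>k = 2\<close> the blocks are
  the lines, so \<open>G\<close> would be linear (\<open>line_stage\<close>); for larger \<open>k\<close> a suitable \<open>k\<close>-set is preserved by enough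
  transvections to leave no room for the additional point of its block (\<open>affine_stage\<close>).

  Consequently \<open>G\<close> is transitive on sets of size \<open>2\<^sup>n\<^sup>-\<^sup>1 - 1\<close>, and a transvection and a suitable conjugate
  of it have supports that meet in one point.  Their commutator is a \<open>3\<close>-cycle (\<open>ex_three_cycle\<close>),
  so \<open>G\<close> contains all \<open>3\<close>-cycles and with them the alternating group.
\<close>

section \<open>Linear algebra in elementary abelian 2-groups\<close>

text \<open>
  A linear functional with values in \<open>\<bbbF>\<^sub>2\<close>, coded by the predicate ``the value is \<open>1\<close>''; addition in
  \<open>\<bbbF>\<^sub>2\<close> becomes exclusive or.
\<close>
definition functional :: "('a::ab_group_add \<Rightarrow> bool) \<Rightarrow> bool" where
  "functional \<phi> \<longleftrightarrow> (\<forall>x y. \<phi> (x + y) \<longleftrightarrow> \<phi> x \<noteq> \<phi> y)"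

definition subspace2 :: "'a::ab_group_add set \<Rightarrow> bool" where
  "subspace2 W \<longleftrightarrow> 0 \<in> W \<and> (\<forall>x\<in>W. \<forall>y\<in>W. x + y \<in> W)"

definition transvection :: "('a::ab_group_add \<Rightarrow> bool) \<Rightarrow> 'a \<Rightarrow> 'a \<Rightarrow> 'a" where
  "transvection \<phi> a x = (if \<phi> x then x + a else x)"

definition additive_bijections :: "('a::ab_group_add \<Rightarrow> 'a) set" where
  "additive_bijections = {f. additive f \<and> bij f}"

lemma functionalD: "functional \<phi> \<Longrightarrow> \<phi> (x + y) \<longleftrightarrow> \<phi> x \<noteq> \<phi> y"
  by (simp add: functional_def)

lemma functional_0: "functional \<phi> \<Longrightarrow> \<not> \<phi> 0"
  using functionalD[of \<phi> 0 0] by simp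

lemma subspace2_kernel: "functional \<phi> \<Longrightarrow> subspace2 {x. \<not> \<phi> x}"
  by (simp add: subspace2_def functionalD functional_0)

lemma additive_bijections_add: "f \<in> additive_bijections \<Longrightarrow> f (x + y) = f x + f y"
  by (simp add: additive_bijections_def additive.add)

lemma additive_bijections_0: "f \<in> additive_bijections \<Longrightarrow> f 0 = 0"
  by (simp add: additive_bijections_def additive.zero)

lemma additive_bijections_bij: "f \<in> additive_bijections \<Longrightarrow> bij f"
  by (simp add: additive_bijections_def)

lemma additive_bijections_comp:
  "f \<in> additive_bijections \<Longrightarrow> g \<in> additive_bijections \<Longrightarrow> f \<circ> g \<in> additive_bijections"
  by (auto simp: additive_bijections_def additive_def bij_comp)

lemma additive_bijections_inv:
  assumes f: "f \<in> additive_bijections"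
  shows "Hilbert_Choice.inv f \<in> additive_bijections"
proof -
  have b: "bij f" by (rule additive_bijections_bij[OF f])
  have "Hilbert_Choice.inv f (x + y) = Hilbert_Choice.inv f x + Hilbert_Choice.inv f y" for x y
  proof -
    have "f (Hilbert_Choice.inv f x + Hilbert_Choice.inv f y) = x + y"
      using b by (simp add: additive_bijections_add[OF f] bij_is_surj surj_f_inv_f)
    then show ?thesis
      by (metis b bij_inv_eq_iff)
  qed
  then show ?thesis
    using b by (simp add: additive_bijections_def additive_def bij_imp_bij_inv)
qed

text \<open>
  An elementary abelian \<open>2\<close>-group \<open>V\<close> of order \<open>2\<^sup>n\<close> with its set \<open>P\<close> of points.  Over \<open>\<bbbF>\<^sub>2\<close> scalar
  multiplication carries no information, so additive subgroups and additive maps are the subspaces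
  and the linear maps, and no scalars appear below.
\<close>
locale binary_space =
  fixes P :: "'a::{ab_group_add,finite} set" and n :: nat
  assumes points: "P = nonzero UNIV"
    and double: "(x::'a) + x = 0"
    and card_space: "CARD('a) = 2 ^ n"
begin

lemma add_cancel_self [simp]: "x + (x + y) = (y::'a)"
  by (metis add.assoc add.left_neutral double)

lemma add_cancel_right [simp]: "x + (y + x) = (y::'a)" "y + x + x = y" "x + y + x = y"
  using add_cancel_self[of x y] by (simp_all only: add.commute)

lemma add_eq_0 [simp]: "x + y = 0 \<longleftrightarrow> x = (y::'a)"
  by (metis add_cancel_self add.right_neutral double)

lemma add_shift [simp]: "(x + a) + (x + b) = a + (b::'a)"
proof -
  have "(x + a) + (x + b) = x + (x + (a + b))" by (simp only: ac_simps)
  then show ?thesis by simp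
qed

lemma in_P [simp]: "x \<in> P \<longleftrightarrow> x \<noteq> 0"
  by (simp add: points nonzero_def)

lemma card_P: "card P = 2 ^ n - 1"
  by (simp add: points nonzero_def card_space)

lemma inj_add: "inj_on ((+) (w::'a)) A"
  by (simp add: inj_on_def)

lemma card_kernel:
  assumes W: "subspace2 (W::'a set)" and \<phi>: "functional \<phi>" and w: "w \<in> W" "\<phi> w"
  shows "card W = 2 * card {x \<in> W. \<not> \<phi> x}"
proof -
  let ?K = "{x \<in> W. \<not> \<phi> x}" and ?L = "{x \<in> W. \<phi> x}"
  have "?L = (+) w ` ?K"
  proof (intro Set.set_eqI iffI)
    fix x assume "x \<in> ?L"
    then have "w + x \<in> ?K" "x = w + (w + x)"
      using W w by (auto simp: subspace2_def functionalD[OF \<phi>])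
    then show "x \<in> (+) w ` ?K" by blast
  qed (use W w in \<open>auto simp: subspace2_def functionalD[OF \<phi>]\<close>)
  then have "card ?L = card ?K" by (simp add: card_image inj_add)
  moreover have "card W = card ?K + card ?L"
    by (subst card_Un_disjoint[symmetric]) (auto intro!: arg_cong[of _ _ card])
  ultimately show ?thesis by simp
qed

lemma card_hyperplane:
  assumes "functional \<phi>" "\<phi> (w::'a)"
  shows "2 * card {x. \<not> \<phi> x} = 2 ^ n"
  using card_kernel[of UNIV \<phi> w] assms by (simp add: subspace2_def card_space)

lemma in_translate: "y \<in> (+) x ` W \<longleftrightarrow> x + y \<in> (W::'a set)"
  by (metis add_cancel_self image_iff)

lemma subspace2_extend:
  assumes W: "subspace2 W"
  shows "subspace2 (W \<union> (+) (x::'a) ` W)"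
  unfolding subspace2_def
proof (intro conjI ballI)
  have closed: "a + b \<in> W" if "a \<in> W" "b \<in> W" for a b
    using W that by (simp add: subspace2_def)
  show "0 \<in> W \<union> (+) x ` W" using W by (simp add: subspace2_def)
  fix a b assume "a \<in> W \<union> (+) x ` W" "b \<in> W \<union> (+) x ` W"
  then show "a + b \<in> W \<union> (+) x ` W"
    using closed[of a b] closed[of "x + a" b] closed[of a "x + b"] closed[of "x + a" "x + b"]
    add_shift[of x a b]
    by (auto simp only: Un_iff in_translate add.assoc add.left_commute[of a x b] simp del: add_shift)
qed

lemma card_extend:
  assumes W: "subspace2 W" and x: "(x::'a) \<notin> W"
  shows "card (W \<union> (+) x ` W) = 2 * card W"
proof -
  have "W \<inter> (+) x ` W = {}"
  proof -
    have False if "w \<in> W" "x + w \<in> W" for w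
    proof -
      have "w + (x + w) \<in> W" using W that unfolding subspace2_def by blast
      then show False using x by simp
    qed
    then show ?thesis by blast
  qed
  then show ?thesis
    by (subst card_Un_disjoint) (auto simp: card_image inj_add)
qed

text \<open>
  Take a subspace \<open>M\<close> that is maximal among those containing \<open>W\<close> but not \<open>y\<close>.  For \<open>z\<close> outside \<open>M\<close>
  the subspace spanned by \<open>M\<close> and \<open>z\<close> contains \<open>y\<close>, so \<open>z\<close> lies in the coset \<open>y + M\<close>: the complement of \<open>M\<close> is
  one coset, and membership in it is a functional.
\<close>
lemma separation:
  assumes W: "subspace2 W" and y: "(y::'a) \<notin> W"
  obtains \<phi> where "functional \<phi>" "\<And>w. w \<in> W \<Longrightarrow> \<not> \<phi> w" "\<phi> y"
proof -
  let ?S = "{M. subspace2 M \<and> W \<subseteq> M \<and> y \<notin> M}"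
  have "finite ?S" by simp
  moreover have "W \<in> ?S" using assms by simp
  ultimately obtain M where M: "M \<in> ?S" and max: "\<And>N. N \<in> ?S \<Longrightarrow> M \<subseteq> N \<Longrightarrow> N = M"
    using finite_has_maximal2[of ?S W] by (metis (no_types, lifting))
  have sub: "subspace2 M" using M by simp
  have outside: "y + z \<in> M" if "z \<notin> M" for z
  proof -
    have "M \<union> (+) z ` M \<noteq> M" using sub that by (force simp: subspace2_def)
    then have "y \<in> M \<union> (+) z ` M"
      using max[of "M \<union> (+) z ` M"] subspace2_extend[OF sub, of z] M by blast
    then obtain m where "m \<in> M" "y = z + m" using M by blast
    then show ?thesis by (simp add: add.commute)
  qed
  have 1: "x + z \<in> M" if "x \<notin> M" "z \<notin> M" for x z
  proof -
    have "(y + x) + (y + z) \<in> M" using outside that sub unfolding subspace2_def by blast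
    then show ?thesis by (simp add: ac_simps)
  qed
  have 2: "x + z \<notin> M" if "x \<in> M" "z \<notin> M" for x z
  proof
    assume "x + z \<in> M"
    then have "x + (x + z) \<in> M" using that sub unfolding subspace2_def by blast
    then show False using that by simp
  qed
  have "functional (\<lambda>x. x \<notin> M)"
    unfolding functional_def using 1 2 sub by (metis add.commute subspace2_def)
  then show thesis using that M by blast
qed

lemma subspace2_zero: "subspace2 {0::'a}"
  by (simp add: subspace2_def)

lemma ex_subspace:
  assumes "subspace2 (W0::'a set)" "card W0 = 2 ^ j" "j \<le> m" "m \<le> n"
  shows "\<exists>W. subspace2 W \<and> W0 \<subseteq> W \<and> card W = 2 ^ m"
  using assms(3,4)
proof (induction m rule: dec_induct)
  case base then show ?case using assms by blast
next
  case (step m)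
  then obtain W where W: "subspace2 W" "W0 \<subseteq> W" "card W = 2 ^ m" by auto
  have "card W < CARD('a)" using step.prems by (simp add: W card_space)
  then obtain x where "x \<notin> W" by (metis UNIV_eq_I less_irrefl)
  then show ?case
    using W subspace2_extend[OF W(1), of x] card_extend[OF W(1), of x]
    by (intro exI[of _ "W \<union> (+) x ` W"]) auto
qed

lemma transvection_add:
  assumes "functional \<phi>"
  shows "transvection \<phi> a (x + y) = transvection \<phi> a x + transvection \<phi> (a::'a) y"
proof -
  have "(x + a) + (y + a) = x + y" using add_shift[of a x y] by (simp add: add.commute)
  then show ?thesis by (auto simp: transvection_def functionalD[OF assms] ac_simps)
qed

lemma transvection_involution:
  assumes "functional \<phi>" "\<not> \<phi> a"
  shows "transvection \<phi> a (transvection \<phi> a x) = (x::'a)"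
  using assms by (auto simp: transvection_def functionalD add.commute)

lemma transvection_involution_comp:
  assumes "functional \<phi>" "\<not> \<phi> (a::'a)"
  shows "transvection \<phi> a \<circ> transvection \<phi> a = id"
  using transvection_involution[OF assms] by (simp add: fun_eq_iff)

lemma transvection_in:
  assumes "functional \<phi>" "\<not> \<phi> a"
  shows "transvection \<phi> (a::'a) \<in> additive_bijections"
  using transvection_involution_comp[OF assms] transvection_add[OF assms(1)]
  by (auto simp: additive_bijections_def additive_def intro: o_bij)

text \<open>
  The functional must be \<open>1\<close> at \<open>x\<close> and vanish on \<open>W\<close> and at \<open>x + y\<close>.  It exists because
  \<open>x\<close> lies outside the span of \<open>W\<close> and \<open>x + y\<close>.
\<close>
lemma transvection_move:
  assumes W: "subspace2 W" and x: "x \<notin> W" and y: "(y::'a) \<notin> W"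
  obtains \<phi> where "functional \<phi>" "\<not> \<phi> (x + y)" "\<And>w. w \<in> W \<Longrightarrow> \<not> \<phi> w"
    "transvection \<phi> (x + y) x = y"
proof -
  let ?W = "W \<union> (+) (x + y) ` W"
  have "x \<notin> ?W"
  proof
    assume "x \<in> ?W"
    then obtain w where "w \<in> W" "x = x + y + w" using x by auto
    then have "y = w" by (metis add.assoc add_cancel_self double add_eq_0)
    then show False using y \<open>w \<in> W\<close> by simp
  qed
  then obtain \<phi> where \<phi>: "functional \<phi>" "\<And>w. w \<in> ?W \<Longrightarrow> \<not> \<phi> w" "\<phi> x"
    using separation[OF subspace2_extend[OF W]] by metis
  have "0 \<in> W" using W by (simp add: subspace2_def)
  then have "x + y \<in> ?W" by force
  then show thesis
    using that[of \<phi>] \<phi> by (auto simp: transvection_def)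
qed

text \<open>
  Composing \<open>f\<close> with transvections enlarges a subspace that is fixed pointwise until it is the whole
  space: if \<open>f\<close> fixes \<open>W\<close> pointwise and \<open>x\<close> is outside \<open>W\<close>, then so is \<open>f x\<close>, and a transvection that
  fixes \<open>W\<close> pointwise takes \<open>f x\<close> back to \<open>x\<close>.
\<close>
lemma transvections_generate:
  assumes comp: "\<And>f g. f \<in> G \<Longrightarrow> g \<in> G \<Longrightarrow> f \<circ> g \<in> G"
    and trans: "\<And>\<phi> a. functional \<phi> \<Longrightarrow> \<not> \<phi> a \<Longrightarrow> transvection \<phi> (a::'a) \<in> G"
  shows "additive_bijections \<subseteq> G"
proof -
  have main: "f \<in> G" if "f \<in> additive_bijections" "subspace2 W" "\<And>w. w \<in> W \<Longrightarrow> f w = w"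
      "CARD('a) - card W = m" for f W m
    using that
  proof (induction m arbitrary: f W rule: less_induct)
    case (less m)
    show ?case
    proof (cases "W = UNIV")
      case True
      then have "f = transvection (\<lambda>_. False) 0"
        using less.prems by (auto simp: transvection_def fun_eq_iff)
      then show ?thesis using trans by (simp add: functional_def)
    next
      case False
      then obtain x where x: "x \<notin> W" by auto
      have fx: "f x \<notin> W"
        using less.prems(1,3) x by (metis additive_bijections_bij bij_pointE)
      obtain \<phi> where \<phi>: "functional \<phi>" "\<not> \<phi> (f x + x)" "\<And>w. w \<in> W \<Longrightarrow> \<not> \<phi> w"
        and mv: "transvection \<phi> (f x + x) (f x) = x"
        using transvection_move[OF less.prems(2) fx x] by metis
      let ?t = "transvection \<phi> (f x + x)"
      have t: "?t \<in> additive_bijections" using \<phi> by (rule_tac transvection_in)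
      have fix_W: "(?t \<circ> f) w = w" if "w \<in> W" for w
        using less.prems(3)[OF that] \<phi>(3)[OF that] by (simp add: transvection_def)
      have tf: "?t \<circ> f \<in> additive_bijections"
        using t less.prems(1) by (rule additive_bijections_comp)
      have fixes_ext: "(?t \<circ> f) w = w" if "w \<in> W \<union> (+) x ` W" for w
        using that fix_W mv additive_bijections_add[OF tf] by auto
      have cW: "card (W \<union> (+) x ` W) = 2 * card W" by (rule card_extend[OF less.prems(2) x])
      have "0 \<in> W" using less.prems(2) by (simp add: subspace2_def)
      then have "card W > 0" by (auto simp: card_gt_0_iff)
      moreover have "card (W \<union> (+) x ` W) \<le> CARD('a)" by (rule card_mono) auto
      ultimately have "CARD('a) - card (W \<union> (+) x ` W) < m" using cW less.prems(4) by linarith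
      then have "?t \<circ> f \<in> G"
        using less.IH[OF _ tf subspace2_extend[OF less.prems(2)] fixes_ext refl] by blast
      then have "?t \<circ> (?t \<circ> f) \<in> G" using trans[OF \<phi>(1,2)] comp by blast
      moreover have "?t \<circ> (?t \<circ> f) = f"
        using transvection_involution[OF \<phi>(1,2)] by (simp add: fun_eq_iff)
      ultimately show ?thesis by simp
    qed
  qed
  show ?thesis
    using main[of _ "{0}"] subspace2_zero by (auto simp: additive_bijections_0)
qed

lemma additive_bijections_permutes:
  assumes f: "f \<in> additive_bijections"
  shows "f permutes P"
proof (rule bij_imp_permutes)
  have b: "bij f" by (rule additive_bijections_bij[OF f])
  then have "f x = 0 \<longleftrightarrow> x = 0" for x
    using additive_bijections_0[OF f] by (metis bij_pointE)
  then have "f ` (- {0}) = - {0}"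
    using b by (metis bij_image_Compl_eq additive_bijections_0[OF f] image_empty image_insert)
  moreover have "P = - {0}" by auto
  ultimately show "bij_betw f P P"
    using b by (metis bij_betw_imageI bij_is_inj inj_on_subset subset_UNIV)
  show "f x = x" if "x \<notin> P" for x using that additive_bijections_0[OF f] by simp
qed

lemma permutation_additive: "f \<in> additive_bijections \<Longrightarrow> permutation (f::'a \<Rightarrow> 'a)"
  using additive_bijections_permutes permutation_permutes by (metis finite)

text \<open>
  Transvections with the same functional and nonzero centres are conjugate, so they have
  the same sign.  As \<open>n \<ge> 3\<close>, the kernel of the functional contains two different nonzero
  centres \<open>a\<close> and \<open>b\<close>, and composing the transvections with centres \<open>a\<close> and \<open>b\<close> yields the one with centre
  \<open>a + b\<close>; so the common sign equals its own square.
\<close>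
lemma additive_bijections_even:
  assumes n: "n \<ge> 3" and f: "f \<in> additive_bijections"
  shows "evenperm (f::'a \<Rightarrow> 'a)"
proof -
  have conj: "evenperm (transvection \<phi> a) = evenperm (transvection \<phi> b)"
    if \<phi>: "functional \<phi>" "\<not> \<phi> a" "\<not> \<phi> (b::'a)" and ab: "a \<noteq> 0" "b \<noteq> 0" for \<phi> a b
  proof -
    obtain \<psi> where \<psi>: "functional \<psi>" "\<not> \<psi> (a + b)" "transvection \<psi> (a + b) a = b"
      using transvection_move[OF subspace2_zero, of a b] ab by auto
    let ?h = "transvection \<psi> (a + b)"
    have h: "?h \<in> additive_bijections" by (rule transvection_in[OF \<psi>(1,2)])
    have ta: "transvection \<phi> a \<in> additive_bijections" and tb: "transvection \<phi> b \<in> additive_bijections"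
      using transvection_in \<phi> by auto
    have eq: "?h \<circ> transvection \<phi> a = transvection \<phi> b \<circ> ?h"
    proof
      fix x
      have "\<phi> (?h x) = \<phi> x"
        using \<phi> by (simp add: transvection_def functionalD)
      then show "(?h \<circ> transvection \<phi> a) x = (transvection \<phi> b \<circ> ?h) x"
        using additive_bijections_add[OF h, of x a] \<psi>(3)
        by (simp add: transvection_def[of \<phi>])
    qed
    have "evenperm (?h \<circ> transvection \<phi> a) = (evenperm ?h = evenperm (transvection \<phi> a))"
      by (rule evenperm_comp) (use h ta permutation_additive in auto)
    moreover have "evenperm (transvection \<phi> b \<circ> ?h) = (evenperm (transvection \<phi> b) = evenperm ?h)"
      by (rule evenperm_comp) (use h tb permutation_additive in auto)
    ultimately show ?thesis using eq by auto
  qed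
  have even: "evenperm (transvection \<phi> a)" if \<phi>: "functional \<phi>" "\<not> \<phi> (a::'a)" for \<phi> a
  proof (cases "a = 0")
    case True
    then have "transvection \<phi> a = id" by (auto simp: transvection_def fun_eq_iff)
    then show ?thesis by simp
  next
    case False
    have "\<exists>b. b \<notin> {0, a} \<and> \<not> \<phi> b"
    proof (rule ccontr)
      assume "\<not> ?thesis"
      then have "{x. \<not> \<phi> x} \<subseteq> {0, a}" by auto
      then have "card {x. \<not> \<phi> x} \<le> card {0, a}" by (rule card_mono[rotated]) simp
      then have "2 * card {x. \<not> \<phi> x} \<le> 4" using card_insert_le_m1[of 2 "{a}" 0] by simp
      moreover have "(2::nat) ^ n \<ge> 2 ^ 3" using n by (intro power_increasing) auto
      moreover have "2 * card {x. \<not> \<phi> x} = 2 ^ n \<or> card {x. \<not> \<phi> x} = 2 ^ n"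
        using card_hyperplane[OF \<phi>(1)] card_space by (cases "\<exists>w. \<phi> w") auto
      ultimately show False by auto
    qed
    then obtain b where b: "b \<noteq> 0" "b \<noteq> a" "\<not> \<phi> b" by auto
    have "transvection \<phi> a \<circ> transvection \<phi> b = transvection \<phi> (a + b)"
      using b(3) by (auto simp: transvection_def fun_eq_iff functionalD[OF \<phi>(1)] ac_simps)
    moreover have "evenperm (transvection \<phi> a \<circ> transvection \<phi> b)
        = (evenperm (transvection \<phi> a) = evenperm (transvection \<phi> b))"
      by (rule evenperm_comp) (use transvection_in \<phi> b permutation_additive in auto)
    moreover have "evenperm (transvection \<phi> a) = evenperm (transvection \<phi> b)"
      using conj \<phi> False b by blast
    moreover have "evenperm (transvection \<phi> a) = evenperm (transvection \<phi> (a + b))"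
      using conj[of \<phi> a "a + b"] \<phi> False b by (auto simp: functionalD)
    ultimately show ?thesis by simp
  qed
  have "additive_bijections \<subseteq> {g::'a \<Rightarrow> 'a. permutation g \<and> evenperm g}"
    by (rule transvections_generate)
       (auto simp: even evenperm_comp permutation_compose permutation_additive transvection_in)
  then show ?thesis using f by blast
qed

end

section \<open>Three-cycles generate the alternating group\<close>

definition three_cycle :: "'p \<Rightarrow> 'p \<Rightarrow> 'p \<Rightarrow> 'p \<Rightarrow> 'p" where
  "three_cycle a b c = Transposition.transpose a b \<circ> Transposition.transpose b c"

lemma three_cycle_apply:
  assumes "a \<noteq> b" "b \<noteq> c" "a \<noteq> c"
  shows "three_cycle a b c x = (if x = a then b else if x = b then c else if x = c then a else x)"
  using assms by (auto simp: three_cycle_def Transposition.transpose_def)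

lemma even_three_cycle:
  assumes "a \<noteq> b" "b \<noteq> c" "a \<noteq> c"
  shows "evenperm (three_cycle a b c)"
  using assms
  by (simp add: three_cycle_def evenperm_comp evenperm_swap permutation_swap_id)

text \<open>
  If \<open>\<sigma>\<close> moves \<open>a\<close> to \<open>b\<close>, a \<open>3\<close>-cycle through \<open>b\<close>, \<open>a\<close> and a third point takes \<open>b\<close> back to \<open>a\<close> and leaves an
  even permutation of one point less.  The third point exists because a permutation of \<open>{a, b}\<close> that
  moves \<open>a\<close> is a transposition.
\<close>
lemma three_cycles_generate_even:
  assumes "finite S" "S \<subseteq> T"
    and id: "id \<in> G"
    and comp: "\<And>f g. f \<in> G \<Longrightarrow> g \<in> G \<Longrightarrow> f \<circ> g \<in> G"
    and cyc: "\<And>a b c. {a, b, c} \<subseteq> T \<Longrightarrow> a \<noteq> b \<Longrightarrow> b \<noteq> c \<Longrightarrow> a \<noteq> c \<Longrightarrow> three_cycle a b c \<in> G"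
    and "\<sigma> permutes S" "evenperm \<sigma>"
  shows "\<sigma> \<in> G"
  using assms(1,2,6,7)
proof (induction S arbitrary: \<sigma> rule: finite_induct)
  case empty
  then show ?case using id by (simp add: permutes_empty id_def)
next
  case (insert a S)
  note perm = insert.prems(2)
  have fix_case: "\<rho> \<in> G" if "\<rho> permutes insert a S" "\<rho> a = a" "evenperm \<rho>" for \<rho>
  proof (rule insert.IH)
    show "\<rho> permutes S"
      by (rule permutes_superset[OF that(1)]) (use that(2) in auto)
  qed (use insert.prems that in auto)
  show ?case
  proof (cases "\<sigma> a = a")
    case True then show ?thesis using fix_case insert.prems by blast
  next
    case False
    define b where "b = \<sigma> a"
    have b: "b \<in> S" "b \<noteq> a"
      using False permutes_in_image[OF perm, of a] by (auto simp: b_def)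
    have "S \<noteq> {b}"
    proof
      assume S: "S = {b}"
      have "\<sigma> b = a"
        using permutes_in_image[OF perm, of b] permutes_inj[OF perm] b
        by (auto simp: S b_def dest: injD)
      have "\<sigma> = Transposition.transpose a b"
      proof
        show "\<sigma> x = Transposition.transpose a b x" for x
          using permutes_not_in[OF perm, of x] \<open>\<sigma> b = a\<close>
          by (auto simp: S b_def Transposition.transpose_def)
      qed
      then show False using insert.prems(3) b by (simp add: evenperm_swap)
    qed
    then obtain c where c: "c \<in> S" "c \<noteq> b" using b by blast
    have dist: "a \<noteq> c" using c insert.hyps by blast
    let ?\<tau> = "three_cycle b a c"
    have app: "?\<tau> x = (if x = b then a else if x = a then c else if x = c then b else x)" for x
      using b c dist by (simp add: three_cycle_apply)
    have "?\<tau> permutes insert a S"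
      unfolding three_cycle_def
      by (intro permutes_compose permutes_swap_id) (use b c in auto)
    then have p: "(?\<tau> \<circ> \<sigma>) permutes insert a S" using perm by (intro permutes_compose)
    have "finite (insert a S)" using insert.hyps(1) by simp
    then have "permutation ?\<tau>" "permutation \<sigma>"
      using perm \<open>?\<tau> permutes insert a S\<close> unfolding permutation_permutes by blast+
    then have "evenperm (?\<tau> \<circ> \<sigma>) = (evenperm ?\<tau> = evenperm \<sigma>)" by (rule evenperm_comp)
    moreover have "evenperm ?\<tau>" using even_three_cycle b c dist by metis
    ultimately have "?\<tau> \<circ> \<sigma> \<in> G"
      using p insert.prems(3) by (intro fix_case) (auto simp: app b_def[symmetric])
    moreover have "three_cycle b c a \<in> G"
      using cyc[of b c a] insert.prems(1) b c dist by auto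
    ultimately have "three_cycle b c a \<circ> (?\<tau> \<circ> \<sigma>) \<in> G" using comp by blast
    moreover have "three_cycle b c a \<circ> (?\<tau> \<circ> \<sigma>) = \<sigma>"
      using b c dist by (auto simp: fun_eq_iff three_cycle_apply)
    ultimately show ?thesis by simp
  qed
qed

section \<open>Flat sets of a group containing the linear group\<close>

text \<open>
  A permutation group that contains the linear group properly.  Only transvections are asked
  for, since they generate the linear group.
\<close>
locale overgroup = binary_space P n for P :: "'a::{ab_group_add,finite} set" and n +
  fixes G :: "('a \<Rightarrow> 'a) set"
  assumes n_ge_3: "n \<ge> 3"
    and perm: "\<And>g. g \<in> G \<Longrightarrow> g permutes P"
    and comp: "\<And>f g. f \<in> G \<Longrightarrow> g \<in> G \<Longrightarrow> f \<circ> g \<in> G"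
    and inv: "\<And>g. g \<in> G \<Longrightarrow> Hilbert_Choice.inv g \<in> G"
    and trans: "\<And>\<phi> a. functional \<phi> \<Longrightarrow> \<not> \<phi> a \<Longrightarrow> transvection \<phi> a \<in> G"
    and nonadditive: "\<exists>g\<in>G. \<not> additive g"
begin

lemma id_in: "id \<in> G"
proof -
  have "transvection (\<lambda>_. False) 0 = (id :: 'a \<Rightarrow> 'a)"
    by (auto simp: transvection_def fun_eq_iff)
  then show ?thesis using trans[of "\<lambda>_. False" 0] by (simp add: functional_def)
qed

lemma inj_G: "g \<in> G \<Longrightarrow> inj g"
  using perm permutes_inj by blast

lemma inj_on_G: "g \<in> G \<Longrightarrow> inj_on g A"
  using inj_G inj_on_subset by blast

lemma G_in_P: "g \<in> G \<Longrightarrow> g x = 0 \<longleftrightarrow> x = 0"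
  using permutes_in_image[OF perm, of g x] by simp

lemma image_P: "g \<in> G \<Longrightarrow> X \<subseteq> P \<Longrightarrow> g ` X \<subseteq> P"
  by (auto simp: G_in_P)

lemma inv_apply [simp]:
  "g \<in> G \<Longrightarrow> Hilbert_Choice.inv g (g x) = x" "g \<in> G \<Longrightarrow> g (Hilbert_Choice.inv g x) = x"
  using permutes_inverses perm by metis+

lemma inv_image [simp]: "g \<in> G \<Longrightarrow> Hilbert_Choice.inv g ` g ` X = X"
  by (force simp: image_image)

text \<open>
  The size condition says that \<open>F\<close> has fewer than half of the \<open>2\<^sup>n - 1\<close> points.  It ensures that
  the complements of any two flat sets meet.
\<close>
definition flat :: "'a set \<Rightarrow> bool" where
  "flat F \<longleftrightarrow> F \<subseteq> P \<and> 2 * card F + 2 \<le> 2 ^ n \<and>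
     (\<forall>x\<in>P - F. \<forall>y\<in>P - F. \<exists>g\<in>G. (\<forall>z\<in>F. g z = z) \<and> g x = y)"

lemma flatD: "flat F \<Longrightarrow> x \<in> P - F \<Longrightarrow> y \<in> P - F \<Longrightarrow> \<exists>g\<in>G. (\<forall>z\<in>F. g z = z) \<and> g x = y"
  by (simp add: flat_def)

lemma flat_image:
  assumes g: "g \<in> G" and F: "flat F"
  shows "flat (g ` F)"
  unfolding flat_def
proof (intro conjI ballI)
  show "g ` F \<subseteq> P" using F image_P[OF g] by (simp add: flat_def)
  show "2 * card (g ` F) + 2 \<le> 2 ^ n"
    using F by (simp add: flat_def card_image[OF inj_on_G[OF g]])
  fix x y assume xy: "x \<in> P - g ` F" "y \<in> P - g ` F"
  let ?i = "Hilbert_Choice.inv g"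
  have "?i x \<in> P - F" "?i y \<in> P - F"
    using xy g by (auto simp: G_in_P[OF inv[OF g]] dest: imageI[of _ F g])
  then obtain h where h: "h \<in> G" "\<forall>z\<in>F. h z = z" "h (?i x) = ?i y"
    using flatD[OF F] by blast
  have "g \<circ> h \<circ> ?i \<in> G" using g h(1) comp inv by blast
  moreover have "(g \<circ> h \<circ> ?i) x = y" "\<forall>z\<in>g ` F. (g \<circ> h \<circ> ?i) z = z"
    using h g by auto
  ultimately show "\<exists>g'\<in>G. (\<forall>z\<in>g ` F. g' z = z) \<and> g' x = y" by blast
qed

text \<open>
  Any point outside \<open>F \<inter> E\<close> can be moved to a common point \<open>z\<close> of the two complements by an element that
  fixes \<open>F\<close> or \<open>E\<close> pointwise, and so fixes \<open>F \<inter> E\<close> pointwise in either case.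
\<close>
lemma flat_Int:
  assumes F: "flat F" and E: "flat E"
  shows "flat (F \<inter> E)"
  unfolding flat_def
proof (intro conjI ballI)
  show "F \<inter> E \<subseteq> P" using F by (auto simp: flat_def)
  have "card (F \<inter> E) \<le> card F" by (rule card_mono) auto
  then show "2 * card (F \<inter> E) + 2 \<le> 2 ^ n" using F by (simp add: flat_def)
  \<comment> \<open>Both flats are smaller than half of the points, so their complements meet.\<close>
  have "card (F \<union> E) \<le> card F + card E" by (rule card_Un_le)
  also have "\<dots> < card P"
  proof -
    have "2 * card F + 2 \<le> 2 ^ n" "2 * card E + 2 \<le> 2 ^ n" using F E by (auto simp: flat_def)
    then show ?thesis unfolding card_P by linarith
  qed
  finally obtain z where z: "z \<in> P" "z \<notin> F \<union> E"
    by (metis card_mono finite not_le subsetI)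
  have to_z: "\<exists>g\<in>G. (\<forall>w\<in>F \<inter> E. g w = w) \<and> g x = z" if "x \<in> P - F \<inter> E" for x
    using that z flatD[OF F, of x z] flatD[OF E, of x z] by blast
  fix x y assume "x \<in> P - F \<inter> E" "y \<in> P - F \<inter> E"
  with to_z obtain g h where g: "g \<in> G" "\<forall>w\<in>F \<inter> E. g w = w" "g x = z"
    and h: "h \<in> G" "\<forall>w\<in>F \<inter> E. h w = w" "h y = z" by metis
  have "Hilbert_Choice.inv h \<circ> g \<in> G" using g h comp inv by blast
  moreover have "(Hilbert_Choice.inv h \<circ> g) x = y" using g h(1) h(3)[symmetric] by simp
  moreover have "(Hilbert_Choice.inv h \<circ> g) w = w" if w: "w \<in> F \<inter> E" for w
  proof -
    have "Hilbert_Choice.inv h w = Hilbert_Choice.inv h (h w)" using h(2) w by simp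
    then show ?thesis using g(2) w h(1) by simp
  qed
  ultimately show "\<exists>g\<in>G. (\<forall>z\<in>F \<inter> E. g z = z) \<and> g x = y" by blast
qed

lemma flat_Inter:
  assumes "finite A" "A \<noteq> {}" "\<And>F. F \<in> A \<Longrightarrow> flat F"
  shows "flat (\<Inter>A)"
  using assms by (induction A rule: finite_ne_induct) (auto intro: flat_Int)

lemma flat_subspace:
  assumes W: "subspace2 W" and proper: "W \<noteq> UNIV"
  shows "flat (W - {0})"
  unfolding flat_def
proof (intro conjI ballI)
  obtain v where v: "v \<notin> W" using proper by blast
  obtain \<phi> where \<phi>: "functional \<phi>" "\<And>w. w \<in> W \<Longrightarrow> \<not> \<phi> w" "\<phi> v"
    using separation[OF W v] by metis
  have "card W \<le> card {x. \<not> \<phi> x}" using \<phi>(2) by (intro card_mono) auto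
  then have "2 * card W \<le> 2 ^ n" using card_hyperplane[OF \<phi>(1,3)] by simp
  moreover have "card (W - {0}) = card W - 1" "card W > 0"
    using W by (auto simp: subspace2_def card_gt_0_iff)
  ultimately show "2 * card (W - {0}) + 2 \<le> 2 ^ n" by simp
  fix x y assume "x \<in> P - (W - {0})" "y \<in> P - (W - {0})"
  then have "x \<notin> W" "y \<notin> W" by auto
  then obtain \<psi> where "functional \<psi>" "\<not> \<psi> (x + y)" "\<And>w. w \<in> W \<Longrightarrow> \<not> \<psi> w"
    "transvection \<psi> (x + y) x = y"
    using transvection_move[OF W] by metis
  then show "\<exists>g\<in>G. (\<forall>z\<in>W - {0}. g z = z) \<and> g x = y"
    by (intro bexI[of _ "transvection \<psi> (x + y)"] trans) (auto simp: transvection_def)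
qed auto

definition homogeneous :: "nat \<Rightarrow> bool" where
  "homogeneous k \<longleftrightarrow>
     (\<forall>X Y. X \<subseteq> P \<and> Y \<subseteq> P \<and> card X = k \<and> card Y = k \<longrightarrow> (\<exists>g\<in>G. g ` X = Y))"

lemma homogeneous_0: "homogeneous 0"
  using id_in by (auto simp: homogeneous_def)

text \<open>
  After matching \<open>k\<close> points of \<open>X\<close> with \<open>k\<close> points of \<open>Y\<close>, flatness of the latter moves the
  remaining point to its target without disturbing them.
\<close>
lemma homogeneous_Suc:
  assumes hom: "homogeneous k" and flats: "\<And>X. X \<subseteq> P \<Longrightarrow> card X = k \<Longrightarrow> flat X"
  shows "homogeneous (Suc k)"
  unfolding homogeneous_def
proof (intro allI impI, elim conjE)
  fix X Y assume X: "X \<subseteq> P" "card X = Suc k" and Y: "Y \<subseteq> P" "card Y = Suc k"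
  obtain x X' where X': "X = insert x X'" "x \<notin> X'" "card X' = k"
    using X(2) by (metis card_Suc_eq)
  obtain y Y' where Y': "Y = insert y Y'" "y \<notin> Y'" "card Y' = k"
    using Y(2) by (metis card_Suc_eq)
  have "X' \<subseteq> P" "Y' \<subseteq> P" using X Y X' Y' by auto
  then obtain g where g: "g \<in> G" "g ` X' = Y'"
    using hom X'(3) Y'(3) unfolding homogeneous_def by blast
  have "g x \<in> P - Y'"
    using X' g X(1) inj_image_mem_iff[OF inj_G[OF g(1)], of x X'] by (auto simp: G_in_P)
  moreover have "y \<in> P - Y'" using Y Y' by auto
  ultimately obtain h where h: "h \<in> G" "\<forall>z\<in>Y'. h z = z" "h (g x) = y"
    using flatD[OF flats[OF \<open>Y' \<subseteq> P\<close> Y'(3)]] by blast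
  have "(h \<circ> g) ` X = insert (h (g x)) (h ` g ` X')" by (simp add: X'(1) image_comp)
  also have "h ` g ` X' = Y'" using g h(2) by force
  finally have "(h \<circ> g) ` X = Y" using Y'(1) h(3) by simp
  then show "\<exists>g\<in>G. g ` X = Y" using comp g h by blast
qed

text \<open>
  The flat closure; it is \<open>UNIV\<close> if no flat set contains \<open>X\<close>.
\<close>
definition cl :: "'a set \<Rightarrow> 'a set" where
  "cl X = \<Inter>{F. flat F \<and> X \<subseteq> F}"

lemma subset_cl: "X \<subseteq> cl X"
  by (auto simp: cl_def)

lemma cl_least: "flat F \<Longrightarrow> X \<subseteq> F \<Longrightarrow> cl X \<subseteq> F"
  by (auto simp: cl_def)

lemma flat_cl: "flat F \<Longrightarrow> X \<subseteq> F \<Longrightarrow> flat (cl X)"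
  unfolding cl_def by (rule flat_Inter) auto

end

section \<open>The Steiner system of a first nonflat size\<close>

text \<open>
  The situation at the smallest \<open>k\<close> for which some \<open>k\<close>-set fails to be flat: by homogeneity
  then no \<open>k\<close>-set is flat.  These assumptions will turn out to be contradictory.
\<close>
locale nonflat_stage = overgroup P n G for P :: "'a::{ab_group_add,finite} set" and n G +
  fixes k :: nat
  assumes k_small: "k < 2 ^ (n - 1)"
    and hom: "homogeneous k"
    and nonflat: "\<And>X. X \<subseteq> P \<Longrightarrow> card X = k \<Longrightarrow> \<not> flat X"
begin

text \<open>
  A hyperplane has \<open>2\<^sup>n\<^sup>-\<^sup>1 - 1\<close> nonzero vectors, enough to contain some \<open>k\<close>-set; by homogeneity every
  \<open>k\<close>-set is then contained in an image of that flat set.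
\<close>
lemma flat_cl_k:
  assumes X: "X \<subseteq> P" "card X = k"
  shows "flat (cl X)"
proof -
  have "\<exists>W. subspace2 W \<and> {0::'a} \<subseteq> W \<and> card W = 2 ^ (n - 1)"
    by (rule ex_subspace[OF subspace2_zero, of 0]) auto
  then obtain W :: "'a set" where W: "subspace2 W" "card W = 2 ^ (n - 1)" by blast
  have "card (W - {0}) = 2 ^ (n - 1) - 1"
    using W by (simp add: subspace2_def)
  then have "k \<le> card (W - {0})" using k_small by linarith
  then obtain Y where Y: "Y \<subseteq> W - {0}" "card Y = k"
    by (rule obtain_subset_with_card_n)
  have "(2::nat) ^ (n - 1) < 2 ^ n" using n_ge_3 by (intro power_strict_increasing) auto
  then have "W \<noteq> UNIV" using W(2) card_space by auto
  then have F: "flat (W - {0})" by (rule flat_subspace[OF W(1)])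
  have "Y \<subseteq> P" using Y by auto
  obtain g where "g \<in> G" "g ` Y = X"
    using hom X Y \<open>Y \<subseteq> P\<close> unfolding homogeneous_def by blast
  then show ?thesis using Y flat_image[OF _ F] flat_cl[of "g ` (W - {0})" X] by blast
qed

lemma cl_P: "X \<subseteq> P \<Longrightarrow> card X = k \<Longrightarrow> cl X \<subseteq> P"
  using flat_cl_k flat_def by blast

lemma cl_image:
  assumes X: "X \<subseteq> P" "card X = k" and g: "g \<in> G"
  shows "cl (g ` X) = g ` cl X"
proof
  have sub: "cl (h ` Z) \<subseteq> h ` cl Z" if "Z \<subseteq> P" "card Z = k" "h \<in> G" for h Z
    using that by (intro cl_least flat_image flat_cl_k image_mono subset_cl)
  show "cl (g ` X) \<subseteq> g ` cl X" using sub assms by blast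
  have "cl (Hilbert_Choice.inv g ` g ` X) \<subseteq> Hilbert_Choice.inv g ` cl (g ` X)"
    using assms image_P[OF g X(1)] by (intro sub inv) (auto simp: card_image inj_on_G)
  then have "g ` cl X \<subseteq> g ` Hilbert_Choice.inv g ` cl (g ` X)"
    using g by (simp add: image_mono)
  then show "g ` cl X \<subseteq> cl (g ` X)" using g by (simp add: image_image)
qed

lemma card_cl_eq:
  assumes "X \<subseteq> P" "card X = k" "Y \<subseteq> P" "card Y = k"
  shows "card (cl X) = card (cl Y)"
proof -
  obtain g where g: "g \<in> G" "g ` X = Y" using hom assms unfolding homogeneous_def by blast
  then have "cl Y = g ` cl X" using cl_image assms by blast
  then show ?thesis using g by (simp add: card_image inj_on_G)
qed

lemma card_cl_greater:
  assumes X: "X \<subseteq> P" "card X = k"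
  shows "k < card (cl X)"
proof -
  have "X \<noteq> cl X" using flat_cl_k[OF X] nonflat[OF X] by auto
  then have "X \<subset> cl X" using subset_cl by blast
  then show ?thesis using X(2) psubset_card_mono[of "cl X" X] by simp
qed

text \<open>
  The Steiner property: the closure of \<open>X\<close> is contained in that of \<open>Y\<close> and has the same size.
\<close>
lemma cl_eq:
  assumes "X \<subseteq> P" "card X = k" "Y \<subseteq> P" "card Y = k" "X \<subseteq> cl Y"
  shows "cl X = cl Y"
proof (rule card_subset_eq)
  show "cl X \<subseteq> cl Y" using assms by (intro cl_least flat_cl_k)
  show "card (cl X) = card (cl Y)" using assms(1-4) by (rule card_cl_eq)
qed simp

lemma cl_subspace:
  assumes "subspace2 W" "X \<subseteq> W" "X \<subseteq> P" "card X = k"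
  shows "cl X \<subseteq> W - {0}"
proof (cases "W = UNIV")
  case True
  then show ?thesis using cl_P[OF assms(3,4)] by auto
next
  case False
  have "cl X \<subseteq> W - {0}"
    by (rule cl_least[OF flat_subspace[OF assms(1) False]]) (use assms in auto)
  then show ?thesis .
qed

text \<open>
  The classical inequality \<open>v \<ge> (k + 1) (f - k) + (k + 1)\<close> for Steiner systems with block size \<open>f\<close>.  The
  \<open>k + 1\<close> subsets of size \<open>k\<close> of \<open>insert s X\<close> have blocks, each with \<open>f - k\<close> points outside \<open>insert s X\<close>.
  Two of these blocks share \<open>k - 1\<close> points of \<open>insert s X\<close>; one more common point would make them equal,
  and then a single block would contain \<open>X\<close> and \<open>s\<close>.
\<close>
lemma steiner_bound:
  assumes X: "X \<subseteq> P" "card X = k" and s: "s \<in> P" "s \<notin> cl X"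
    and W: "subspace2 W" "insert s X \<subseteq> W"
  shows "(k + 1) * (card (cl X) - k) + (k + 1) < card W"
proof -
  let ?S = "insert s X"
  have "s \<notin> X" using s subset_cl by blast
  then have card_S: "card ?S = k + 1" using X by simp
  have S: "?S \<subseteq> P" using X s by blast
  have card_minus: "card (?S - {t}) = k" if "t \<in> ?S" for t using card_S that by simp
  have not_in: "t \<notin> cl (?S - {t})" if t: "t \<in> ?S" for t
  proof
    assume "t \<in> cl (?S - {t})"
    then have "?S \<subseteq> cl (?S - {t})" using subset_cl[of "?S - {t}"] by blast
    then have "cl X = cl (?S - {t})"
      using S card_minus[OF t] X by (intro cl_eq) auto
    then show False using \<open>?S \<subseteq> cl (?S - {t})\<close> s by blast
  qed
  have disj: "(cl (?S - {t}) - ?S) \<inter> (cl (?S - {t'}) - ?S) = {}"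
    if t: "t \<in> ?S" "t' \<in> ?S" "t \<noteq> t'" for t t'
  proof (rule ccontr)
    assume "\<not> ?thesis"
    then obtain z where z: "z \<in> cl (?S - {t})" "z \<in> cl (?S - {t'})" "z \<notin> ?S" by blast
    let ?Z = "insert z (?S - {t} - {t'})"
    have zP: "z \<in> P" using z(1) cl_P[of "?S - {t}"] S card_minus[OF t(1)] by blast
    have "card (?S - {t} - {t'}) = k - 1" using card_minus[OF t(1)] t by simp
    moreover have "k > 0" using card_minus[OF t(1)] t by (metis Diff_iff card_gt_0_iff empty_iff finite singletonD)
    ultimately have cZ: "card ?Z = k" using z(3) by simp
    have "cl ?Z = cl (?S - {t})"
      using z zP S cZ card_minus[OF t(1)] subset_cl[of "?S - {t}"] by (intro cl_eq) auto
    moreover have "cl ?Z = cl (?S - {t'})"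
      using z zP S cZ card_minus[OF t(2)] subset_cl[of "?S - {t'}"] by (intro cl_eq) auto
    ultimately show False using not_in[OF t(1)] subset_cl[of "?S - {t'}"] t by blast
  qed
  have card_part: "card (cl (?S - {t}) - ?S) = card (cl X) - k" if t: "t \<in> ?S" for t
  proof -
    have "cl (?S - {t}) \<inter> ?S = ?S - {t}"
      using subset_cl[of "?S - {t}"] not_in[OF t] by blast
    then have "card (cl (?S - {t}) - ?S) = card (cl (?S - {t})) - k"
      using card_minus[OF t] by (metis card_Diff_subset_Int finite)
    also have "card (cl (?S - {t})) = card (cl X)"
      using S card_minus[OF t] X by (intro card_cl_eq) auto
    finally show ?thesis .
  qed
  let ?U = "\<Union>t\<in>?S. cl (?S - {t}) - ?S"
  have "card ?U = (\<Sum>t\<in>?S. card (cl (?S - {t}) - ?S))"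
    by (rule card_UN_disjoint) (use disj in auto)
  also have "\<dots> = (k + 1) * (card (cl X) - k)" using card_part card_S by simp
  finally have "card (?U \<union> ?S) = (k + 1) * (card (cl X) - k) + (k + 1)"
    using card_S by (subst card_Un_disjoint) auto
  moreover have "?U \<union> ?S \<subseteq> W - {0}"
  proof -
    have "cl (?S - {t}) \<subseteq> W - {0}" if "t \<in> ?S" for t
      using W S card_minus[OF that] by (intro cl_subspace) auto
    then have "?U \<subseteq> W - {0}" by blast
    moreover have "?S \<subseteq> W - {0}" using W S by auto
    ultimately show ?thesis by blast
  qed
  then have "card (?U \<union> ?S) \<le> card (W - {0})" by (intro card_mono) auto
  moreover have "card (W - {0}) < card W"
    using W by (intro psubset_card_mono) (auto simp: subspace2_def)
  ultimately show ?thesis by simp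
qed

text \<open>
  The block through \<open>a\<close> and \<open>b\<close> is contained in the subspace \<open>{0, a, b, a + b}\<close> and has more than two
  points, so it is the line through them; permutations that preserve lines are additive.
\<close>
lemma line_stage:
  assumes k: "k = 2"
  shows False
proof -
  have cl_line: "cl {a, b} = {a, b, a + b}" if ab: "a \<in> P" "b \<in> P" "a \<noteq> b" for a b
  proof -
    have X: "{a, b} \<subseteq> P" "card {a, b} = k" using ab k by auto
    have "subspace2 {0, a, b, a + b}"
      by (auto simp: subspace2_def double add.commute)
    then have sub: "cl {a, b} \<subseteq> {a, b, a + b}"
      using cl_subspace[of "{0, a, b, a + b}" "{a, b}"] X by auto
    moreover have "card {a, b, a + b} = 3" using ab by (auto simp: card_insert_if)
    moreover have "3 \<le> card (cl {a, b})" using card_cl_greater[OF X] k by simp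
    ultimately show ?thesis by (intro card_seteq) auto
  qed
  have "additive g" if g: "g \<in> G" for g
    unfolding additive_def
  proof (intro allI)
    fix a b
    show "g (a + b) = g a + g b"
    proof (cases "a = 0 \<or> b = 0 \<or> a = b")
      case True
      have "g 0 = 0" using G_in_P[OF g] by simp
      with True show ?thesis by (auto simp: double)
    next
      case False
      then have ab: "a \<in> P" "b \<in> P" "a \<noteq> b" by auto
      then have g_ab: "g a \<in> P" "g b \<in> P" "g a \<noteq> g b"
        using g by (auto simp: G_in_P dest: injD[OF inj_G])
      have "g ` {a, b, a + b} = g ` cl {a, b}" using cl_line[OF ab] by simp
      also have "\<dots> = cl (g ` {a, b})" by (rule cl_image[symmetric]) (use ab k g in auto)
      also have "\<dots> = {g a, g b, g a + g b}" using cl_line[OF g_ab] by simp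
      finally have "g (a + b) \<in> {g a, g b, g a + g b}" by auto
      moreover have "g (a + b) \<noteq> g a" "g (a + b) \<noteq> g b"
        using ab injD[OF inj_G[OF g], of "a + b" a] injD[OF inj_G[OF g], of "a + b" b]
        by auto
      ultimately show ?thesis by blast
    qed
  qed
  then show False using nonadditive by blast
qed

text \<open>
  With \<open>A = p + W\<close> the complement of the subspace \<open>W\<close> of dimension \<open>d + 1\<close> in one of dimension \<open>d + 2\<close>, the set
  \<open>Y\<close> arises from \<open>A\<close> by replacing three points \<open>p\<close>, \<open>q = p + e1\<close>, \<open>r = p + e2\<close> by one vector \<open>z\<close> of \<open>W\<close> that is
  independent of \<open>e1\<close> and \<open>e2\<close>.  It has \<open>k\<close> points, and its block has a single further point
  \<open>u\<close>.  Transvections that permute \<open>p\<close>, \<open>q\<close>, \<open>r\<close>, fix \<open>z\<close> and have their centre in \<open>W\<close> must fix \<open>u\<close>.  Those fixing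
  \<open>p\<close>, \<open>q\<close>, \<open>r\<close> and \<open>z\<close> force \<open>u\<close> into the span of \<open>p\<close>, \<open>e1\<close>, \<open>e2\<close>, \<open>z\<close>; one that exchanges \<open>p\<close> with \<open>q\<close> and one that
  exchanges \<open>p\<close> with \<open>r\<close> leave only vectors that are zero or belong to \<open>Y\<close>.
\<close>
lemma affine_stage:
  assumes d: "d \<ge> 2" "d + 2 \<le> n" and k: "k = 2 ^ (d + 1) - 2"
    and size: "\<And>X. X \<subseteq> P \<Longrightarrow> card X = k \<Longrightarrow> card (cl X) = k + 1"
  shows False
proof -
  have outside: "\<exists>x. x \<notin> E" if "card E < 2 ^ n" for E :: "'a set"
    using that card_space by (metis UNIV_eq_I less_irrefl)
  have big: "(2::nat) ^ 3 < 2 ^ n" "(2::nat) ^ (d + 1) < 2 ^ n" "(2::nat) ^ 3 \<le> 2 ^ (d + 1)"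
    using d by (intro power_strict_increasing power_increasing; simp)+
  define E1 where "E1 e = {0::'a} \<union> (+) e ` {0}" for e
  define E2 where "E2 e v = E1 e \<union> (+) v ` E1 e" for e v
  define E3 where "E3 e v w = E2 e v \<union> (+) w ` E2 e v" for e v w
  note E_defs = E3_def E2_def E1_def
  have sub1: "subspace2 (E1 e)" for e
    unfolding E1_def by (intro subspace2_extend subspace2_zero)
  have sub2: "subspace2 (E2 e v)" for e v
    unfolding E2_def by (intro subspace2_extend sub1)
  have sub3: "subspace2 (E3 e v w)" for e v w
    unfolding E3_def by (intro subspace2_extend sub2)
  obtain e1 where e1: "e1 \<notin> {0::'a}" using outside[of "{0}"] big by auto
  have c1: "card (E1 e1) = 2" unfolding E1_def using card_extend[OF subspace2_zero e1] by simp
  obtain e2 where e2: "e2 \<notin> E1 e1" using outside[of "E1 e1"] big c1 by auto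
  have c2: "card (E2 e1 e2) = 4" unfolding E2_def using card_extend[OF sub1 e2] c1 by simp
  obtain z where z: "z \<notin> E2 e1 e2" using outside[of "E2 e1 e2"] big c2 by auto
  have c3: "card (E3 e1 e2 z) = 2 ^ 3" unfolding E3_def using card_extend[OF sub2 z] c2 by simp
  obtain W where W: "subspace2 W" "E3 e1 e2 z \<subseteq> W" "card W = 2 ^ (d + 1)"
    using ex_subspace[OF sub3 c3, of "d + 1"] d by auto
  have addW: "x + y \<in> W" if "x \<in> W" "y \<in> W" for x y using W(1) that by (simp add: subspace2_def)
  obtain p where p: "p \<notin> W" using outside[of W] big W(3) by auto
  have eW: "0 \<in> W" "e1 \<in> W" "e2 \<in> W" "z \<in> W"
    using W(2) by (auto simp: E_defs)
  have indep: "e1 \<noteq> 0" "e2 \<noteq> 0" "e1 \<noteq> e2" "z \<noteq> 0" "z \<noteq> e1" "z \<noteq> e2" "z \<noteq> e1 + e2"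
    using e1 e2 z by (auto simp: E_defs add.commute)
  define U where "U = W \<union> (+) p ` W"
  have subU: "subspace2 U" unfolding U_def by (rule subspace2_extend[OF W(1)])
  define q where "q = p + e1"
  define r where "r = p + e2"
  define Y where "Y = insert z ((+) p ` W - {p, q, r})"
  have in_A: "y \<in> (+) p ` W \<longleftrightarrow> p + y \<in> W" for y by (rule in_translate)
  have A_not_W: "y \<notin> W" if "p + y \<in> W" for y
    using addW[OF that, of y] p by auto
  have YP: "Y \<subseteq> P"
    using A_not_W eW indep by (auto simp: Y_def in_A simp del: in_translate)
  have "{p, q, r} \<subseteq> (+) p ` W" "card {p, q, r} = 3"
    using eW indep by (auto simp: in_A q_def r_def double card_insert_if)
  then have "card ((+) p ` W - {p, q, r}) = 2 ^ (d + 1) - 3"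
    using W(3) by (simp add: card_Diff_subset card_image inj_add)
  moreover have "z \<notin> (+) p ` W" using in_A A_not_W eW by blast
  ultimately have Y: "card Y = k" using big k by (simp add: Y_def)
  have "card (cl Y - Y) = 1"
    using size[OF YP Y] Y by (simp add: card_Diff_subset subset_cl)
  then obtain u where u: "cl Y - Y = {u}" by (auto simp: card_1_singleton_iff)
  have YU: "Y \<subseteq> U" using eW by (auto simp: Y_def U_def)
  have uU: "u \<in> U" "u \<noteq> 0" "u \<notin> Y" "u \<in> cl Y"
    using u cl_subspace[OF subU YU YP Y] by auto
  \<comment> \<open>A transvection that preserves \<open>Y\<close> preserves its closure and so fixes the extra point.\<close>
  have fixed: "\<not> \<phi> u" if \<phi>: "functional \<phi>" "\<not> \<phi> a" "\<not> \<phi> z" and a: "a \<in> W" "a \<noteq> 0"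
    and pqr: "transvection \<phi> a ` {p, q, r} \<subseteq> {p, q, r}" for \<phi> a
  proof
    assume "\<phi> u"
    let ?t = "transvection \<phi> a"
    have t: "?t \<in> G" using trans \<phi> by blast
    have "?t y \<in> Y" if y: "y \<in> Y" for y
    proof (cases "y = z")
      case True
      then show ?thesis using \<phi>(3) by (simp add: Y_def transvection_def)
    next
      case False
      then have y': "p + y \<in> W" "y \<notin> {p, q, r}" using y by (auto simp: Y_def in_A)
      have "?t y \<notin> {p, q, r}"
      proof
        assume "?t y \<in> {p, q, r}"
        then have "?t (?t y) \<in> {p, q, r}" using pqr by blast
        then show False using y' transvection_involution[OF \<phi>(1,2)] by simp
      qed
      moreover have "p + ?t y \<in> W"
        using y' addW[of "p + y" a] a by (auto simp: transvection_def add.assoc)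
      ultimately show ?thesis by (simp add: Y_def in_A)
    qed
    then have "?t ` Y \<subseteq> Y" by blast
    then have tY: "?t ` Y = Y" by (rule endo_inj_surj[OF finite _ inj_on_G[OF t]])
    have "?t u \<in> ?t ` cl Y" using uU by blast
    also have "?t ` cl Y = cl Y" using cl_image[OF YP Y t] tY by simp
    finally have "?t u \<in> cl Y" .
    moreover have "?t u \<notin> Y"
      using uU(3) transvection_involution[OF \<phi>(1,2), of u] tY by (metis imageI)
    ultimately have "?t u = u" using u by blast
    then show False using \<open>\<phi> u\<close> a(2) by (simp add: transvection_def)
  qed
  let ?S = "E3 e1 e2 z \<union> (+) p ` E3 e1 e2 z"
  \<comment> \<open>A functional that vanishes on the span but not at \<open>u\<close> gives a transvection with centre \<open>e1\<close> moving \<open>u\<close>.\<close>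
  have "u \<in> ?S"
  proof (rule ccontr)
    assume "u \<notin> ?S"
    then obtain \<phi> where \<phi>: "functional \<phi>" "\<And>w. w \<in> ?S \<Longrightarrow> \<not> \<phi> w" "\<phi> u"
      using separation[OF subspace2_extend[OF sub3]] by metis
    have "\<not> \<phi> e1" "\<not> \<phi> z" "\<not> \<phi> p" "\<not> \<phi> q" "\<not> \<phi> r"
      using \<phi>(2) by (auto simp: E_defs q_def r_def)
    then show False
      using fixed[of \<phi> e1] \<phi> eW indep by (simp add: transvection_def)
  qed
  \<comment> \<open>The transvection with such a functional and centre \<open>e\<close> exchanges \<open>p\<close> with \<open>p + e\<close> and fixes \<open>p + e'\<close> and \<open>z\<close>.\<close>
  have sep: "\<exists>\<phi>. functional \<phi> \<and> \<not> \<phi> e \<and> \<not> \<phi> z \<and> \<phi> p \<and> \<phi> e'"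
    if e: "e \<in> W" "e' \<in> W" "e' \<notin> E2 e z" for e e'
  proof -
    have "E2 e z \<subseteq> W" using eW e addW by (auto simp: E_defs)
    then have "p \<notin> E3 e z (p + e')"
      using e p by (auto simp: E3_def in_translate)
    then obtain \<phi> where \<phi>: "functional \<phi>" "\<And>w. w \<in> E3 e z (p + e') \<Longrightarrow> \<not> \<phi> w" "\<phi> p"
      using separation[OF sub3] by metis
    have "\<not> \<phi> e" "\<not> \<phi> z" "\<not> \<phi> (p + e')" using \<phi>(2) by (auto simp: E_defs)
    then show ?thesis using \<phi> by (auto simp: functionalD)
  qed
  have "e2 \<notin> E2 e1 z" "e1 \<notin> E2 e2 z"
    using indep by (auto simp: E_defs)
  then obtain \<phi> \<psi> where \<phi>: "functional \<phi>" "\<not> \<phi> e1" "\<not> \<phi> z" "\<phi> p" "\<phi> e2"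
    and \<psi>: "functional \<psi>" "\<not> \<psi> e2" "\<not> \<psi> z" "\<psi> p" "\<psi> e1"
    using sep[of e1 e2] sep[of e2 e1] eW by metis
  have "\<not> \<phi> u"
    using \<phi> eW indep
    by (intro fixed[of \<phi> e1]) (auto simp: q_def r_def transvection_def functionalD[OF \<phi>(1)])
  moreover have "\<not> \<psi> u"
    using \<psi> eW indep
    by (intro fixed[of \<psi> e2]) (auto simp: q_def r_def transvection_def functionalD[OF \<psi>(1)])
  ultimately have "u \<in> {0, z, p + (e1 + e2), p + (z + (e1 + e2))}"
    using \<open>u \<in> ?S\<close> \<phi>(2-) \<psi>(2-)
    by (auto simp: E_defs functionalD[OF \<phi>(1)] functionalD[OF \<psi>(1)] add.commute)
  moreover have "p + (e1 + e2) \<in> Y" "p + (z + (e1 + e2)) \<in> Y" "z \<in> Y"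
    using indep eW addW by (auto simp: Y_def in_A q_def r_def)
  ultimately show False using uU by auto
qed

text \<open>
  Within a subspace of dimension \<open>d + 1\<close> the bound shows that blocks are as large as the nonzero part
  of the subspace; within dimension \<open>d + 2\<close> it then forces \<open>k = 2\<^sup>d\<^sup>+\<^sup>1 - 2\<close>.
\<close>
lemma contradiction: False
proof -
  have "k \<noteq> 0"
  proof
    assume "k = 0"
    moreover have "flat ({0} - {0})"
    proof (rule flat_subspace[OF subspace2_zero])
      show "{0::'a} \<noteq> UNIV"
      proof
        assume "{0::'a} = UNIV"
        then have "card {0::'a} = CARD('a)" by simp
        then show False using card_space n_ge_3 one_less_power[of "2::nat" n] by simp
      qed
    qed
    ultimately show False using nonflat[of "{}"] by simp
  qed
  then obtain d where d: "2 ^ d \<le> k" "k < 2 ^ (d + 1)"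
    using ex_power_ivl1[of 2 k] by auto
  have "(2::nat) ^ d < 2 ^ (n - 1)" using d k_small by linarith
  then have dn: "d + 2 \<le> n" using n_ge_3 by simp
  have "\<exists>W. subspace2 W \<and> {0::'a} \<subseteq> W \<and> card W = 2 ^ (d + 1)"
    by (rule ex_subspace[OF subspace2_zero, of 0]) (use dn in auto)
  then obtain W :: "'a set" where W: "subspace2 W" "card W = 2 ^ (d + 1)" by blast
  have cW: "card (W - {0}) = 2 ^ (d + 1) - 1" using W by (simp add: subspace2_def)
  have "(2::nat) ^ (d + 1) < 2 ^ n" using dn by (intro power_strict_increasing) auto
  then have proper: "W \<noteq> UNIV" using W(2) card_space by auto
  have "k \<noteq> 2 ^ (d + 1) - 1"
  proof -
    have "W - {0} \<subseteq> P" by auto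
    then show ?thesis using nonflat flat_subspace[OF W(1) proper] cW by blast
  qed
  then have k_le: "k + 2 \<le> 2 ^ (d + 1)" using d by linarith
  have "k \<le> card (W - {0})" using cW k_le by simp
  then obtain X where X: "X \<subseteq> W - {0}" "card X = k"
    by (rule obtain_subset_with_card_n)
  have XP: "X \<subseteq> P" using X by auto
  define f where "f = card (cl X)"
  have f_k: "k < f" using card_cl_greater[OF XP X(2)] by (simp add: f_def)
  have cl_W: "cl X \<subseteq> W - {0}" using cl_subspace[OF W(1) _ XP X(2)] X(1) by blast
  \<comment> \<open>Otherwise the blocks inside \<open>W\<close> violate the counting bound.\<close>
  have cl_eq_W: "cl X = W - {0}"
  proof (rule ccontr)
    assume "cl X \<noteq> W - {0}"
    then obtain s where s: "s \<in> W" "s \<in> P" "s \<notin> cl X" using cl_W by auto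
    have "(k + 1) * (f - k) + (k + 1) < 2 ^ (d + 1)"
      unfolding f_def W(2)[symmetric]
      by (rule steiner_bound[OF XP X(2) s(2,3) W(1)]) (use s X in auto)
    moreover have "(k + 1) * 1 \<le> (k + 1) * (f - k)" using f_k by (intro mult_le_mono2) simp
    ultimately show False using d by simp
  qed
  then have f: "f = 2 ^ (d + 1) - 1" using cW by (simp add: f_def)
  obtain s where s: "s \<notin> W" using proper by blast
  \<comment> \<open>The bound in the span of \<open>W\<close> and \<open>s\<close>, which has dimension \<open>d + 2\<close>.\<close>
  have "(k + 1) * (f - k) + (k + 1) < 2 ^ (d + 2)"
  proof -
    have "s \<in> P" using s W(1) by (auto simp: subspace2_def)
    moreover have "s \<notin> cl X" using s cl_W by blast
    ultimately have "(k + 1) * (f - k) + (k + 1) < card (W \<union> (+) s ` W)"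
      unfolding f_def
    proof (rule steiner_bound[OF XP X(2)])
      have "0 \<in> W" using W(1) by (simp add: subspace2_def)
      then show "insert s X \<subseteq> W \<union> (+) s ` W" using X(1) by (auto simp: image_iff)
    qed (rule subspace2_extend[OF W(1)])
    then show ?thesis using card_extend[OF W(1) s] W(2) by simp
  qed
  then have bound: "(k + 1) * (2 ^ (d + 1) - k) < 2 ^ (d + 2)"
    using f k_le by (simp add: algebra_simps diff_mult_distrib2)
  have "d \<noteq> 0" using d k_le by (cases d) auto
  have "d \<noteq> 1"
  proof
    assume "d = 1"
    then have "k = 2" using d k_le by simp
    then show False by (rule line_stage)
  qed
  with \<open>d \<noteq> 0\<close> have d2: "d \<ge> 2" by simp
  have "k = 2 ^ (d + 1) - 2"
  proof (rule ccontr)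
    assume k_neq: "k \<noteq> 2 ^ (d + 1) - 2"
    define N where "N = (2::nat) ^ d"
    have N4: "N \<ge> 2 ^ 2" unfolding N_def using d2 by (intro power_increasing) auto
    have N: "2 ^ (d + 1) = 2 * N" "(2::nat) ^ (d + 2) = 4 * N" by (simp_all add: N_def)
    have "k + 3 \<le> 2 * N" using k_le k_neq unfolding N by linarith
    then obtain v where v: "2 * N = k + 3 + v" using le_Suc_ex by blast
    have "2 \<le> k" using d(1) N4 unfolding N_def by simp
    then obtain w where w: "k = 2 + w" using le_Suc_ex by blast
    \<comment> \<open>Both factors are at least \<open>3\<close> and their sum is \<open>2 N + 1\<close>, so the product is at least \<open>6 N - 6\<close>, which exceeds \<open>4 N\<close>.\<close>
    have "(k + 1) * (2 * N - k) = (w + 3) * (v + 3)" using v w by (simp add: algebra_simps)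
    also have "\<dots> = w * v + 3 * w + 3 * v + 9" by (simp add: algebra_simps)
    finally have "3 * w + 3 * v + 9 < 4 * N" using bound unfolding N by linarith
    then show False using v w N4 by simp
  qed
  moreover have "card (cl Y) = k + 1" if "Y \<subseteq> P" "card Y = k" for Y
    using card_cl_eq[OF that XP X(2)] f k_le calculation by (simp add: f_def)
  ultimately show False by (rule affine_stage[OF d2 dn])
qed

end

section \<open>Homogeneity and three-cycles\<close>

context overgroup
begin

lemma all_flat_homogeneous:
  "k < 2 ^ (n - 1) \<Longrightarrow> homogeneous k \<and> (\<forall>X. X \<subseteq> P \<and> card X = k \<longrightarrow> flat X)"
proof (induction k)
  have flats: "\<forall>X. X \<subseteq> P \<and> card X = k \<longrightarrow> flat X"
    if k: "k < 2 ^ (n - 1)" and hom: "homogeneous k" for k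
  proof (rule ccontr)
    assume "\<not> ?thesis"
    then obtain X where X: "X \<subseteq> P" "card X = k" "\<not> flat X" by blast
    have none: "\<not> flat Y" if Y: "Y \<subseteq> P" "card Y = k" for Y
    proof
      assume "flat Y"
      moreover obtain g where "g \<in> G" "g ` Y = X"
        using hom X Y unfolding homogeneous_def by blast
      ultimately show False using flat_image X(3) by blast
    qed
    interpret nonflat_stage P n G k
      using k hom none by unfold_locales
    show False by (rule contradiction)
  qed
  {
    case 0
    then show ?case using flats homogeneous_0 by blast
  next
    case (Suc k)
    then have "homogeneous (Suc k)" by (intro homogeneous_Suc) auto
    then show ?case using flats Suc.prems by blast
  }
qed

lemma homogeneous: "k < 2 ^ (n - 1) \<Longrightarrow> homogeneous k"
  using all_flat_homogeneous by blast

text \<open>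
  A transvection \<open>t\<close> with functional \<open>\<phi>\<close> moves the \<open>2\<^sup>n\<^sup>-\<^sup>1\<close> points of the complement \<open>J\<close> of the
  hyperplane \<open>H\<close>.  By homogeneity some \<open>h\<close> maps the nonzero part of \<open>H\<close> onto \<open>J - {v}\<close>; the conjugate of \<open>t\<close> by \<open>h\<close>
  then moves just the other points, so that \<open>v\<close> is the only point moved by both involutions.
\<close>
lemma ex_three_cycle:
  obtains x y w where "x \<in> P" "y \<in> P" "w \<in> P" "x \<noteq> y" "y \<noteq> w" "x \<noteq> w" "three_cycle w x y \<in> G"
proof -
  have big: "(2::nat) ^ 2 \<le> 2 ^ (n - 1)" using n_ge_3 by (intro power_increasing) auto
  have twice: "(2::nat) ^ n = 2 * 2 ^ (n - 1)" using n_ge_3 by (cases n) auto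
  obtain v :: 'a where v: "v \<noteq> 0"
  proof -
    have "card {0::'a} \<noteq> CARD('a)" using card_space n_ge_3 one_less_power[of "2::nat" n] by simp
    then show thesis using that by (metis UNIV_eq_I singletonI)
  qed
  obtain \<phi> where \<phi>: "functional \<phi>" "\<phi> v"
    using separation[OF subspace2_zero] v by (metis singletonD)
  let ?H = "{x. \<not> \<phi> x}"
  have cH: "card ?H = 2 ^ (n - 1)" using card_hyperplane[OF \<phi>] twice by simp
  have H0: "0 \<in> ?H" using functional_0[OF \<phi>(1)] by simp
  have cH': "card (?H - {0}) = 2 ^ (n - 1) - 1" using cH H0 by simp
  have "card (?H - {0}) \<noteq> 0" unfolding cH' using big by simp
  then have "?H - {0} \<noteq> {}" by (metis card.empty)
  then obtain a where a: "\<not> \<phi> a" "a \<noteq> 0" by blast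
  let ?t = "transvection \<phi> a"
  have t: "?t \<in> G" by (rule trans[OF \<phi>(1) a(1)])
  define J where "J = {x. \<phi> x}"
  have vJ: "v \<in> J" using \<phi> by (simp add: J_def)
  have "card J = 2 ^ n - 2 ^ (n - 1)"
  proof -
    have "J = UNIV - ?H" by (auto simp: J_def)
    then show ?thesis using cH card_space by (simp add: card_Diff_subset)
  qed
  then have "card (J - {v}) = 2 ^ (n - 1) - 1" using vJ twice by simp
  moreover have "J - {v} \<subseteq> P" using H0 by (auto simp: J_def)
  moreover have "?H - {0} \<subseteq> P" by auto
  moreover have "homogeneous (2 ^ (n - 1) - 1)" by (rule homogeneous) simp
  ultimately obtain h where h: "h \<in> G" "h ` (?H - {0}) = J - {v}"
    using cH' unfolding homogeneous_def by metis
  let ?i = "Hilbert_Choice.inv h"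
  define t' where "t' = h \<circ> ?t \<circ> ?i"
  have t': "t' \<in> G" unfolding t'_def by (intro comp inv h(1) t)
  have invol: "t' (t' x) = x" for x
    using h(1) transvection_involution[OF \<phi>(1) a(1)] by (simp add: t'_def)
  \<comment> \<open>The conjugate moves exactly the nonzero vectors of the hyperplane together with \<open>v\<close>.\<close>
  have moves: "t' x = x \<longleftrightarrow> x = 0 \<or> x \<in> J - {v}" for x
  proof -
    have "t' x = x \<longleftrightarrow> ?t (?i x) = ?i x"
      using h(1) by (metis comp_apply inv_apply t'_def)
    also have "\<dots> \<longleftrightarrow> ?i x \<in> ?H" using a by (simp add: transvection_def)
    also have "\<dots> \<longleftrightarrow> ?i x = 0 \<or> ?i x \<in> ?H - {0}" using H0 by auto
    also have "?i x = 0 \<longleftrightarrow> x = 0" by (rule G_in_P[OF inv[OF h(1)]])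
    also have "?i x \<in> ?H - {0} \<longleftrightarrow> x \<in> J - {v}"
      unfolding h(2)[symmetric] using h(1) inj_G[OF h(1)] by (metis inj_image_mem_iff inv_apply(2))
    finally show ?thesis .
  qed
  define w where "w = t' v"
  have tv: "t' v \<noteq> v" using moves[of v] H0 vJ by (auto simp: J_def)
  have "t' w = v" by (simp add: w_def invol)
  then have w_moved: "w \<noteq> v" "t' w \<noteq> w" using tv by (auto simp: w_def)
  then have w: "w \<in> ?H" "w \<noteq> 0" using moves[of w] by (auto simp: J_def)
  have va: "\<phi> (v + a)" "v + a \<noteq> v" using \<phi> a by (auto simp: functionalD)
  \<comment> \<open>The commutator of the two involutions.\<close>
  have "?t \<circ> t' \<circ> ?t \<circ> t' = three_cycle w v (v + a)"
  proof
    fix x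
    have fix': "t' y = y" if "\<phi> y" "y \<noteq> v" for y using moves that by (simp add: J_def)
    have H_t': "\<not> \<phi> (t' y)" if y: "\<not> \<phi> y" "y \<noteq> w" for y
    proof
      assume "\<phi> (t' y)"
      moreover have "t' y \<noteq> v" using y(2) invol[of y] by (auto simp: w_def)
      ultimately have "t' (t' y) = t' y" by (rule fix')
      then show False using \<open>\<phi> (t' y)\<close> y by (simp add: invol)
    qed
    have 3: "three_cycle w v (v + a) x
      = (if x = w then v else if x = v then v + a else if x = v + a then w else x)"
      by (rule three_cycle_apply) (use w va \<phi> in auto)
    consider "x = w" | "x = v" | "x = v + a" | "\<not> \<phi> x" "x \<noteq> w" | "\<phi> x" "x \<noteq> v" "x \<noteq> v + a"
      by blast
    then show "(?t \<circ> t' \<circ> ?t \<circ> t') x = three_cycle w v (v + a) x"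
    proof cases
      case 1
      then show ?thesis unfolding 3 using \<open>t' w = v\<close> \<phi> va fix' a
        by (simp add: transvection_def add.assoc double functionalD)
    next
      case 2
      then show ?thesis unfolding 3 using \<open>t' w = v\<close> \<phi> va w w_moved
        by (simp add: transvection_def w_def[symmetric])
    next
      case 3
      then show ?thesis unfolding \<open>three_cycle w v (v + a) x = _\<close>
        using fix'[of "v + a"] \<phi> va w w_moved
        by (auto simp: transvection_def w_def[symmetric] add.assoc double)
    next
      case 4
      then show ?thesis unfolding 3 using H_t'[of x] \<phi> va by (auto simp: transvection_def invol)
    next
      case 5
      then have "\<phi> (x + a)" "x + a \<noteq> v"
        using \<phi> a by (auto simp: functionalD)
      then show ?thesis unfolding 3 using 5 fix' w
        by (auto simp: transvection_def)
    qed
  qed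
  then have "three_cycle w v (v + a) \<in> G" using t t' comp by metis
  then show thesis using that[of v "v + a" w] v w va \<phi> w_moved functional_0[OF \<phi>(1)]
    by (metis in_P mem_Collect_eq)
qed

text \<open>
  Conjugation transports the given \<open>3\<close>-cycle to any three points by homogeneity, and the two
  \<open>3\<close>-cycles on these points are squares of each other.
\<close>
lemma three_cycle_in:
  assumes abc: "{a, b, c} \<subseteq> P" "a \<noteq> b" "b \<noteq> c" "a \<noteq> c"
  shows "three_cycle a b c \<in> G"
proof -
  obtain x y w where xyw: "x \<in> P" "y \<in> P" "w \<in> P" "x \<noteq> y" "y \<noteq> w" "x \<noteq> w" "three_cycle w x y \<in> G"
    by (rule ex_three_cycle)
  have "(2::nat) ^ 2 \<le> 2 ^ (n - 1)" using n_ge_3 by (intro power_increasing) auto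
  then have "homogeneous 3" by (intro homogeneous) simp
  moreover have "card {w, x, y} = 3" "card {a, b, c} = 3" using xyw abc by auto
  ultimately obtain g where g: "g \<in> G" "g ` {w, x, y} = {a, b, c}"
    using abc(1) xyw unfolding homogeneous_def by (metis insert_subset empty_subsetI)
  have inj: "g u = g v \<longleftrightarrow> u = v" for u v using inj_G[OF g(1)] by (auto dest: injD)
  have conj: "g \<circ> three_cycle w x y \<circ> Hilbert_Choice.inv g = three_cycle (g w) (g x) (g y)"
  proof
    fix u
    have "three_cycle (g w) (g x) (g y) (g (Hilbert_Choice.inv g u))
      = g (three_cycle w x y (Hilbert_Choice.inv g u))"
      using xyw by (subst (1 2) three_cycle_apply) (auto simp: inj)
    then show "(g \<circ> three_cycle w x y \<circ> Hilbert_Choice.inv g) u = three_cycle (g w) (g x) (g y) u"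
      using g(1) by simp
  qed
  then have in_G: "three_cycle (g w) (g x) (g y) \<in> G"
    using g(1) xyw(7) comp inv by metis
  have dist: "g w \<noteq> g x" "g x \<noteq> g y" "g w \<noteq> g y" using xyw inj by auto
  have turn: "three_cycle v w u \<in> G" "three_cycle u w v \<in> G"
    if m: "three_cycle u v w \<in> G" and d: "u \<noteq> v" "v \<noteq> w" "u \<noteq> w" for u v w
  proof -
    have "three_cycle v w u = three_cycle u v w"
      using d by (auto simp: fun_eq_iff three_cycle_apply)
    then show "three_cycle v w u \<in> G" using m by simp
    have "three_cycle u w v = three_cycle u v w \<circ> three_cycle u v w"
      using d by (auto simp: fun_eq_iff three_cycle_apply)
    then show "three_cycle u w v \<in> G" using comp[OF m m] by simp
  qed
  have mem: "a \<in> {g w, g x, g y}" "b \<in> {g w, g x, g y}" "c \<in> {g w, g x, g y}"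
    using g(2) by auto
  have "three_cycle (g x) (g y) (g w) \<in> G" "three_cycle (g w) (g y) (g x) \<in> G"
    using turn[OF in_G] dist by auto
  moreover from this have "three_cycle (g y) (g w) (g x) \<in> G" "three_cycle (g x) (g w) (g y) \<in> G"
    "three_cycle (g y) (g x) (g w) \<in> G"
    using turn[of "g x" "g y" "g w"] turn[of "g w" "g y" "g x"] dist by auto
  ultimately show ?thesis using mem abc(2-) in_G by auto
qed

theorem contains_alternating:
  assumes "\<sigma> permutes P" "evenperm \<sigma>"
  shows "\<sigma> \<in> G"
  by (rule three_cycles_generate_even[OF _ order_refl id_in comp _ assms])
     (auto intro: three_cycle_in)

end

section \<open>Coordinates and matrices over the field with two elements\<close>

lemma bit_double [simp]: "(b::bit) + b = 0"
  by (cases b) simp_all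

lemma bit_vec_double:
  "v \<in> carrier_vec m \<Longrightarrow> v + v = (0\<^sub>v m :: bit vec)"
  by (intro eq_vecI) auto

lemma bit_vec_add_cancel:
  "v \<in> carrier_vec m \<Longrightarrow> w \<in> carrier_vec m \<Longrightarrow> v + (v + w) = (w :: bit vec)"
  by (intro eq_vecI) (auto simp flip: add.assoc)

lemma mat_mult_unit_vec_index:
  "A \<in> carrier_mat m m \<Longrightarrow> i < m \<Longrightarrow> j < m \<Longrightarrow> (A *\<^sub>v unit_vec m j) $ i = (A $$ (i, j) :: bit)"
  by (auto simp: scalar_prod_right_unit)

lemma mat_eq_if_mult_vec_eq:
  assumes "A \<in> carrier_mat m m" "B \<in> carrier_mat m m"
    and "\<And>v. v \<in> carrier_vec m \<Longrightarrow> A *\<^sub>v v = B *\<^sub>v (v :: bit vec)"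
  shows "A = B"
proof (rule eq_matI)
  fix i j assume "i < dim_row B" "j < dim_col B"
  then have ij: "i < m" "j < m" using assms by auto
  have "(A *\<^sub>v unit_vec m j) $ i = (B *\<^sub>v unit_vec m j) $ i"
    using assms(3)[of "unit_vec m j"] by simp
  then show "A $$ (i, j) = B $$ (i, j)"
    using mat_mult_unit_vec_index assms ij by metis
qed (use assms in auto)

text \<open>
  Induction on the position after which all entries of \<open>v\<close> vanish: a nonzero last entry is removed by
  adding a unit vector.
\<close>
lemma matrix_of_additive:
  fixes g :: "bit vec \<Rightarrow> bit vec"
  assumes g: "\<And>v. v \<in> carrier_vec m \<Longrightarrow> g v \<in> carrier_vec m"
    and add: "\<And>v w. v \<in> carrier_vec m \<Longrightarrow> w \<in> carrier_vec m \<Longrightarrow> g (v + w) = g v + g w"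
    and v: "v \<in> carrier_vec m"
  shows "mat m m (\<lambda>(i, j). g (unit_vec m j) $ i) *\<^sub>v v = g v"
proof -
  let ?A = "mat m m (\<lambda>(i, j). g (unit_vec m j) $ i)"
  have A: "?A \<in> carrier_mat m m" by simp
  have unit: "?A *\<^sub>v unit_vec m j = g (unit_vec m j)" if "j < m" for j
  proof (rule eq_vecI)
    fix i assume "i < dim_vec (g (unit_vec m j))"
    then have "i < m" using g[of "unit_vec m j"] by auto
    then show "(?A *\<^sub>v unit_vec m j) $ i = g (unit_vec m j) $ i"
      using mat_mult_unit_vec_index[OF A _ that] that by simp
  qed (use g[of "unit_vec m j"] in auto)
  have zero: "g (0\<^sub>v m) = 0\<^sub>v m"
    using add[of "0\<^sub>v m" "0\<^sub>v m"] bit_vec_double[OF g[of "0\<^sub>v m"]] by simp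
  have "\<forall>v\<in>carrier_vec m. (\<forall>i<m. l \<le> i \<longrightarrow> v $ i = 0) \<longrightarrow> ?A *\<^sub>v v = g v" if "l \<le> m" for l
    using that
  proof (induction l)
    case 0
    have "?A *\<^sub>v 0\<^sub>v m = 0\<^sub>v m" by (intro eq_vecI) auto
    moreover have "v = 0\<^sub>v m" if "v \<in> carrier_vec m" "\<forall>i<m. v $ i = 0" for v :: "bit vec"
      using that by (intro eq_vecI) auto
    ultimately show ?case using zero by auto
  next
    case (Suc l)
    show ?case
    proof (intro ballI impI)
      fix v :: "bit vec" assume v: "v \<in> carrier_vec m" "\<forall>i<m. Suc l \<le> i \<longrightarrow> v $ i = 0"
      show "?A *\<^sub>v v = g v"
      proof (cases "v $ l = 0")
        case True
        then have "\<forall>i<m. l \<le> i \<longrightarrow> v $ i = 0"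
          using v(2) by (metis le_antisym not_less_eq_eq)
        then show ?thesis using Suc v(1) by simp
      next
        case False
        define w where "w = unit_vec m l + v"
        have u: "unit_vec m l \<in> (carrier_vec m :: bit vec set)" by simp
        have w: "w \<in> carrier_vec m" using v(1) by (simp add: w_def)
        have "w $ i = 0" if "i < m" "l \<le> i" for i
          using that v False Suc.prems by (cases "i = l") (auto simp: w_def unit_vec_def)
        then have "?A *\<^sub>v w = g w" using Suc w by simp
        moreover have vw: "v = unit_vec m l + w"
          unfolding w_def using bit_vec_add_cancel[OF u v(1)] by simp
        ultimately show ?thesis
          unfolding vw mult_add_distrib_mat_vec[OF A u w] add[OF u w]
          using unit[of l] Suc.prems by simp
      qed
    qed
  qed
  from this[of m] show ?thesis using v by auto
qed

lemma GL2_simps: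
  "carrier (GL2 m) = {A \<in> carrier_mat m m. \<exists>B\<in>carrier_mat m m. B * A = 1\<^sub>m m \<and> A * B = 1\<^sub>m m}"
  "A \<otimes>\<^bsub>GL2 m\<^esub> B = A * B"
  by (auto simp: GL2_def units_of_def Units_def ring_mat_def)

lemma AGL2_simps:
  "carrier (AGL2 m) = carrier_vec m \<times> carrier (GL2 m)"
  "(v, A) \<otimes>\<^bsub>AGL2 m\<^esub> (w, B) = (v + A *\<^sub>v w, A * B)"
  by (simp_all add: AGL2_def semidirect_def monoid_vec_def GL2_simps)

context binary_space
begin

text \<open>
  A functional \<open>\<phi>\<close> with \<open>\<phi> w = 1\<close> splits \<open>W\<close> into its kernel and \<open>w\<close>: the first coordinate is \<open>\<phi>\<close>, and the others
  are the coordinates of the projection to the kernel along \<open>w\<close>.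
\<close>
lemma ex_coordinates:
  assumes "subspace2 (W::'a set)" "card W = 2 ^ m"
  shows "\<exists>c. bij_betw c W (carrier_vec m :: bit vec set) \<and>
    (\<forall>x\<in>W. \<forall>y\<in>W. c (x + y) = c x + c y)"
  using assms
proof (induction m arbitrary: W)
  case 0
  then have "card W = 1" by simp
  then obtain x where "W = {x}" by (auto simp: card_1_singleton_iff)
  then have W: "W = {0}" using 0(1) by (simp add: subspace2_def)
  have "carrier_vec 0 = {0\<^sub>v 0 :: bit vec}" by (auto intro: eq_vecI)
  then show ?case unfolding W by (intro exI[of _ "\<lambda>_. 0\<^sub>v 0"]) auto
next
  case (Suc m)
  have "0 \<in> W" using Suc.prems(1) by (simp add: subspace2_def)
  moreover have "W \<noteq> {0}"
  proof
    assume "W = {0}"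
    then have "card W = 1" by simp
    moreover have "even (card W)" unfolding Suc.prems(2) by simp
    ultimately show False by simp
  qed
  ultimately obtain w where w: "w \<in> W" "w \<noteq> 0" by blast
  obtain \<phi> where \<phi>: "functional \<phi>" "\<phi> w"
    using separation[OF subspace2_zero] w by (metis singletonD)
  let ?V = "{x \<in> W. \<not> \<phi> x}"
  have V: "subspace2 ?V"
    using Suc.prems(1) functional_0[OF \<phi>(1)] by (auto simp: subspace2_def functionalD[OF \<phi>(1)])
  have "card ?V = 2 ^ m" using card_kernel[OF Suc.prems(1) \<phi>(1) w(1) \<phi>(2)] Suc.prems(2) by simp
  then obtain c where c: "bij_betw c ?V (carrier_vec m :: bit vec set)"
    "\<forall>x\<in>?V. \<forall>y\<in>?V. c (x + y) = c x + c y"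
    using Suc.IH[OF V] by blast
  define pr where "pr x = (if \<phi> x then x + w else x)" for x
  have pr: "pr x \<in> ?V" if "x \<in> W" for x
    using that w \<phi> Suc.prems(1) by (auto simp: pr_def functionalD subspace2_def)
  have pr_add: "pr (x + y) = pr x + pr y" for x y
    using transvection_add[OF \<phi>(1), of w x y] by (simp add: pr_def transvection_def)
  define c' where "c' x = vCons (of_bool (\<phi> x)) (c (pr x))" for x
  have cV: "c x \<in> carrier_vec m" if "x \<in> ?V" for x using c(1) that by (meson bij_betwE)
  have "bij_betw c' W (carrier_vec (Suc m))"
  proof (rule bij_betwI')
    fix x y assume xy: "x \<in> W" "y \<in> W"
    have "c (pr x) = c (pr y) \<longleftrightarrow> pr x = pr y"
      using inj_on_eq_iff[OF bij_betw_imp_inj_on[OF c(1)] pr[OF xy(1)] pr[OF xy(2)]] .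
    then show "c' x = c' y \<longleftrightarrow> x = y"
      by (auto simp: c'_def pr_def split: if_splits)
  next
    fix x assume "x \<in> W"
    then show "c' x \<in> carrier_vec (Suc m)" using cV[OF pr] by (simp add: c'_def)
  next
    fix v :: "bit vec" assume "v \<in> carrier_vec (Suc m)"
    then obtain b v' where v: "v = vCons b v'" "v' \<in> carrier_vec m"
      by (cases v rule: vec_cases) auto
    then have "v' \<in> c ` ?V" using bij_betw_imp_surj_on[OF c(1)] by simp
    then obtain x where x: "x \<in> ?V" "v' = c x" by (rule imageE)
    have xw: "x + w \<in> W" "\<phi> (x + w)" using x w \<phi> Suc.prems(1)
      by (auto simp: subspace2_def functionalD)
    show "\<exists>x\<in>W. v = c' x"
    proof (cases b)
      case zero
      then show ?thesis using x v by (intro bexI[of _ x]) (auto simp: c'_def pr_def)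
    next
      case one
      then show ?thesis using x v xw by (intro bexI[of _ "x + w"]) (auto simp: c'_def pr_def)
    qed
  qed
  moreover have "c' (x + y) = c' x + c' y" if xy: "x \<in> W" "y \<in> W" for x y
  proof -
    have "c (pr (x + y)) = c (pr x) + c (pr y)"
      using c(2) pr[OF xy(1)] pr[OF xy(2)] by (simp add: pr_add)
    moreover have "(of_bool (\<phi> (x + y)) :: bit) = of_bool (\<phi> x) + of_bool (\<phi> y)"
      by (simp add: functionalD[OF \<phi>(1)])
    moreover have "dim_vec (c (pr x)) = m" "dim_vec (c (pr y)) = m"
      using cV[OF pr[OF xy(1)]] cV[OF pr[OF xy(2)]] by auto
    ultimately show ?thesis
      by (intro eq_vecI) (auto simp: c'_def vec_index_vCons less_Suc_eq_0_disj)
  qed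
  ultimately show ?case by blast
qed

end

locale coordinates = binary_space P n for P :: "'a::{ab_group_add,finite} set" and n +
  fixes W :: "'a set" and m :: nat and c :: "'a \<Rightarrow> bit vec"
  assumes subspace: "subspace2 W"
    and c_bij: "bij_betw c W (carrier_vec m)"
    and c_add: "\<And>x y. x \<in> W \<Longrightarrow> y \<in> W \<Longrightarrow> c (x + y) = c x + c y"
begin

definition e :: "bit vec \<Rightarrow> 'a" where "e = inv_into W c"

lemma c_in [simp]: "x \<in> W \<Longrightarrow> c x \<in> carrier_vec m"
  using c_bij by (meson bij_betwE)

lemma e_in [simp]: "v \<in> carrier_vec m \<Longrightarrow> e v \<in> W"
  using bij_betw_inv_into[OF c_bij] by (metis bij_betwE e_def)

lemma c_e [simp]: "v \<in> carrier_vec m \<Longrightarrow> c (e v) = v"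
  unfolding e_def using c_bij by (rule bij_betw_inv_into_right)

lemma e_c [simp]: "x \<in> W \<Longrightarrow> e (c x) = x"
  unfolding e_def using c_bij by (rule bij_betw_inv_into_left)

lemma W_add: "x \<in> W \<Longrightarrow> y \<in> W \<Longrightarrow> x + y \<in> W"
  using subspace by (simp add: subspace2_def)

lemma c_inj: "x \<in> W \<Longrightarrow> y \<in> W \<Longrightarrow> c x = c y \<longleftrightarrow> x = y"
  by (metis e_c)

lemma e_add: "v \<in> carrier_vec m \<Longrightarrow> w \<in> carrier_vec m \<Longrightarrow> e (v + w) = e v + e w"
  by (rule c_inj[THEN iffD1]) (auto simp: c_add W_add)

text \<open>
  The values of \<open>f\<close> outside \<open>W\<close> are left open, so that the restriction of a map of the whole space need not
  be named.
\<close>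
definition linear_on_W :: "('a \<Rightarrow> 'a) \<Rightarrow> bool" where
  "linear_on_W f \<longleftrightarrow> f ` W = W \<and> (\<forall>x\<in>W. \<forall>y\<in>W. f (x + y) = f x + f y)"

definition matrix_of :: "('a \<Rightarrow> 'a) \<Rightarrow> bit mat" where
  "matrix_of f = mat m m (\<lambda>(i, j). c (f (e (unit_vec m j))) $ i)"

lemma matrix_of_carrier: "matrix_of f \<in> carrier_mat m m"
  by (simp add: matrix_of_def)

lemma linear_on_W_in: "linear_on_W f \<Longrightarrow> x \<in> W \<Longrightarrow> f x \<in> W"
  by (auto simp: linear_on_W_def)

lemma matrix_of_apply:
  assumes f: "linear_on_W f" and x: "x \<in> W"
  shows "matrix_of f *\<^sub>v c x = c (f x)"
proof -
  have "matrix_of f *\<^sub>v c x = (c \<circ> f \<circ> e) (c x)"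
    unfolding matrix_of_def comp_def
    by (rule matrix_of_additive)
       (use f x linear_on_W_in[OF f] in \<open>auto simp: e_add c_add linear_on_W_def\<close>)
  then show ?thesis using x by simp
qed

lemma matrix_of_unique:
  assumes "A \<in> carrier_mat m m" "linear_on_W f" "\<And>x. x \<in> W \<Longrightarrow> A *\<^sub>v c x = c (f x)"
  shows "matrix_of f = A"
proof (rule mat_eq_if_mult_vec_eq[OF matrix_of_carrier assms(1)])
  fix v :: "bit vec" assume v: "v \<in> carrier_vec m"
  then show "matrix_of f *\<^sub>v v = A *\<^sub>v v"
    using matrix_of_apply[OF assms(2) e_in[OF v]] assms(3)[OF e_in[OF v]] by simp
qed

lemma linear_on_W_comp: "linear_on_W f \<Longrightarrow> linear_on_W g \<Longrightarrow> linear_on_W (f \<circ> g)"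
  using linear_on_W_in[of g] image_image[of f g W] by (simp add: linear_on_W_def)

lemma matrix_of_comp:
  assumes "linear_on_W f" "linear_on_W g"
  shows "matrix_of (f \<circ> g) = matrix_of f * matrix_of g"
proof (rule matrix_of_unique)
  fix x assume x: "x \<in> W"
  show "matrix_of f * matrix_of g *\<^sub>v c x = c ((f \<circ> g) x)"
    using assoc_mult_mat_vec[OF matrix_of_carrier matrix_of_carrier c_in[OF x], of f g]
      matrix_of_apply[OF assms(2) x] matrix_of_apply[OF assms(1) linear_on_W_in[OF assms(2) x]]
    by simp
qed (simp_all add: assms matrix_of_carrier linear_on_W_comp mult_carrier_mat[of _ m m])

lemma matrix_of_id:
  assumes "\<And>x. x \<in> W \<Longrightarrow> f x = x"
  shows "matrix_of f = 1\<^sub>m m"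
proof (rule matrix_of_unique)
  have "f ` W = W" using assms by force
  then show "linear_on_W f" using assms W_add by (auto simp: linear_on_W_def)
qed (use assms in auto)

lemma linear_on_W_inverse:
  assumes f: "linear_on_W f"
  shows "linear_on_W (inv_into W f)" "\<And>x. x \<in> W \<Longrightarrow> f (inv_into W f x) = x"
    "\<And>x. x \<in> W \<Longrightarrow> inv_into W f (f x) = x"
proof -
  have inj: "inj_on f W" using f by (intro eq_card_imp_inj_on) (auto simp: linear_on_W_def)
  have im: "f ` W = W" using f by (simp add: linear_on_W_def)
  have bij: "bij_betw f W W" using inj im by (simp add: bij_betw_def)
  show right: "f (inv_into W f x) = x" if "x \<in> W" for x
    using that im by (simp add: f_inv_into_f)
  show left: "inv_into W f (f x) = x" if "x \<in> W" for x
    using inj that by (rule inv_into_f_f)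
  have im': "inv_into W f ` W = W" using bij_betw_inv_into[OF bij] by (simp add: bij_betw_def)
  have "inv_into W f (x + y) = inv_into W f x + inv_into W f y" if xy: "x \<in> W" "y \<in> W" for x y
  proof -
    have i: "inv_into W f x \<in> W" "inv_into W f y \<in> W" using xy im' by auto
    then have "f (inv_into W f x + inv_into W f y) = x + y"
      using f xy by (simp add: linear_on_W_def right)
    then show ?thesis using left[OF W_add[OF i]] by simp
  qed
  then show "linear_on_W (inv_into W f)" using im' by (simp add: linear_on_W_def)
qed

lemma matrix_of_in_GL2:
  assumes f: "linear_on_W f"
  shows "matrix_of f \<in> carrier (GL2 m)"
proof -
  note inv = linear_on_W_inverse[OF f]
  have "matrix_of (inv_into W f) * matrix_of f = 1\<^sub>m m"
    by (subst matrix_of_comp[symmetric]) (auto simp: inv f intro: matrix_of_id)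
  moreover have "matrix_of f * matrix_of (inv_into W f) = 1\<^sub>m m"
    by (subst matrix_of_comp[symmetric]) (auto simp: inv f intro: matrix_of_id)
  ultimately show ?thesis by (auto simp: GL2_simps matrix_of_carrier)
qed

lemma linear_on_W_matrix:
  assumes A: "A \<in> carrier (GL2 m)"
  shows "linear_on_W (\<lambda>x. e (A *\<^sub>v c x))"
proof -
  obtain B where B: "B \<in> carrier_mat m m" "B * A = 1\<^sub>m m" "A * B = 1\<^sub>m m" and A': "A \<in> carrier_mat m m"
    using A by (auto simp: GL2_simps)
  have "x \<in> (\<lambda>x. e (A *\<^sub>v c x)) ` W" if x: "x \<in> W" for x
  proof (rule image_eqI)
    have "A *\<^sub>v (B *\<^sub>v c x) = c x"
      using B(3) assoc_mult_mat_vec[OF A' B(1) c_in[OF x]] x by simp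
    then show "x = e (A *\<^sub>v c (e (B *\<^sub>v c x)))" using B A' x by simp
  qed (use B x in auto)
  moreover have "e (A *\<^sub>v c x) \<in> W" if "x \<in> W" for x using A' that by auto
  ultimately have "(\<lambda>x. e (A *\<^sub>v c x)) ` W = W" by blast
  moreover have "e (A *\<^sub>v c (x + y)) = e (A *\<^sub>v c x) + e (A *\<^sub>v c y)" if "x \<in> W" "y \<in> W" for x y
    using that A' by (simp add: c_add mult_add_distrib_mat_vec[OF A'] e_add)
  ultimately show ?thesis by (simp add: linear_on_W_def)
qed

lemma matrix_of_matrix:
  assumes A: "A \<in> carrier (GL2 m)" and f: "linear_on_W f"
    and eq: "\<And>x. x \<in> W \<Longrightarrow> f x = e (A *\<^sub>v c x)"
  shows "matrix_of f = A"
proof (rule matrix_of_unique[OF _ f])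
  show A': "A \<in> carrier_mat m m" using A by (simp add: GL2_simps)
  show "A *\<^sub>v c x = c (f x)" if "x \<in> W" for x using eq[OF that] that A' by simp
qed

lemma matrix_of_inj:
  assumes "linear_on_W f" "linear_on_W g" "matrix_of f = matrix_of g" "x \<in> W"
  shows "f x = g x"
  using assms matrix_of_apply[of f x] matrix_of_apply[of g x] c_inj[of "f x" "g x"]
    linear_on_W_in by metis

end

context binary_space
begin

lemma finite_additive_bijection:
  assumes add: "\<And>x y. f (x + y) = f x + (f y :: 'a)" and ker: "\<And>x. f x = 0 \<Longrightarrow> x = 0"
  shows "f \<in> additive_bijections"
proof -
  have "x = y" if "f x = f y" for x y :: 'a
  proof -
    have "f (x + y) = 0" using add[of x y] that by simp
    then show ?thesis using ker by fastforce
  qed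
  then have "inj f" by (rule injI)
  then show ?thesis
    using add by (simp add: additive_bijections_def additive_def bij_def finite_UNIV_inj_surj)
qed

lemma additive_bijections_iso_GL2:
  "(sym_group_on P)\<lparr>carrier := additive_bijections\<rparr> \<cong> GL2 n"
proof -
  obtain c where "bij_betw c (UNIV::'a set) (carrier_vec n :: bit vec set)"
    "\<forall>x\<in>UNIV. \<forall>y\<in>UNIV. c (x + y) = c x + c y"
    using ex_coordinates[of UNIV n] card_space by (auto simp: subspace2_def)
  then interpret coordinates P n UNIV n c by unfold_locales (auto simp: subspace2_def)
  have lin: "linear_on_W f \<longleftrightarrow> f \<in> additive_bijections" for f
    by (auto simp: linear_on_W_def additive_bijections_def additive_def bij_def
        intro: finite_UNIV_surj_inj)
  have "matrix_of \<in> hom ((sym_group_on P)\<lparr>carrier := additive_bijections\<rparr>) (GL2 n)"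
    by (rule homI) (auto simp: lin matrix_of_in_GL2 sym_group_on_def GL2_simps(2) matrix_of_comp)
  moreover have "bij_betw matrix_of additive_bijections (carrier (GL2 n))"
  proof (rule bij_betw_imageI)
    show "inj_on matrix_of additive_bijections"
      using matrix_of_inj by (intro inj_onI) (auto simp: lin fun_eq_iff)
    have "A \<in> matrix_of ` additive_bijections" if "A \<in> carrier (GL2 n)" for A
      using matrix_of_matrix[OF that linear_on_W_matrix[OF that]] linear_on_W_matrix[OF that]
      by (metis image_eqI lin)
    then show "matrix_of ` additive_bijections = carrier (GL2 n)"
      using matrix_of_in_GL2 lin by blast
  qed
  ultimately show ?thesis by (intro is_isoI isoI) auto
qed

text \<open>
  With an origin \<open>u\<close> outside \<open>H\<close>, the complement of \<open>H\<close> is \<open>u + H\<close>, and \<open>f\<close> acts on it as the affine map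
  \<open>x \<mapsto> f x + (f u + u)\<close> of \<open>H\<close>.  The pair of the translation part \<open>f u + u\<close> and the linear part of this map
  determines \<open>f\<close>, and every pair occurs.
\<close>
lemma hyperplane_stabilizer_iso_AGL2:
  assumes \<phi>: "functional \<phi>" "\<phi> (u::'a)"
  defines "H \<equiv> {x. \<not> \<phi> x}"
  shows "(sym_group_on P)\<lparr>carrier := {f \<in> additive_bijections. f ` H = H}\<rparr> \<cong> AGL2 (n - 1)"
proof -
  let ?S = "{f \<in> additive_bijections. f ` H = H}"
  have "n \<noteq> 0"
  proof
    assume "n = 0"
    then have "card H = 0 \<or> 2 * card H = 1" using card_hyperplane[OF \<phi>] by (simp add: H_def)
    then show False using functional_0[OF \<phi>(1)] by (auto simp: H_def)
  qed
  define m where "m = n - 1"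
  have "(2::nat) ^ n = 2 * 2 ^ m" using \<open>n \<noteq> 0\<close> by (cases n) (auto simp: m_def)
  then have cH: "card H = 2 ^ m" using card_hyperplane[OF \<phi>] by (simp add: H_def)
  have subH: "subspace2 H" unfolding H_def by (rule subspace2_kernel[OF \<phi>(1)])
  obtain c where "bij_betw c H (carrier_vec m :: bit vec set)"
    "\<forall>x\<in>H. \<forall>y\<in>H. c (x + y) = c x + c y"
    using ex_coordinates[OF subH cH] by blast
  then interpret coordinates P n H m c using subH by unfold_locales auto
  have in_H: "x \<in> H \<longleftrightarrow> \<not> \<phi> x" for x by (simp add: H_def)
  have add: "f (x + y) = f x + f y" if "f \<in> ?S" for f x y
    using that additive_bijections_add by blast
  have f_H: "f x \<in> H \<longleftrightarrow> x \<in> H" if "f \<in> ?S" for f x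
  proof -
    have "inj f" using that by (simp add: additive_bijections_bij bij_is_inj)
    then have "f x \<in> f ` H \<longleftrightarrow> x \<in> H" by (rule inj_image_mem_iff)
    then show ?thesis using that by simp
  qed
  have lin: "linear_on_W f" if "f \<in> ?S" for f
    using that add[OF that] by (auto simp: linear_on_W_def)
  have fu: "f u + u \<in> H" if "f \<in> ?S" for f
    using f_H[OF that, of u] \<phi> by (simp add: in_H functionalD)
  define F where "F f = (c (f u + u), matrix_of f)" for f
  have "F \<in> hom ((sym_group_on P)\<lparr>carrier := ?S\<rparr>) (AGL2 m)"
  proof (rule homI)
    fix f assume "f \<in> carrier ((sym_group_on P)\<lparr>carrier := ?S\<rparr>)"
    then have "f \<in> ?S" by simp
    then show "F f \<in> carrier (AGL2 m)"
      using fu lin by (simp add: F_def AGL2_simps matrix_of_in_GL2)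
  next
    fix f g assume "f \<in> carrier ((sym_group_on P)\<lparr>carrier := ?S\<rparr>)"
      "g \<in> carrier ((sym_group_on P)\<lparr>carrier := ?S\<rparr>)"
    then have f: "f \<in> ?S" and g: "g \<in> ?S" by simp_all
    have "f (g u) + u = (f u + u) + f (g u + u)"
      by (simp add: add[OF f] ac_simps)
    then have "c (f (g u) + u) = c ((f u + u) + f (g u + u))" by (rule arg_cong)
    also have "\<dots> = c (f u + u) + c (f (g u + u))"
      using fu[OF f] fu[OF g] f_H[OF f] by (intro c_add) simp_all
    also have "c (f (g u + u)) = matrix_of f *\<^sub>v c (g u + u)"
      using matrix_of_apply[OF lin[OF f] fu[OF g]] by simp
    finally show "F (f \<otimes>\<^bsub>(sym_group_on P)\<lparr>carrier := ?S\<rparr>\<^esub> g) = F f \<otimes>\<^bsub>AGL2 m\<^esub> F g"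
      by (simp add: F_def sym_group_on_def AGL2_simps
          matrix_of_comp[OF lin[OF f] lin[OF g]])
  qed
  moreover have "bij_betw F ?S (carrier (AGL2 m))"
  proof (rule bij_betw_imageI)
    show "inj_on F ?S"
    proof (rule inj_onI, rule ext)
      fix f g x assume f: "f \<in> ?S" and g: "g \<in> ?S" and eq: "F f = F g"
      have "f u + u = g u + u" using eq fu[OF f] fu[OF g] by (simp add: F_def c_inj)
      then have u: "f u = g u" by simp
      have H: "f y = g y" if "y \<in> H" for y
        using eq that by (intro matrix_of_inj lin f g) (auto simp: F_def)
      show "f x = g x"
      proof (cases "x \<in> H")
        case False
        then have "x + u \<in> H" using \<phi> by (simp add: in_H functionalD)
        then have "f (x + u) = g (x + u)" by (rule H)
        then show ?thesis using u by (simp add: add[OF f] add[OF g])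
      qed (rule H)
    qed
    have "va \<in> F ` ?S" if va: "va \<in> carrier (AGL2 m)" for va
    proof -
      obtain v A where vA: "va = (v, A)" "v \<in> carrier_vec m" and A: "A \<in> carrier (GL2 m)"
        using va by (auto simp: AGL2_simps)
      define g where "g x = e (A *\<^sub>v c x)" for x
      have g: "linear_on_W g" unfolding g_def by (rule linear_on_W_matrix[OF A])
      define f where "f x = (if \<phi> x then g (x + u) + (u + e v) else g x)" for x
      have g_in: "g x \<in> H" if "x \<in> H" for x using linear_on_W_in[OF g that] .
      have g_add: "g (x + y) = g x + g y" if "x \<in> H" "y \<in> H" for x y
        using g that by (simp add: linear_on_W_def)
      have ev: "e v \<in> H" using vA by simp
      have \<phi>f: "\<phi> (f x) \<longleftrightarrow> \<phi> x" for x
        using g_in[of x] g_in[of "x + u"] ev \<phi>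
        by (auto simp: f_def in_H functionalD)
      have "f \<in> additive_bijections"
      proof (rule finite_additive_bijection)
        fix x y
        have *: "x \<in> H \<Longrightarrow> y + u \<in> H \<Longrightarrow> g (x + y + u) = g x + g (y + u)"
          "y \<in> H \<Longrightarrow> x + u \<in> H \<Longrightarrow> g (x + y + u) = g (x + u) + g y"
          "x + u \<in> H \<Longrightarrow> y + u \<in> H \<Longrightarrow> g (x + y) = g (x + u) + g (y + u)"
          using g_add[of x "y + u"] g_add[of "x + u" y] g_add[of "x + u" "y + u"] add_shift[of u x y]
          by (simp_all add: ac_simps)
        have **: "(a + w) + (b + w) = a + b" for a b w :: 'a
          using add_shift[of w a b] by (simp add: ac_simps)
        show "f (x + y) = f x + f y"
          using * ** g_add[of x y] \<phi>
          by (cases "\<phi> x"; cases "\<phi> y") (simp_all add: f_def in_H functionalD add.assoc add.left_commute)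
      next
        fix x assume x: "f x = 0"
        then have "\<not> \<phi> x" using \<phi>f[of x] functional_0[OF \<phi>(1)] by simp
        then have "x \<in> H" "g x = 0" using x by (simp_all add: f_def in_H)
        moreover have "g 0 = 0" "0 \<in> H"
          using g_add[of 0 0] functional_0[OF \<phi>(1)] by (simp_all add: in_H double)
        ultimately show "x = 0" using linear_on_W_inverse(3)[OF g] by metis
      qed
      moreover have "f ` H = g ` H" by (rule image_cong) (auto simp: f_def in_H)
      then have "f ` H = H" using g by (simp add: linear_on_W_def)
      ultimately have fS: "f \<in> ?S" by simp
      have "matrix_of f = A"
        by (rule matrix_of_matrix[OF A lin[OF fS]]) (simp add: f_def g_def in_H)
      moreover have "g 0 = 0" using g_add[of 0 0] functional_0[OF \<phi>(1)] by (simp add: in_H double)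
      then have "c (f u + u) = v" using \<phi> vA by (simp add: f_def double)
      ultimately have "F f = va" by (simp add: F_def vA)
      then show ?thesis using fS by blast
    qed
    moreover have "F f \<in> carrier (AGL2 m)" if "f \<in> ?S" for f
      using that fu lin by (simp add: F_def AGL2_simps matrix_of_in_GL2)
    ultimately show "F ` ?S = carrier (AGL2 m)" by blast
  qed
  ultimately have "(sym_group_on P)\<lparr>carrier := ?S\<rparr> \<cong> AGL2 m" by (intro is_isoI isoI) auto
  then show ?thesis by (simp only: m_def)
qed

end

section \<open>Permutation groups\<close>

text \<open>
  Closure conditions for a subgroup of the symmetric group in terms of functions, which spares the
  inverses of the various group records below.
\<close>
definition permutation_group_on :: "'p set \<Rightarrow> ('p \<Rightarrow> 'p) set \<Rightarrow> bool" where
  "permutation_group_on S X \<longleftrightarrow> id \<in> X \<and> (\<forall>f\<in>X. f permutes S \<and> Hilbert_Choice.inv f \<in> X) \<and>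
     (\<forall>f\<in>X. \<forall>g\<in>X. f \<circ> g \<in> X)"

lemma sym_group_on_simps [simp]:
  "carrier (sym_group_on S) = {\<sigma>. \<sigma> permutes S}"
  "f \<otimes>\<^bsub>sym_group_on S\<^esub> g = f \<circ> g"
  "\<one>\<^bsub>sym_group_on S\<^esub> = id"
  by (simp_all add: sym_group_on_def)

lemma sym_group_on_inv:
  assumes "f permutes S"
  shows "inv\<^bsub>sym_group_on S\<^esub> f = Hilbert_Choice.inv f"
  by (rule group.inv_equality[OF group_sym_group_on])
     (use assms in \<open>simp_all add: permutes_inv permutes_inv_o(2)\<close>)

lemma permutation_group_on_subgroup:
  assumes "permutation_group_on S X"
  shows "subgroup X (sym_group_on S)"
  by (rule group.subgroupI[OF group_sym_group_on])
     (use assms in \<open>auto simp: permutation_group_on_def sym_group_on_inv\<close>)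

lemma permutation_group_on_group:
  assumes "permutation_group_on S X"
  shows "group ((sym_group_on S)\<lparr>carrier := X\<rparr>)"
  by (rule subgroup.subgroup_is_group[OF permutation_group_on_subgroup[OF assms] group_sym_group_on])

lemma permutation_group_on_inv:
  assumes "permutation_group_on S X" "f \<in> X"
  shows "inv\<^bsub>(sym_group_on S)\<lparr>carrier := X\<rparr>\<^esub> f = Hilbert_Choice.inv f"
  using group.m_inv_consistent[OF group_sym_group_on permutation_group_on_subgroup[OF assms(1)] assms(2)]
    assms by (simp add: sym_group_on_inv permutation_group_on_def)

lemma subgroup_iff_permutation_group_on:
  assumes X: "permutation_group_on S X"
  shows "subgroup K ((sym_group_on S)\<lparr>carrier := X\<rparr>) \<longleftrightarrow> permutation_group_on S K \<and> K \<subseteq> X"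
proof
  assume K: "subgroup K ((sym_group_on S)\<lparr>carrier := X\<rparr>)"
  have "K \<subseteq> X" using subgroup.subset[OF K] by simp
  moreover have "Hilbert_Choice.inv f \<in> K" if "f \<in> K" for f
    using subgroup.m_inv_closed[OF K that] permutation_group_on_inv[OF X] \<open>K \<subseteq> X\<close> that by auto
  moreover have "f \<circ> g \<in> K" if "f \<in> K" "g \<in> K" for f g
    using subgroup.m_closed[OF K that] by simp
  moreover have "id \<in> K" using subgroup.one_closed[OF K] by simp
  ultimately show "permutation_group_on S K \<and> K \<subseteq> X"
    using X by (auto simp: permutation_group_on_def)
next
  assume K: "permutation_group_on S K \<and> K \<subseteq> X"
  show "subgroup K ((sym_group_on S)\<lparr>carrier := X\<rparr>)"
    by (rule group.subgroupI[OF permutation_group_on_group[OF X]])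
       (use K permutation_group_on_inv[OF X] in \<open>auto simp: permutation_group_on_def\<close>)
qed

definition conj_by :: "('p \<Rightarrow> 'p) \<Rightarrow> ('p \<Rightarrow> 'p) \<Rightarrow> 'p \<Rightarrow> 'p" where
  "conj_by s f = s \<circ> f \<circ> Hilbert_Choice.inv s"

lemma conj_by_apply: "bij s \<Longrightarrow> conj_by s f (s x) = s (f x)"
  by (simp add: conj_by_def bij_is_inj)

lemma conj_by_inverse:
  "bij s \<Longrightarrow> conj_by (Hilbert_Choice.inv s) (conj_by s f) = f"
  "bij s \<Longrightarrow> conj_by s (conj_by (Hilbert_Choice.inv s) f) = f"
  by (simp_all add: conj_by_def fun_eq_iff bij_is_inj bij_is_surj surj_f_inv_f inv_inv_eq)

lemma conj_by_comp: "bij s \<Longrightarrow> conj_by s (f \<circ> g) = conj_by s f \<circ> conj_by s g"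
  by (simp add: conj_by_def fun_eq_iff bij_is_inj)

lemma conj_by_id [simp]: "bij s \<Longrightarrow> conj_by s id = id"
  by (simp add: conj_by_def fun_eq_iff bij_is_surj surj_f_inv_f)

lemma conj_by_inv:
  assumes "bij s" "bij f"
  shows "Hilbert_Choice.inv (conj_by s f) = conj_by s (Hilbert_Choice.inv f)"
proof (rule inv_unique_comp)
  have "f \<circ> Hilbert_Choice.inv f = id" "Hilbert_Choice.inv f \<circ> f = id"
    using assms(2) by (simp_all add: bij_is_inj bij_is_surj surj_iff[symmetric])
  then show "conj_by s f \<circ> conj_by s (Hilbert_Choice.inv f) = id"
    "conj_by s (Hilbert_Choice.inv f) \<circ> conj_by s f = id"
    using assms(1) by (simp_all flip: conj_by_comp)
qed

lemma conj_by_inj: "bij s \<Longrightarrow> inj_on (conj_by s) X"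
  by (metis conj_by_inverse(1) inj_on_inverseI)

lemma conj_by_mem: "bij s \<Longrightarrow> conj_by s f \<in> conj_by s ` X \<longleftrightarrow> f \<in> X"
  by (metis conj_by_inverse(1) image_iff)

lemma conj_by_permutes:
  assumes "s permutes S" "f permutes S"
  shows "conj_by s f permutes S"
  unfolding conj_by_def using assms by (intro permutes_compose permutes_inv)

lemma conj_by_even:
  assumes "finite S" "s permutes S" "f permutes S"
  shows "evenperm (conj_by s f) = evenperm f"
proof -
  have p: "permutation s" "permutation f" using assms permutation_permutes by blast+
  then have "evenperm (conj_by s f) = ((evenperm s = evenperm f) = evenperm s)"
    by (simp add: conj_by_def evenperm_comp permutation_compose permutation_inverse evenperm_inv)
  then show ?thesis by auto
qed

lemma conj_by_permutation_group:
  assumes s: "s permutes S" and X: "permutation_group_on S X"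
  shows "permutation_group_on S (conj_by s ` X)"
proof -
  have b: "bij s" using permutes_bij[OF s] .
  have f: "bij f" if "f \<in> X" for f using that X permutes_bij by (auto simp: permutation_group_on_def)
  show ?thesis
    unfolding permutation_group_on_def
  proof (intro conjI ballI)
    show "id \<in> conj_by s ` X"
      using X conj_by_id[OF b] by (metis imageI permutation_group_on_def)
  qed (use X conj_by_permutes[OF s] b f in
      \<open>auto simp: permutation_group_on_def conj_by_inv simp flip: conj_by_comp\<close>)
qed

lemma conj_by_iso:
  assumes s: "bij s"
  shows "(sym_group_on S)\<lparr>carrier := X\<rparr> \<cong> (sym_group_on S)\<lparr>carrier := conj_by s ` X\<rparr>"
  by (rule is_isoI[OF isoI[of "conj_by s"]])
     (use s in \<open>auto simp: hom_def conj_by_comp bij_betw_def conj_by_inj\<close>)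

lemma alt_group_on_permutation_group:
  assumes "finite S"
  shows "permutation_group_on S {\<sigma>. \<sigma> permutes S \<and> evenperm \<sigma>}"
proof -
  have p: "permutation f" if "f permutes S" for f using that assms permutation_permutes by blast
  show ?thesis
    by (auto simp: permutation_group_on_def permutes_id permutes_compose permutes_inv
        evenperm_comp evenperm_inv p)
qed

lemma conjugate_in_permutation_group:
  assumes "permutation_group_on S X"
  shows "conjugate_in ((sym_group_on S)\<lparr>carrier := X\<rparr>) K L \<longleftrightarrow> (\<exists>g\<in>X. L = conj_by g ` K)"
proof -
  have "g <#\<^bsub>(sym_group_on S)\<lparr>carrier := X\<rparr>\<^esub> K #>\<^bsub>(sym_group_on S)\<lparr>carrier := X\<rparr>\<^esub>
      (inv\<^bsub>(sym_group_on S)\<lparr>carrier := X\<rparr>\<^esub> g) = conj_by g ` K" if "g \<in> X" for g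
    using permutation_group_on_inv[OF assms that]
    by (auto simp: l_coset_def r_coset_def conj_by_def)
  then show ?thesis by (auto simp: conjugate_in_def)
qed

lemma conj_by_image_iff:
  assumes "bij s"
  shows "g \<in> conj_by s ` X \<longleftrightarrow> conj_by (Hilbert_Choice.inv s) g \<in> X"
proof
  assume "conj_by (Hilbert_Choice.inv s) g \<in> X"
  then have "conj_by s (conj_by (Hilbert_Choice.inv s) g) \<in> conj_by s ` X" by (rule imageI)
  then show "g \<in> conj_by s ` X" by (simp only: conj_by_inverse(2)[OF assms])
qed (auto simp: conj_by_inverse[OF assms])

lemma conj_by_point_stabilizer:
  assumes X: "permutation_group_on S X" and g: "g \<in> X"
  shows "{f \<in> X. f (g p) = g p} = conj_by g ` {f \<in> X. f p = p}"
proof -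
  have b: "bij g" using X g permutes_bij by (auto simp: permutation_group_on_def)
  have i: "Hilbert_Choice.inv g \<in> X" using X g by (simp add: permutation_group_on_def)
  have in_X: "conj_by g f \<in> X" "conj_by (Hilbert_Choice.inv g) f \<in> X" if "f \<in> X" for f
    using X that g i b by (auto simp: conj_by_def permutation_group_on_def inv_inv_eq)
  have "f \<in> conj_by g ` {f \<in> X. f p = p}" if f: "f \<in> X" "f (g p) = g p" for f
  proof (rule image_eqI)
    show "f = conj_by g (conj_by (Hilbert_Choice.inv g) f)" using conj_by_inverse(2)[OF b] by simp
    have "conj_by (Hilbert_Choice.inv g) f p = p"
      using f(2) b by (simp add: conj_by_def inv_inv_eq bij_is_inj)
    then show "conj_by (Hilbert_Choice.inv g) f \<in> {f \<in> X. f p = p}" using in_X f(1) by simp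
  qed
  moreover have "conj_by g f (g p) = g p" if "f p = p" for f
    using that conj_by_apply[OF b] by simp
  ultimately show ?thesis using in_X by auto
qed

text \<open>
  A class with two points \<open>x\<close> and \<open>y\<close> contains every \<open>z\<close>: an element that fixes \<open>x\<close> and moves \<open>y\<close> to \<open>z\<close> maps the class to
  a class through \<open>x\<close>, which is the same class.
\<close>
lemma doubly_transitive_primitive:
  assumes S: "S \<noteq> {}" "finite S" and perm: "\<And>g. g \<in> X \<Longrightarrow> g permutes S"
    and trans: "\<And>x y. x \<in> S \<Longrightarrow> y \<in> S \<Longrightarrow> \<exists>g\<in>X. g x = y"
    and two: "\<And>x y x' y'. {x, y, x', y'} \<subseteq> S \<Longrightarrow> x \<noteq> y \<Longrightarrow> x' \<noteq> y' \<Longrightarrow> \<exists>g\<in>X. g x = x' \<and> g y = y'"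
  shows "primitive_on S X"
  unfolding primitive_on_def
proof (intro conjI ballI allI impI)
  fix Q assume Q: "partition_on S Q \<and> (\<forall>g\<in>X. \<forall>C\<in>Q. g ` C \<in> Q)"
  then have union: "\<Union>Q = S" and disj: "\<And>C C'. C \<in> Q \<Longrightarrow> C' \<in> Q \<Longrightarrow> C \<inter> C' \<noteq> {} \<Longrightarrow> C = C'"
    and ne: "{} \<notin> Q"
    by (auto simp: partition_on_def disjoint_def)
  show "Q = {S} \<or> Q = (\<lambda>x. {x}) ` S"
  proof (cases "\<exists>C\<in>Q. \<exists>x\<in>C. \<exists>y\<in>C. x \<noteq> y")
    case True
    then obtain C x y where C: "C \<in> Q" "x \<in> C" "y \<in> C" "x \<noteq> y" by blast
    have xyS: "x \<in> S" "y \<in> S" using C union by blast+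
    have "z \<in> C" if z: "z \<in> S" "z \<noteq> x" for z
    proof -
      obtain g where g: "g \<in> X" "g x = x" "g y = z" using two[of x y x z] xyS C z by auto
      then have "g ` C \<in> Q" "x \<in> g ` C" "z \<in> g ` C" using Q C by force+
      then show ?thesis using disj[of C "g ` C"] C by blast
    qed
    then have "C = S" using C union by blast
    have "C' = S" if "C' \<in> Q" for C'
    proof -
      have "C' \<noteq> {}" using that ne by metis
      moreover have "C' \<subseteq> C" using that union \<open>C = S\<close> by auto
      ultimately have "C' \<inter> C \<noteq> {}" by auto
      then show ?thesis using disj[OF that C(1)] \<open>C = S\<close> by simp
    qed
    then have "Q = {S}" using C(1) \<open>C = S\<close> by blast
    then show ?thesis by simp
  next
    case False
    then have single: "C = {x}" if "C \<in> Q" "x \<in> C" for C x using that by blast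
    have "{x} \<in> Q" if "x \<in> S" for x using that union single by blast
    moreover have "C \<in> (\<lambda>x. {x}) ` S" if "C \<in> Q" for C
      using that single ne union by (metis UnionI equals0I imageI)
    ultimately show ?thesis by blast
  qed
qed (use S trans in auto)

section \<open>Perfect forms, double transitivity and maximality\<close>

context binary_space
begin

lemma additive_bijections_permutation_group:
  "permutation_group_on P (additive_bijections :: ('a \<Rightarrow> 'a) set)"
proof -
  have "(id :: 'a \<Rightarrow> 'a) \<in> additive_bijections"
    by (simp add: additive_bijections_def additive_def)
  then show ?thesis
    by (auto simp: permutation_group_on_def additive_bijections_permutes additive_bijections_comp
        additive_bijections_inv)
qed

text \<open>
  The functional \<open>\<psi>\<close> does not vanish on the kernel of \<open>\<phi>\<close>, since otherwise the two would be equal, so it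
  halves that kernel.
\<close>
lemma card_two_kernels:
  assumes n: "n \<ge> 2" and \<phi>: "functional \<phi>" "\<phi> u" and \<psi>: "functional \<psi>" "\<psi> v"
    and neq: "\<phi> \<noteq> (\<psi> :: 'a \<Rightarrow> bool)"
  shows "card {x. \<not> \<phi> x \<and> \<not> \<psi> x} = 2 ^ (n - 2)"
proof -
  have n4: "(2::nat) ^ n = 4 * 2 ^ (n - 2)"
  proof -
    obtain m where "n = 2 + m" using n le_Suc_ex by blast
    then show ?thesis by simp
  qed
  let ?K = "{x. \<not> \<phi> x}"
  have "\<exists>w\<in>?K. \<psi> w"
  proof (rule ccontr)
    assume "\<not> ?thesis"
    then have imp: "\<psi> w \<Longrightarrow> \<phi> w" for w by blast
    have "\<phi> z \<longleftrightarrow> \<psi> z" for z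
      using imp[of z] imp[of "z + v"] \<psi>(2) imp[OF \<psi>(2)] by (auto simp: functionalD \<phi>(1) \<psi>(1))
    then show False using neq by (simp add: fun_eq_iff)
  qed
  then obtain w where w: "w \<in> ?K" "\<psi> w" by blast
  have "card ?K = 2 * card {x \<in> ?K. \<not> \<psi> x}"
    by (rule card_kernel[OF subspace2_kernel[OF \<phi>(1)] \<psi>(1) w])
  moreover have "2 * card ?K = 2 ^ n" by (rule card_hyperplane[OF \<phi>])
  ultimately have "card {x \<in> ?K. \<not> \<psi> x} = 2 ^ (n - 2)" using n4 by simp
  then show ?thesis by simp
qed

lemma card_hyperplane_nonzero:
  assumes n: "n \<ge> 1" and \<phi>: "functional \<phi>" "\<phi> u"
  shows "card {x \<in> P. \<not> \<phi> x} = 2 ^ (n - 1) - 1"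
proof -
  have "(2::nat) ^ n = 2 * 2 ^ (n - 1)" using n by (cases n) auto
  then have "card {x. \<not> \<phi> x} = 2 ^ (n - 1)" using card_hyperplane[OF \<phi>] by simp
  moreover have "{x \<in> P. \<not> \<phi> x} = {x. \<not> \<phi> x} - {0}" by auto
  ultimately show ?thesis using functional_0[OF \<phi>(1)] by (simp add: card_Diff_singleton)
qed

text \<open>
  If \<open>\<psi>\<close> were not of the form \<open>B y\<close>, its kernel would meet the kernel of \<open>B y\<close>, for
  every nonzero \<open>y\<close>, in a quarter of the space; counting the orthogonal pairs \<open>(y, x)\<close> with \<open>\<psi> x = 0\<close> in two ways refutes this.
\<close>
lemma injective_form_perfect:
  assumes n: "n \<ge> 2" and fn: "\<And>y. functional (B y)" and sym: "\<And>x y. B x y \<longleftrightarrow> B y x"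
    and inj: "inj B" and \<psi>: "functional \<psi>"
  shows "\<exists>!y::'a. \<psi> = B y"
proof (rule ex_ex1I)
  show "y = y'" if "\<psi> = B y" "\<psi> = B y'" for y y' using that inj by (auto dest: injD)
  show "\<exists>y. \<psi> = B y"
  proof (rule ccontr)
    assume no: "\<not> ?thesis"
    have B0: "B 0 = (\<lambda>_. False)" using functional_0[OF fn] sym by (auto simp: fun_eq_iff)
    then have "\<psi> \<noteq> (\<lambda>_. False)" using no by metis
    then obtain v where v: "\<psi> v" by auto
    have nz: "\<exists>u. B y u" if "y \<in> P" for y
    proof (rule ccontr)
      assume "\<not> ?thesis"
      then have "B y = B 0" by (simp add: B0 fun_eq_iff)
      then show False using that inj by (auto dest: injD)
    qed
    let ?N = "{x \<in> P. \<not> \<psi> x}"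
    have row: "card {x \<in> ?N. \<not> B y x} = 2 ^ (n - 2) - 1" if y: "y \<in> P" for y
    proof -
      obtain u where "B y u" using nz[OF y] by blast
      moreover have "\<psi> \<noteq> B y" using no by blast
      ultimately have "card {x. \<not> \<psi> x \<and> \<not> B y x} = 2 ^ (n - 2)"
        using card_two_kernels[OF n \<psi> v fn] by blast
      moreover have "{x \<in> ?N. \<not> B y x} = {x. \<not> \<psi> x \<and> \<not> B y x} - {0}" by auto
      ultimately show ?thesis using functional_0[OF \<psi>] functional_0[OF fn]
        by (simp add: card_Diff_singleton)
    qed
    have column: "card {y \<in> P. \<not> B y x} = 2 ^ (n - 1) - 1" if x: "x \<in> ?N" for x
    proof -
      obtain u where "B x u" using nz x by blast
      then have "card {y \<in> P. \<not> B x y} = 2 ^ (n - 1) - 1"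
        using n by (intro card_hyperplane_nonzero fn) auto
      then show ?thesis using sym by simp
    qed
    have "(\<Sum>y\<in>P. card {x \<in> ?N. \<not> B y x}) = (\<Sum>x\<in>?N. 2 ^ (n - 1) - 1)"
      by (rule sum_multicount_gen) (use column in auto)
    then have "card P * (2 ^ (n - 2) - 1) = card ?N * (2 ^ (n - 1) - 1)" using row by simp
    moreover have "card ?N = 2 ^ (n - 1) - 1"
      using n v by (intro card_hyperplane_nonzero \<psi>) auto
    ultimately have count: "(2 ^ n - 1) * (2 ^ (n - 2) - 1) = (2 ^ (n - 1) - 1) * (2 ^ (n - 1) - (1::nat))"
      by (simp add: card_P)
    obtain m where m: "n = 2 + m" using n le_Suc_ex by blast
    obtain k where k: "(2::nat) ^ m = Suc k" using not0_implies_Suc[of "2 ^ m"] by auto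
    have "(4 * k + 3) * k = (2 * k + 1) * (2 * k + (1::nat))"
      using count by (simp add: m k)
    then show False by (simp add: algebra_simps)
  qed
qed

text \<open>
  First move \<open>x\<close> to \<open>x'\<close>, then the image of \<open>y\<close> to \<open>y'\<close> by a transvection that fixes \<open>x'\<close>.
\<close>
lemma doubly_transitive:
  assumes xy: "x \<in> P" "y \<in> P" "x \<noteq> y" and xy': "x' \<in> P" "y' \<in> P" "x' \<noteq> y'"
  shows "\<exists>f\<in>additive_bijections. f x = x' \<and> f y = y'"
proof -
  have "x \<notin> {0}" "x' \<notin> {0}" using xy xy' by auto
  from transvection_move[OF subspace2_zero this]
  obtain \<phi> where \<phi>: "functional \<phi>" "\<not> \<phi> (x + x')" "transvection \<phi> (x + x') x = x'" by metis
  let ?f = "transvection \<phi> (x + x')"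
  have f: "?f \<in> additive_bijections" by (rule transvection_in[OF \<phi>(1,2)])
  let ?z = "?f y"
  have "?z \<noteq> 0"
    using permutes_in_image[OF additive_bijections_permutes[OF f], of y] xy by simp
  moreover have "?z \<noteq> x'"
    using \<phi>(3) xy(3) permutes_inj[OF additive_bijections_permutes[OF f]] by (metis injD)
  ultimately have z: "?z \<notin> {0, x'}" by blast
  have sub: "subspace2 {0, x'}" by (auto simp: subspace2_def double)
  have "y' \<notin> {0, x'}" using xy' by auto
  from transvection_move[OF sub z this]
  obtain \<psi> where \<psi>: "functional \<psi>" "\<not> \<psi> (?z + y')" "\<And>w. w \<in> {0, x'} \<Longrightarrow> \<not> \<psi> w"
    "transvection \<psi> (?z + y') ?z = y'" by metis
  let ?g = "transvection \<psi> (?z + y')"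
  have "?g \<circ> ?f \<in> additive_bijections"
    using additive_bijections_comp[OF transvection_in[OF \<psi>(1,2)] f] .
  moreover have "?g x' = x'" using \<psi>(3)[of x'] by (simp add: transvection_def)
  ultimately show ?thesis using \<phi>(3) \<psi>(4) by (intro bexI[of _ "?g \<circ> ?f"]) auto
qed

text \<open>
  A \<open>3\<close>-cycle \<open>(a b c)\<close> that fixes \<open>a + b\<close> is not additive, as \<open>c \<noteq> a\<close>; this needs
  \<open>c \<noteq> a + b\<close>, hence more than three points.
\<close>
lemma ex_not_additive_even:
  assumes n: "n \<ge> 3"
  shows "\<exists>\<sigma>. \<sigma> permutes P \<and> evenperm \<sigma> \<and> \<sigma> \<notin> additive_bijections"
proof -
  have "(2::nat) ^ 3 \<le> 2 ^ n" using n by (intro power_increasing) auto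
  then have big: "8 \<le> CARD('a)" by (simp add: card_space)
  have out: "\<exists>x. x \<notin> E" if "card E < 8" for E :: "'a set"
    using that big by (metis UNIV_eq_I not_le)
  obtain a :: 'a where a: "a \<noteq> 0" using out[of "{0}"] by auto
  obtain b where b: "b \<notin> {0, a}" using out[of "{0, a}"] a by auto
  have "card {0, a, b, a + b} \<le> 4" by (auto simp: card_insert_if)
  then obtain c where c: "c \<notin> {0, a, b, a + b}" using out[of "{0, a, b, a + b}"] by auto
  let ?\<sigma> = "three_cycle a b c"
  have app: "?\<sigma> x = (if x = a then b else if x = b then c else if x = c then a else x)" for x
    using a b c by (intro three_cycle_apply) auto
  have "?\<sigma> permutes P"
    unfolding three_cycle_def
    by (intro permutes_compose permutes_swap_id) (use a b c in auto)
  moreover have "evenperm ?\<sigma>" using a b c by (intro even_three_cycle) auto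
  moreover have "?\<sigma> \<notin> additive_bijections"
  proof
    assume "?\<sigma> \<in> additive_bijections"
    then have "?\<sigma> (a + b) = ?\<sigma> a + ?\<sigma> b" by (rule additive_bijections_add)
    moreover have "?\<sigma> (a + b) = a + b" using a b c by (auto simp: app)
    moreover have "?\<sigma> a = b" "?\<sigma> b = c" using b by (auto simp: app)
    ultimately show False using c by (simp add: add.commute)
  qed
  ultimately show ?thesis by blast
qed

theorem intermediate_group:
  assumes n: "n \<ge> 3" and K: "permutation_group_on P K"
    and sub: "additive_bijections \<subseteq> K" and neq: "K \<noteq> additive_bijections"
  shows "{\<sigma>. \<sigma> permutes P \<and> evenperm \<sigma>} \<subseteq> K"
proof -
  obtain g where g: "g \<in> K" "g \<notin> additive_bijections" using sub neq by blast
  then have "bij g" using K permutes_bij by (auto simp: permutation_group_on_def)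
  then have "\<not> additive g" using g(2) by (simp add: additive_bijections_def)
  interpret overgroup P n K
  proof
    show "\<exists>g\<in>K. \<not> additive g" using g(1) \<open>\<not> additive g\<close> by blast
    show "transvection \<phi> a \<in> K" if "functional \<phi>" "\<not> \<phi> a" for \<phi> a
      using transvection_in[OF that] sub by blast
  qed (use n K in \<open>auto simp: permutation_group_on_def\<close>)
  show ?thesis using contains_alternating by blast
qed

end

section \<open>The design of points and hyperplanes\<close>

text \<open>
  A perfect symmetric bilinear form \<open>B\<close>, with value \<open>1\<close> coded as truth.  It identifies vectors with
  functionals, and nonzero vectors with hyperplanes.
\<close>
locale dual_pairing = binary_space P n for P :: "'a::{ab_group_add,finite} set" and n +
  fixes B :: "'a \<Rightarrow> 'a \<Rightarrow> bool"
  assumes n_ge_2: "n \<ge> 2"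
    and B_functional: "functional (B y)"
    and B_commute: "B x y \<longleftrightarrow> B y x"
    and B_perfect: "functional \<phi> \<Longrightarrow> \<exists>!y. \<phi> = B y"
begin

definition hyper :: "'a \<Rightarrow> 'a set" where
  "hyper y = {x \<in> P. \<not> B y x}"

lemma B_add: "B y (x + x') \<longleftrightarrow> B y x \<noteq> B y x'" "B (x + x') y \<longleftrightarrow> B x y \<noteq> B x' y"
  using functionalD[OF B_functional] B_commute by blast+

lemma B_0 [simp]: "\<not> B y 0" "\<not> B 0 y"
  using functional_0[OF B_functional] B_commute by blast+

lemma B_eq: "B y = B z \<longleftrightarrow> y = z"
  using B_perfect[OF B_functional] by blast

lemma B_nonzero: "y \<noteq> 0 \<Longrightarrow> \<exists>x. B y x"
  using B_eq[of y 0] by (auto simp: fun_eq_iff)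

lemma hyper_kernel: "insert 0 (hyper y) = {x. \<not> B y x}"
  by (auto simp: hyper_def)

lemma hyper_inj: "hyper y = hyper z \<longleftrightarrow> y = z"
proof
  assume "hyper y = hyper z"
  then have "{x. \<not> B y x} = {x. \<not> B z x}" by (simp flip: hyper_kernel)
  then have "B y = B z" by (auto simp: fun_eq_iff)
  then show "y = z" by (simp add: B_eq)
qed simp

lemma card_hyper:
  assumes "y \<in> P"
  shows "card (hyper y) = 2 ^ (n - 1) - 1"
proof -
  obtain x where "B y x" using B_nonzero assms by auto
  then show ?thesis
    unfolding hyper_def using n_ge_2 by (intro card_hyperplane_nonzero B_functional) auto
qed

lemma card_hyper_pair:
  assumes xy: "x \<in> P" "y \<in> P" "x \<noteq> y"
  shows "card {z \<in> P. {x, y} \<subseteq> hyper z} = 2 ^ (n - 2) - 1"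
proof -
  obtain u v where "B x u" "B y v" using B_nonzero xy by (metis in_P)
  moreover have "B x \<noteq> B y" using xy B_eq by blast
  ultimately have "card {z. \<not> B x z \<and> \<not> B y z} = 2 ^ (n - 2)"
    using card_two_kernels[OF n_ge_2 B_functional _ B_functional] by blast
  moreover have "{z \<in> P. {x, y} \<subseteq> hyper z} = {z. \<not> B x z \<and> \<not> B y z} - {0}"
    using xy B_commute by (auto simp: hyper_def)
  ultimately show ?thesis by (simp add: card_Diff_singleton)
qed

text \<open>
  The inverse of the adjoint of \<open>f\<close> with respect to \<open>B\<close>.
\<close>
definition dual_map :: "('a \<Rightarrow> 'a) \<Rightarrow> 'a \<Rightarrow> 'a" where
  "dual_map f y = (THE z. (\<lambda>x. B y (Hilbert_Choice.inv f x)) = B z)"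

lemma dual_map:
  assumes f: "f \<in> additive_bijections"
  shows "B (dual_map f y) (f x) \<longleftrightarrow> B y x"
proof -
  have i: "Hilbert_Choice.inv f \<in> additive_bijections" by (rule additive_bijections_inv[OF f])
  have "functional (\<lambda>x. B y (Hilbert_Choice.inv f x))"
    unfolding functional_def by (simp add: additive_bijections_add[OF i] B_add)
  then have "\<exists>!z. (\<lambda>x. B y (Hilbert_Choice.inv f x)) = B z" by (rule B_perfect)
  then have "(\<lambda>x. B y (Hilbert_Choice.inv f x)) = B (dual_map f y)"
    unfolding dual_map_def by (rule theI')
  from fun_cong[OF this, of "f x"] show ?thesis
    using additive_bijections_bij[OF f] by (simp add: bij_is_inj)
qed

lemma dual_map_unique:
  assumes f: "f \<in> additive_bijections" and z: "\<And>x. B z (f x) \<longleftrightarrow> B y x"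
  shows "dual_map f y = z"
proof -
  have "B (dual_map f y) = B z"
  proof
    show "B (dual_map f y) x = B z x" for x
    using dual_map[OF f, of y "Hilbert_Choice.inv f x"] z[of "Hilbert_Choice.inv f x"]
      additive_bijections_bij[OF f] by (simp add: bij_is_surj surj_f_inv_f)
  qed
  then show ?thesis by (simp only: B_eq)
qed

lemma dual_map_in:
  assumes f: "f \<in> additive_bijections"
  shows "dual_map f \<in> additive_bijections"
proof (rule finite_additive_bijection)
  show "dual_map f (x + y) = dual_map f x + dual_map f y" for x y
    by (rule dual_map_unique[OF f]) (simp add: B_add dual_map[OF f])
  fix x assume "dual_map f x = 0"
  then have "B x = B 0" using dual_map[OF f, of x] by (auto simp: fun_eq_iff)
  then show "x = 0" by (simp add: B_eq)
qed

lemma dual_map_dual_map: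
  assumes f: "f \<in> additive_bijections"
  shows "dual_map (dual_map f) = f"
proof
  show "dual_map (dual_map f) y = f y" for y
    by (rule dual_map_unique[OF dual_map_in[OF f]]) (metis B_commute dual_map[OF f])
qed

lemma dual_map_comp:
  assumes f: "f \<in> additive_bijections" and g: "g \<in> additive_bijections"
  shows "dual_map (f \<circ> g) = dual_map f \<circ> dual_map g"
proof
  show "dual_map (f \<circ> g) y = (dual_map f \<circ> dual_map g) y" for y
    by (rule dual_map_unique[OF additive_bijections_comp[OF f g]]) (simp add: dual_map f g)
qed

lemma image_hyper:
  assumes f: "f \<in> additive_bijections"
  shows "f ` hyper y = hyper (dual_map f y)"
proof (rule Set.set_eqI)
  note p = additive_bijections_permutes[OF f]
  fix z
  obtain x where z: "z = f x" using additive_bijections_bij[OF f] by (metis bij_pointE)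
  have "f x \<in> f ` hyper y \<longleftrightarrow> x \<in> hyper y"
    by (rule inj_image_mem_iff[OF permutes_inj[OF p]])
  then show "z \<in> f ` hyper y \<longleftrightarrow> z \<in> hyper (dual_map f y)"
    using permutes_in_image[OF p, of x] by (simp add: z hyper_def dual_map[OF f] del: in_P)
qed

text \<open>
  Since \<open>f\<close> is the dual of its dual, \<open>dual_map f\<close> sends the hyperplane of \<open>p\<close> to that of \<open>f p\<close>.
\<close>
lemma point_stabilizer_iff:
  assumes f: "f \<in> additive_bijections"
  shows "f p = p \<longleftrightarrow> dual_map f ` hyper p = hyper p"
proof -
  have "dual_map f ` hyper p = hyper (f p)"
    using image_hyper[OF dual_map_in[OF f], of p] dual_map_dual_map[OF f] by simp
  then show ?thesis using hyper_inj by simp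
qed

lemma hyper_image_kernel:
  assumes f: "f \<in> additive_bijections"
  shows "f ` hyper y = hyper y \<longleftrightarrow> f ` {x. \<not> B y x} = {x. \<not> B y x}"
proof -
  have "0 \<notin> hyper y" "0 \<notin> f ` hyper y"
    unfolding image_hyper[OF f] by (auto simp: hyper_def)
  then show ?thesis
    unfolding hyper_kernel[symmetric] image_insert additive_bijections_0[OF f]
    by (metis insert_ident)
qed

lemma block_stabilizer_iso:
  assumes "y \<in> P"
  shows "(sym_group_on P)\<lparr>carrier := {f \<in> additive_bijections. f ` hyper y = hyper y}\<rparr> \<cong> AGL2 (n - 1)"
proof -
  obtain u where u: "B y u" using B_nonzero assms by auto
  have "{f \<in> additive_bijections. f ` hyper y = hyper y}
    = {f \<in> additive_bijections. f ` {x. \<not> B y x} = {x. \<not> B y x}}"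
    using hyper_image_kernel by blast
  then show ?thesis using hyperplane_stabilizer_iso_AGL2[OF B_functional u] by simp
qed

lemma point_stabilizer_iso:
  assumes "p \<in> P"
  shows "(sym_group_on P)\<lparr>carrier := {f \<in> additive_bijections. f p = p}\<rparr> \<cong> AGL2 (n - 1)"
proof -
  let ?X = "{f \<in> additive_bijections. f p = p}"
  let ?Y = "{f \<in> additive_bijections. f ` hyper p = hyper p}"
  have XY: "dual_map f \<in> ?Y" if "f \<in> ?X" for f
    using that dual_map_in[of f] point_stabilizer_iff[of f p] by simp
  have YX: "dual_map f \<in> ?X" if "f \<in> ?Y" for f
    using that dual_map_in[of f] point_stabilizer_iff[of "dual_map f" p] dual_map_dual_map[of f] by simp
  have "bij_betw dual_map ?X ?Y"
    by (rule bij_betw_byWitness[where f' = dual_map])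
       (use XY YX dual_map_dual_map in blast)+
  then have "dual_map \<in> iso ((sym_group_on P)\<lparr>carrier := ?X\<rparr>) ((sym_group_on P)\<lparr>carrier := ?Y\<rparr>)"
    using XY by (intro isoI homI) (simp_all add: dual_map_comp)
  then have "(sym_group_on P)\<lparr>carrier := ?X\<rparr> \<cong> (sym_group_on P)\<lparr>carrier := ?Y\<rparr>"
    by (rule is_isoI)
  also have "\<dots> \<cong> AGL2 (n - 1)" by (rule block_stabilizer_iso[OF assms])
  finally show ?thesis .
qed

text \<open>
  If \<open>f (x + y)\<close> were outside the line through \<open>f x\<close> and \<open>f y\<close>, some hyperplane would contain \<open>f x\<close> and \<open>f y\<close>
  but not \<open>f (x + y)\<close>.  As \<open>f\<close> permutes the finitely many blocks, that hyperplane is the image of a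
  block, which contains \<open>x\<close> and \<open>y\<close> and so \<open>x + y\<close>.
\<close>
lemma hyperplane_automorphisms:
  assumes f: "f permutes P"
  shows "(\<forall>y\<in>P. f ` hyper y \<in> hyper ` P) \<longleftrightarrow> f \<in> additive_bijections"
proof
  assume "f \<in> additive_bijections"
  then show "\<forall>y\<in>P. f ` hyper y \<in> hyper ` P"
    using image_hyper permutes_in_image[OF additive_bijections_permutes[OF dual_map_in]] by blast
next
  assume blocks: "\<forall>y\<in>P. f ` hyper y \<in> hyper ` P"
  have inj: "f x = f y \<longleftrightarrow> x = y" for x y using permutes_inj[OF f] by (auto dest: injD)
  have "image f ` hyper ` P \<subseteq> hyper ` P" using blocks by blast
  moreover have "inj_on (image f) (hyper ` P)"
    using permutes_inj[OF f] by (auto simp: inj_on_def inj_image_eq_iff)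
  ultimately have onto: "image f ` hyper ` P = hyper ` P"
    by (intro endo_inj_surj) auto
  have f0: "f 0 = 0" using permutes_not_in[OF f, of 0] by simp
  have "f (x + y) = f x + f y" for x y
  proof (cases "x = 0 \<or> y = 0 \<or> x = y")
    case True
    then show ?thesis using f0 by (auto simp: double)
  next
    case False
    let ?W = "{0, f x, f y, f x + f y}"
    have "subspace2 ?W" by (auto simp: subspace2_def double add.commute)
    have "f (x + y) \<in> ?W"
    proof (rule ccontr)
      assume "f (x + y) \<notin> ?W"
      then obtain \<phi> where \<phi>: "functional \<phi>" "\<And>w. w \<in> ?W \<Longrightarrow> \<not> \<phi> w" "\<phi> (f (x + y))"
        using separation[OF \<open>subspace2 ?W\<close>] by metis
      obtain z where z: "\<phi> = B z" using B_perfect[OF \<phi>(1)] by blast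
      have "z \<in> P" using \<phi>(3) z by auto
      then have "hyper z \<in> image f ` hyper ` P" using onto by blast
      then obtain w where w: "hyper z = f ` hyper w" by blast
      have mem: "f v \<in> hyper z \<longleftrightarrow> v \<in> hyper w" for v
        unfolding w by (rule inj_image_mem_iff[OF permutes_inj[OF f]])
      have "f x \<in> P" "f y \<in> P" using permutes_in_image[OF f] False by auto
      then have "f x \<in> hyper z" "f y \<in> hyper z" using \<phi>(2) z by (auto simp: hyper_def)
      then have "x \<in> hyper w" "y \<in> hyper w" by (simp_all only: mem)
      then have "x + y \<in> hyper w" using False by (auto simp: hyper_def B_add)
      then have "f (x + y) \<in> hyper z" using mem by blast
      then show False using \<phi>(3) z by (simp add: hyper_def)
    qed
    moreover have "f (x + y) \<noteq> f x" "f (x + y) \<noteq> f y" "f (x + y) \<noteq> f 0"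
      using False by (auto simp: inj)
    ultimately show ?thesis using f0 by auto
  qed
  then show "f \<in> additive_bijections"
    using permutes_bij[OF f] by (simp add: additive_bijections_def additive_def)
qed

text \<open>
  A transvection with centre \<open>a\<close> in the hyperplane preserves it.  For \<open>n \<ge> 3\<close> the centre can be chosen
  different from \<open>p\<close>, and then the functional can be chosen to be \<open>1\<close> at \<open>p\<close>.
\<close>
lemma hyper_stabilizer_moves:
  assumes n: "n \<ge> 3" and y: "y \<in> P" and p: "p \<in> P"
  shows "\<exists>f\<in>additive_bijections. f ` hyper y = hyper y \<and> f p \<noteq> p"
proof -
  have "(2::nat) ^ 2 \<le> 2 ^ (n - 1)" using n by (intro power_increasing) auto
  then have "card (hyper y) \<ge> 3" using card_hyper[OF y] by simp
  then have "\<not> hyper y \<subseteq> {p}" using card_mono[of "{p}" "hyper y"] by auto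
  then obtain a where a: "a \<in> hyper y" "a \<noteq> p" by blast
  then have a0: "a \<noteq> 0" "\<not> B y a" by (auto simp: hyper_def)
  have "subspace2 {0, a}" by (auto simp: subspace2_def double)
  moreover have "p \<notin> {0, a}" using p a by auto
  ultimately obtain \<psi> where \<psi>: "functional \<psi>" "\<And>w. w \<in> {0, a} \<Longrightarrow> \<not> \<psi> w" "\<psi> p"
    using separation by metis
  let ?t = "transvection \<psi> a"
  have t: "?t \<in> additive_bijections" using \<psi> by (intro transvection_in) auto
  have "dual_map ?t y = y"
    by (rule dual_map_unique[OF t]) (auto simp: transvection_def B_add a0)
  then have "?t ` hyper y = hyper y" using image_hyper[OF t] by simp
  moreover have "?t p \<noteq> p" using \<psi>(3) a0 by (simp add: transvection_def)
  ultimately show ?thesis using t by blast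
qed

end

section \<open>Images of the hyperplane design\<close>

text \<open>
  The permutation \<open>s\<close> is what allows both designs of the theorem to be treated at once.
\<close>
locale transported_design = dual_pairing P n B
  for P :: "'a::{ab_group_add,finite} set" and n B +
  fixes s :: "'a \<Rightarrow> 'a"
  assumes s_permutes: "s permutes P"
begin

abbreviation linear_group :: "('a \<Rightarrow> 'a) set" where
  "linear_group \<equiv> additive_bijections"

definition D :: "'a incidence" where
  "D = (P, (\<lambda>y. s ` hyper y) ` P)"

lemma bij_s: "bij s"
  by (rule permutes_bij[OF s_permutes])

lemma s_in_P: "s x \<in> P \<longleftrightarrow> x \<in> P"
  by (rule permutes_in_image[OF s_permutes])

lemma fst_D [simp]: "fst D = P"
  by (simp add: D_def)

lemma block_inj: "inj_on (\<lambda>y. s ` hyper y) A"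
  by (simp add: inj_on_def inj_image_eq_iff[OF bij_is_inj[OF bij_s]] hyper_inj)

lemma ex_preimage: "x \<in> P \<Longrightarrow> \<exists>x'\<in>P. x = s x'"
  using permutes_image[OF s_permutes] by blast

lemma design: "is_design 2 (2 ^ n - 1) (2 ^ (n - 1) - 1) (2 ^ (n - 2) - 1) D"
  unfolding is_design_def
proof (intro conjI ballI allI impI)
  fix X assume "X \<in> snd D"
  then obtain y where y: "y \<in> P" "X = s ` hyper y" by (auto simp: D_def)
  have "hyper y \<subseteq> P" by (auto simp: hyper_def)
  then show "X \<subseteq> fst D" using y s_in_P by auto
  show "card X = 2 ^ (n - 1) - 1"
    using y card_hyper card_image[OF inj_on_subset[OF bij_is_inj[OF bij_s]], of "hyper y"] by simp
next
  fix T assume T: "T \<subseteq> fst D \<and> card T = 2"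
  then obtain x y where xy: "T = {x, y}" "x \<noteq> y" by (auto simp: card_2_iff)
  then obtain x' y' where xy': "x' \<in> P" "y' \<in> P" "x = s x'" "y = s y'"
    using T ex_preimage[of x] ex_preimage[of y] by auto
  have "T \<subseteq> s ` hyper z \<longleftrightarrow> {x', y'} \<subseteq> hyper z" for z
    using xy xy' by (simp add: inj_image_mem_iff[OF bij_is_inj[OF bij_s]])
  then have "{X \<in> snd D. T \<subseteq> X} = (\<lambda>y. s ` hyper y) ` {z \<in> P. {x', y'} \<subseteq> hyper z}"
    unfolding D_def by auto
  then have "card {X \<in> snd D. T \<subseteq> X} = card {z \<in> P. {x', y'} \<subseteq> hyper z}"
    by (simp only: card_image[OF block_inj])
  then show "card {X \<in> snd D. T \<subseteq> X} = 2 ^ (n - 2) - 1"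
    using card_hyper_pair[of x' y'] xy xy' by force
qed (simp_all add: card_P)

lemma Aut_D: "Aut D = conj_by s ` linear_group"
proof -
  have "g \<in> Aut D \<longleftrightarrow> g permutes P \<and> conj_by (Hilbert_Choice.inv s) g \<in> linear_group" for g
  proof (cases "g permutes P")
    case True
    let ?f = "conj_by (Hilbert_Choice.inv s) g"
    have f: "?f permutes P" by (intro conj_by_permutes permutes_inv s_permutes True)
    have "g ` s ` hyper y = s ` ?f ` hyper y" for y
      using bij_s by (simp add: image_image conj_by_def inv_inv_eq bij_is_surj surj_f_inv_f)
    then have "g ` s ` hyper y \<in> (\<lambda>y. s ` hyper y) ` P \<longleftrightarrow> ?f ` hyper y \<in> hyper ` P" for y
      using bij_s by (auto simp: inj_image_eq_iff bij_is_inj)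
    then have "(\<forall>X\<in>snd D. g ` X \<in> snd D) \<longleftrightarrow> (\<forall>y\<in>P. ?f ` hyper y \<in> hyper ` P)"
      by (auto simp: D_def)
    then show ?thesis
      using True permutes_imp_bij[OF True] hyperplane_automorphisms[OF f]
      by (simp add: Aut_def design_iso_def)
  qed (simp add: Aut_def)
  moreover have "g permutes P" if "conj_by (Hilbert_Choice.inv s) g \<in> linear_group" for g
    using conj_by_permutes[OF s_permutes additive_bijections_permutes[OF that]]
      conj_by_inverse(2)[OF bij_s] by simp
  ultimately show ?thesis
    by (intro Set.set_eqI) (simp only: conj_by_image_iff[OF bij_s], blast)
qed

lemma aut_group_D: "aut_group D = (sym_group_on P)\<lparr>carrier := Aut D\<rparr>"
  by (simp add: aut_group_def)

lemma Aut_permutation_group: "permutation_group_on P (Aut D)"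
  unfolding Aut_D by (rule conj_by_permutation_group[OF s_permutes additive_bijections_permutation_group])

lemma aut_group_iso: "(sym_group_on P)\<lparr>carrier := linear_group\<rparr> \<cong> aut_group D"
  unfolding aut_group_D Aut_D by (rule conj_by_iso[OF bij_s])

lemma stabilizer_iso:
  assumes iso: "(sym_group_on P)\<lparr>carrier := {f \<in> linear_group. R f}\<rparr> \<cong> A"
    and R: "\<And>f. R' (conj_by s f) \<longleftrightarrow> R f"
  shows "(sym_group_on P)\<lparr>carrier := {g \<in> Aut D. R' g}\<rparr> \<cong> A"
proof -
  have "g \<in> conj_by s ` {f \<in> linear_group. R f} \<longleftrightarrow> g \<in> {g \<in> Aut D. R' g}" for g
    using R[of "conj_by (Hilbert_Choice.inv s) g"]
    by (simp add: conj_by_image_iff[OF bij_s] Aut_D conj_by_inverse(2)[OF bij_s])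
  then have "conj_by s ` {f \<in> linear_group. R f} = {g \<in> Aut D. R' g}" by blast
  then have eq: "conj_by (Hilbert_Choice.inv s) ` {g \<in> Aut D. R' g} = {f \<in> linear_group. R f}"
    by (simp flip: \<open>conj_by s ` _ = _\<close> add: image_image conj_by_inverse(1)[OF bij_s])
  have "(sym_group_on P)\<lparr>carrier := {g \<in> Aut D. R' g}\<rparr>
      \<cong> (sym_group_on P)\<lparr>carrier := conj_by (Hilbert_Choice.inv s) ` {g \<in> Aut D. R' g}\<rparr>"
    by (rule conj_by_iso[OF bij_imp_bij_inv[OF bij_s]])
  then show ?thesis using iso unfolding eq by (rule iso_trans)
qed

lemma point_stabilizer_D: "point_stabilizer (aut_group D) p = {g \<in> Aut D. g p = p}"
  by (simp add: point_stabilizer_def stabilizer_def aut_group_D)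

lemma block_stabilizer_D: "block_stabilizer (aut_group D) X = {g \<in> Aut D. g ` X = X}"
  by (simp add: block_stabilizer_def stabilizer_def aut_group_D)

lemma conj_by_fixes: "conj_by s f (s x) = s x \<longleftrightarrow> f x = x"
  using bij_s by (simp add: conj_by_apply bij_is_inj inj_eq)

lemma conj_by_stabilizes: "conj_by s f ` s ` X = s ` X \<longleftrightarrow> f ` X = X"
proof -
  have "conj_by s f ` s ` X = s ` f ` X" by (simp add: image_image conj_by_apply[OF bij_s])
  then show ?thesis using bij_s by (simp add: inj_image_eq_iff bij_is_inj)
qed

lemma point_stabilizer_D_iso:
  assumes "p \<in> P"
  shows "(aut_group D)\<lparr>carrier := point_stabilizer (aut_group D) p\<rparr> \<cong> AGL2 (n - 1)"
proof -
  obtain p' where p': "p' \<in> P" "p = s p'" using ex_preimage[OF assms] by blast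
  have "(sym_group_on P)\<lparr>carrier := {g \<in> Aut D. g p = p}\<rparr> \<cong> AGL2 (n - 1)"
    by (rule stabilizer_iso[OF point_stabilizer_iso[OF p'(1)]]) (simp add: p' conj_by_fixes)
  then show ?thesis unfolding point_stabilizer_D by (simp add: aut_group_D)
qed

lemma block_stabilizer_D_iso:
  assumes "X \<in> snd D"
  shows "(aut_group D)\<lparr>carrier := block_stabilizer (aut_group D) X\<rparr> \<cong> AGL2 (n - 1)"
proof -
  obtain y where y: "y \<in> P" "X = s ` hyper y" using assms by (auto simp: D_def)
  have "(sym_group_on P)\<lparr>carrier := {g \<in> Aut D. g ` X = X}\<rparr> \<cong> AGL2 (n - 1)"
    by (rule stabilizer_iso[OF block_stabilizer_iso[OF y(1)]]) (simp add: y conj_by_stabilizes)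
  then show ?thesis unfolding block_stabilizer_D by (simp add: aut_group_D)
qed

lemma Aut_doubly_transitive:
  assumes "{x, y, x', y'} \<subseteq> P" "x \<noteq> y" "x' \<noteq> y'"
  shows "\<exists>g\<in>Aut D. g x = x' \<and> g y = y'"
proof -
  obtain a b a' b' where a: "a \<in> P" "b \<in> P" "a' \<in> P" "b' \<in> P"
    "x = s a" "y = s b" "x' = s a'" "y' = s b'"
    using assms(1) ex_preimage by (metis insert_subset)
  then obtain f where "f \<in> linear_group" "f a = a'" "f b = b'"
    using doubly_transitive[of a b a' b'] assms by auto
  then show ?thesis
    unfolding Aut_D using a by (intro bexI[of _ "conj_by s f"]) (auto simp: conj_by_apply[OF bij_s])
qed

lemma Aut_transitive:
  assumes "x \<in> P" "y \<in> P"
  shows "\<exists>g\<in>Aut D. g x = y"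
proof -
  have "card P \<ge> 3"
    using power_increasing[OF n_ge_2, of "2::nat"] by (simp add: card_P)
  then have "\<not> P \<subseteq> {x}" "\<not> P \<subseteq> {y}"
    using card_mono[of "{x}" P] card_mono[of "{y}" P] by auto
  then obtain x' y' where "x' \<in> P" "y' \<in> P" "x \<noteq> x'" "y \<noteq> y'" by blast
  then show ?thesis using Aut_doubly_transitive[of x x' y y'] assms by auto
qed

lemma primitive: "primitive_on P (Aut D)"
proof (rule doubly_transitive_primitive)
  have "card P \<noteq> 0" using power_increasing[OF n_ge_2, of "2::nat"] by (simp add: card_P)
  then show "P \<noteq> {}" by auto
  show "g permutes P" if "g \<in> Aut D" for g using that by (simp add: Aut_def)
qed (use Aut_transitive Aut_doubly_transitive in auto)

text \<open>
  An intermediate group is conjugated back by \<open>s\<close> to a group containing the linear group.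
\<close>
lemma maximal:
  assumes n: "n \<ge> 3"
  shows "maximal_subgroup (Aut D) (alt_group_on P)"
proof -
  let ?A = "{\<sigma>. \<sigma> permutes P \<and> evenperm \<sigma>}"
  have A: "permutation_group_on P ?A" by (rule alt_group_on_permutation_group) simp
  have alt: "alt_group_on P = (sym_group_on P)\<lparr>carrier := ?A\<rparr>"
    by (simp add: alt_group_on_def)
  have even: "evenperm (conj_by s f) = evenperm f" if "f permutes P" for f
    by (rule conj_by_even[OF _ s_permutes that]) simp
  have perm: "conj_by s f permutes P" if "f permutes P" for f
    using conj_by_permutes s_permutes that by blast
  have "Aut D \<subseteq> ?A"
    unfolding Aut_D
    using additive_bijections_permutes additive_bijections_even[OF n] even perm by auto
  then have "subgroup (Aut D) (alt_group_on P)"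
    unfolding alt subgroup_iff_permutation_group_on[OF A] using Aut_permutation_group by blast
  moreover obtain \<sigma> where \<sigma>: "\<sigma> permutes P" "evenperm \<sigma>" "\<sigma> \<notin> linear_group"
    using ex_not_additive_even[OF n] by blast
  then have "conj_by s \<sigma> \<in> ?A" "conj_by s \<sigma> \<notin> Aut D"
    using even perm conj_by_mem[OF bij_s] by (auto simp: Aut_D)
  then have "Aut D \<noteq> carrier (alt_group_on P)" unfolding alt by auto
  moreover have "K = Aut D \<or> K = carrier (alt_group_on P)"
    if K: "subgroup K (alt_group_on P)" "Aut D \<subseteq> K" for K
  proof (rule disjCI)
    assume neq: "K \<noteq> carrier (alt_group_on P)"
    have K': "permutation_group_on P K" "K \<subseteq> ?A"
      using K(1) unfolding alt subgroup_iff_permutation_group_on[OF A] by auto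
    let ?i = "Hilbert_Choice.inv s"
    let ?K = "conj_by ?i ` K"
    have from_K: "conj_by s f \<in> K" if "f \<in> ?K" for f
      using that conj_by_inverse(2)[OF bij_s] by auto
    have to_K: "f \<in> ?K" if "conj_by s f \<in> K" for f
      using that conj_by_inverse(1)[OF bij_s] by (metis imageI)
    show "K = Aut D"
    proof (rule ccontr)
      assume K_neq: "K \<noteq> Aut D"
      have "linear_group \<subseteq> ?K" using to_K K(2) Aut_D by blast
      moreover have "?K \<noteq> linear_group"
      proof
        assume eq: "?K = linear_group"
        have "g \<in> Aut D" if "g \<in> K" for g
        proof -
          have "conj_by ?i g \<in> linear_group" using that eq by blast
          then show ?thesis unfolding Aut_D using conj_by_inverse(2)[OF bij_s, of g] by (metis imageI)
        qed
        then show False using K(2) K_neq by blast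
      qed
      moreover have "permutation_group_on P ?K"
        by (rule conj_by_permutation_group[OF permutes_inv[OF s_permutes] K'(1)])
      ultimately have "?A \<subseteq> ?K" using intermediate_group[OF n] by blast
      have "g \<in> K" if g: "g \<in> ?A" for g
      proof -
        have p: "conj_by ?i g permutes P"
          using g by (intro conj_by_permutes permutes_inv s_permutes) simp
        then have "evenperm (conj_by ?i g)"
          using even[OF p] conj_by_inverse(2)[OF bij_s, of g] g by simp
        then have "conj_by ?i g \<in> ?K" using p \<open>?A \<subseteq> ?K\<close> by blast
        then show ?thesis using from_K conj_by_inverse(2)[OF bij_s, of g] by force
      qed
      then show False using neq K'(2) unfolding alt by auto
    qed
  qed
  ultimately show ?thesis by (simp add: maximal_subgroup_def)
qed

lemma stabilizers_conjugate:
  assumes n: "n = 2" and p: "p \<in> P" and X: "X \<in> snd D"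
  shows "conjugate_in (aut_group D) (point_stabilizer (aut_group D) p) (block_stabilizer (aut_group D) X)"
proof -
  obtain y where y: "y \<in> P" "X = s ` hyper y" using X by (auto simp: D_def)
  have "card (hyper y) = 1" using card_hyper[OF y(1)] n by simp
  then obtain h where h: "hyper y = {h}" by (auto simp: card_1_singleton_iff)
  then have "h \<in> P" by (auto simp: hyper_def)
  then have "s h \<in> P" by (simp only: s_in_P)
  then obtain g where g: "g \<in> Aut D" "g p = s h" using Aut_transitive p by blast
  have "{f \<in> Aut D. f ` X = X} = {f \<in> Aut D. f (g p) = g p}" by (simp add: y h g)
  also have "\<dots> = conj_by g ` {f \<in> Aut D. f p = p}"
    by (rule conj_by_point_stabilizer[OF Aut_permutation_group g(1)])
  finally show ?thesis
    unfolding point_stabilizer_D block_stabilizer_D unfolding aut_group_D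
      conjugate_in_permutation_group[OF Aut_permutation_group] using g(1) by blast
qed

text \<open>
  Every conjugate of a point stabilizer fixes a point, whereas the stabilizer of a block fixes none if \<open>n \<ge> 3\<close>.
\<close>
lemma stabilizers_not_conjugate:
  assumes n: "n \<ge> 3" and p: "p \<in> P" and X: "X \<in> snd D"
  shows "\<not> conjugate_in (aut_group D) (point_stabilizer (aut_group D) p) (block_stabilizer (aut_group D) X)"
proof
  assume "conjugate_in (aut_group D) (point_stabilizer (aut_group D) p) (block_stabilizer (aut_group D) X)"
  then obtain g where g: "g \<in> Aut D" "{f \<in> Aut D. f ` X = X} = conj_by g ` {f \<in> Aut D. f p = p}"
    unfolding point_stabilizer_D block_stabilizer_D unfolding aut_group_D
      conjugate_in_permutation_group[OF Aut_permutation_group] by blast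
  obtain y where y: "y \<in> P" "X = s ` hyper y" using X by (auto simp: D_def)
  have "g permutes P" using g(1) by (simp add: Aut_def)
  then have "g p \<in> P" using p permutes_in_image by metis
  then obtain p' where p': "p' \<in> P" "g p = s p'" using ex_preimage by blast
  obtain f where f: "f \<in> linear_group" "f ` hyper y = hyper y" "f p' \<noteq> p'"
    using hyper_stabilizer_moves[OF n y(1) p'(1)] by blast
  have "conj_by s f \<in> {f \<in> Aut D. f ` X = X}"
    unfolding Aut_D y(2) using f by (simp add: conj_by_stabilizes)
  then have "conj_by s f \<in> {f \<in> Aut D. f (g p) = g p}"
    unfolding g(2) conj_by_point_stabilizer[OF Aut_permutation_group g(1)] .
  then show False using f(3) unfolding p'(2) by (simp add: conj_by_fixes)
qed

lemma automorphism_group_properties: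
  "primitive_on P (Aut D) \<and>
   (n \<ge> 3 \<longrightarrow> maximal_subgroup (Aut D) (alt_group_on P)) \<and>
   (\<forall>p\<in>P. (aut_group D)\<lparr>carrier := point_stabilizer (aut_group D) p\<rparr> \<cong> AGL2 (n - 1)) \<and>
   (\<forall>X\<in>snd D. (aut_group D)\<lparr>carrier := block_stabilizer (aut_group D) X\<rparr> \<cong> AGL2 (n - 1)) \<and>
   (\<forall>p\<in>P. \<forall>X\<in>snd D.
     (n = 2 \<longrightarrow> conjugate_in (aut_group D)
        (point_stabilizer (aut_group D) p) (block_stabilizer (aut_group D) X)) \<and>
     (n \<ge> 3 \<longrightarrow> \<not> conjugate_in (aut_group D)
        (point_stabilizer (aut_group D) p) (block_stabilizer (aut_group D) X)))"
  using primitive maximal point_stabilizer_D_iso block_stabilizer_D_iso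
    stabilizers_conjugate stabilizers_not_conjugate by blast

end

section \<open>The two designs over a field of even order\<close>

text \<open>
  Multiplication by \<open>c\<close> permutes \<open>S\<close>, so the product over \<open>S\<close> equals \<open>c\<close> to the power \<open>card S\<close> times itself.
\<close>
lemma power_card_invariant:
  fixes c :: "'a::field"
  assumes "finite S" "0 \<notin> S" "c \<noteq> 0" "(*) c ` S = S"
  shows "c ^ card S = 1"
proof -
  have inj: "inj_on ((*) c) S" using assms(3) by (simp add: inj_on_def)
  have "prod id S = prod id ((*) c ` S)" by (simp only: assms(4))
  also have "\<dots> = (\<Prod>x\<in>S. c * x)" by (simp add: prod.reindex[OF inj])
  also have "\<dots> = c ^ card S * prod id S" by (simp add: prod.distrib)
  finally show ?thesis using assms(1,2) by auto
qed

locale binary_field =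
  fixes T :: "'a::{field,finite} itself" and n :: nat
  assumes n_ge_2: "n \<ge> 2" and card_field: "CARD('a) = 2 ^ n"
begin

lemma power_card_nonzero:
  fixes c :: 'a
  assumes "c \<noteq> 0"
  shows "c ^ (2 ^ n - 1) = 1"
proof -
  have "x \<in> (*) c ` (- {0})" if "x \<noteq> 0" for x
    by (rule image_eqI[of _ _ "x / c"]) (use that assms in auto)
  moreover have "(*) c ` (- {0}) \<subseteq> - {0}" using assms by auto
  ultimately have "(*) c ` (- {0}) = - {0}" by blast
  then have "c ^ card (- {0::'a}) = 1" using assms by (intro power_card_invariant) auto
  moreover have "card (- {0::'a}) = 2 ^ n - 1"
    by (simp add: Compl_eq_Diff_UNIV card_Diff_singleton card_field)
  ultimately show ?thesis by simp
qed

text \<open>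
  The element \<open>- 1\<close> raised to the odd number \<open>q - 1\<close> is both \<open>- 1\<close> and \<open>1\<close>.
\<close>
lemma char_2: "x + x = (0::'a)"
proof -
  have "odd ((2::nat) ^ n - 1)" using n_ge_2 by simp
  then have "(- 1 :: 'a) ^ (2 ^ n - 1) = - 1" by simp
  then have "(- 1 :: 'a) = 1" using power_card_nonzero[of "- 1"] by simp
  then have "x = - x" by (metis mult_minus1 mult_1)
  then show ?thesis by (metis add.right_inverse)
qed

sublocale binary_space "nonzero (UNIV :: 'a set)" n
  by unfold_locales (simp_all add: char_2 card_field)

lemma square_add: "(x + y)\<^sup>2 = x\<^sup>2 + (y::'a)\<^sup>2"
  by (simp add: power2_sum mult_2 char_2)

text \<open>
  Substitute \<open>a z\<close> for \<open>z\<close> in \<open>z\<^sup>2 + a z\<close>.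
\<close>
lemma in_U_set: "a \<noteq> 0 \<Longrightarrow> (x::'a) \<in> U_set a \<longleftrightarrow> x * inverse (a\<^sup>2) \<in> U_set 1"
proof -
  assume a: "a \<noteq> 0"
  have "(x = z\<^sup>2 + a * z) = (x * inverse (a\<^sup>2) = (z / a)\<^sup>2 + 1 * (z / a))" for z
    using a by (auto simp: field_simps power2_eq_square)
  moreover have "\<exists>z. w = z / a" for w :: 'a using a by (intro exI[of _ "w * a"]) simp
  ultimately show ?thesis unfolding U_set_def by simp metis
qed

lemma subspace_U1: "subspace2 (U_set (1::'a))"
proof -
  have U1: "U_set (1::'a) = range (\<lambda>x. x\<^sup>2 + x)" by (auto simp: U_set_def)
  have eq: "x\<^sup>2 + x + (y\<^sup>2 + y) = (x + y)\<^sup>2 + (x + y)" for x y :: 'a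
    by (simp add: square_add ac_simps)
  have "x\<^sup>2 + x + (y\<^sup>2 + y) \<in> U_set 1" for x y :: 'a
    unfolding U1 by (rule range_eqI[of _ _ "x + y"]) (rule eq)
  moreover have "0 \<in> U_set (1::'a)" unfolding U1 by (rule range_eqI[of _ _ 0]) simp
  ultimately show ?thesis unfolding subspace2_def by (auto simp: U1)
qed

text \<open>
  The additive map \<open>x \<mapsto> x\<^sup>2 + x\<close> has kernel \<open>{0, 1}\<close>, so it is injective on a hyperplane that avoids \<open>1\<close> and
  takes all its values there.
\<close>
lemma card_U1: "2 * card (U_set (1::'a)) = 2 ^ n"
proof -
  let ?g = "\<lambda>x::'a. x\<^sup>2 + x"
  obtain \<chi> where \<chi>: "functional \<chi>" "\<chi> (1::'a)"
    using separation[OF subspace2_zero] by (metis one_neq_zero singletonD)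
  let ?K = "{x. \<not> \<chi> x}"
  have g_add: "?g (x + y) = ?g x + ?g y" for x y by (simp add: square_add ac_simps)
  have kernel: "?g x = 0 \<longleftrightarrow> x = 0 \<or> x = 1" for x
  proof -
    have "?g x = x * (x + 1)" by (simp add: power2_eq_square algebra_simps)
    then show ?thesis by simp
  qed
  have "inj_on ?g ?K"
  proof (rule inj_onI)
    fix x y assume xy: "x \<in> ?K" "y \<in> ?K" "?g x = ?g y"
    have "?g (x + y) = ?g x + ?g y" by (rule g_add)
    also have "\<dots> = 0" unfolding xy(3) by (rule char_2)
    finally have "x + y = 0 \<or> x + y = 1" by (simp only: kernel)
    moreover have "\<not> \<chi> (x + y)" using xy \<chi> by (simp add: functionalD)
    ultimately have "x + y = 0" using \<chi>(2) by metis
    then show "x = y" by (simp only: add_eq_0)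
  qed
  moreover have "U_set 1 = ?g ` ?K"
  proof -
    have "?g x \<in> ?g ` ?K" for x
    proof (cases "\<chi> x")
      case True
      have "?g 1 = 0" using kernel by blast
      then have "?g x = ?g (x + 1)" using g_add[of x 1] by simp
      moreover have "x + 1 \<in> ?K" using True \<chi> by (simp add: functionalD)
      ultimately show ?thesis by blast
    qed auto
    then show ?thesis unfolding U_set_def by auto
  qed
  ultimately have "card (U_set (1::'a)) = card ?K" by (simp add: card_image)
  then show ?thesis using card_hyperplane[OF \<chi>] by simp
qed

text \<open>
  This is the trace form: \<open>U\<^sub>1\<close> is the kernel of the absolute trace.
\<close>
definition form :: "'a \<Rightarrow> 'a \<Rightarrow> bool" where
  "form y x \<longleftrightarrow> y * x \<notin> U_set 1"

lemma functional_U1: "functional (\<lambda>x::'a. x \<notin> U_set 1)"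
proof -
  let ?U = "U_set (1::'a)"
  have closed: "x + y \<in> ?U" if "x \<in> ?U" "y \<in> ?U" for x y
    using subspace_U1 that by (simp add: subspace2_def)
  have one: "x + y \<notin> ?U" if "x \<in> ?U" "y \<notin> ?U" for x y
    using closed[of x "x + y"] that by auto
  have two: "x + y \<in> ?U" if "x \<notin> ?U" "y \<notin> ?U" for x y
  proof -
    have "(+) x ` ?U \<inter> ?U = {}" using one that(1) by (auto simp: add.commute)
    then have "card ((+) x ` ?U \<union> ?U) = CARD('a)"
      using card_U1 by (simp add: card_Un_disjoint card_image inj_add card_space)
    then have "(+) x ` ?U \<union> ?U = UNIV" by (intro card_subset_eq) auto
    then show ?thesis using that(2) by (metis UNIV_I Un_iff in_translate)
  qed
  show ?thesis unfolding functional_def using closed one two by (metis add.commute)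
qed

lemma functional_form: "functional (form y)"
  unfolding functional_def form_def
  using functionalD[OF functional_U1] by (simp add: distrib_left)

lemma form_commute: "form x y \<longleftrightarrow> form y x"
  by (simp add: form_def mult.commute)

text \<open>
  If \<open>y\<close> and \<open>z\<close> induce the same functional, multiplication by \<open>c = z / y\<close> permutes the nonzero elements of
  \<open>U\<^sub>1\<close>, whose number is \<open>2\<^sup>n\<^sup>-\<^sup>1 - 1\<close>.  As \<open>2\<^sup>n - 1 = 2 (2\<^sup>n\<^sup>-\<^sup>1 - 1) + 1\<close> and \<open>c\<close> to the power \<open>2\<^sup>n - 1\<close> is \<open>1\<close>, it
  follows that \<open>c = 1\<close>.
\<close>
lemma inj_form: "inj form"
proof (rule injI)
  fix y z assume eq: "form y = form z"
  have not_all: "\<exists>w. w \<notin> U_set (1::'a)"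
  proof (rule ccontr)
    assume "\<not> ?thesis"
    then have "U_set (1::'a) = UNIV" by auto
    then show False using card_U1 card_field by simp
  qed
  have zero: "b = 0" if "form b = form 0" for b
  proof (rule ccontr)
    assume b: "b \<noteq> 0"
    obtain w where "w \<notin> U_set (1::'a)" using not_all by blast
    then have "form b (w / b)" using b by (simp add: form_def)
    moreover have "\<not> form 0 (w / b)"
      using subspace_U1 by (simp add: form_def subspace2_def)
    ultimately show False using that by simp
  qed
  show "y = z"
  proof (cases "y = 0 \<or> z = 0")
    case True
    then show ?thesis using zero eq by metis
  next
    case False
    define c where "c = z / y"
    have c: "c \<noteq> 0" "z = c * y" using False by (simp_all add: c_def)
    let ?S = "U_set (1::'a) - {0}"
    have iff: "c * w \<in> U_set 1 \<longleftrightarrow> w \<in> U_set 1" for w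
      using fun_cong[OF eq, of "w / y"] False by (simp add: form_def c_def)
    have "x \<in> (*) c ` ?S" if "x \<in> ?S" for x
      by (rule image_eqI[of _ _ "x / c"]) (use that c(1) iff[of "x / c"] in auto)
    moreover have "(*) c ` ?S \<subseteq> ?S" using c(1) iff by auto
    ultimately have "(*) c ` ?S = ?S" by blast
    then have "c ^ card ?S = 1" using c(1) by (intro power_card_invariant) auto
    moreover have "card ?S = card (U_set (1::'a)) - 1"
      using subspace_U1 by (simp add: subspace2_def card_Diff_singleton)
    moreover have "card (U_set (1::'a)) > 0" using card_U1 by (intro gr0I) simp
    ultimately have "c ^ card ?S = 1" "2 ^ n - 1 = card ?S + card ?S + 1"
      using card_U1 by linarith+
    then have "c ^ (2 ^ n - 1) = c" by (simp add: power_add)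
    then have "c = 1" using power_card_nonzero[OF c(1)] by simp
    then show ?thesis using c by simp
  qed
qed

sublocale dual_pairing "nonzero (UNIV :: 'a set)" n form
  using injective_form_perfect[OF n_ge_2 functional_form form_commute inj_form]
  by unfold_locales (simp_all add: n_ge_2 functional_form form_commute)

definition inverse_square :: "'a \<Rightarrow> 'a" where
  "inverse_square y = inverse (y\<^sup>2)"

lemma inverse_square_permutes: "inverse_square permutes nonzero UNIV"
proof (rule bij_imp_permutes)
  have "inj inverse_square"
  proof (rule injI)
    fix y z assume "inverse_square y = inverse_square z"
    then have "y\<^sup>2 = z\<^sup>2" by (simp add: inverse_square_def)
    then have "(y + z)\<^sup>2 = 0" by (simp add: square_add char_2)
    then show "y = z" by simp
  qed
  then have inj: "inj_on inverse_square (nonzero UNIV)" by (rule inj_on_subset) simp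
  moreover have "inverse_square ` nonzero UNIV \<subseteq> nonzero UNIV"
    by (auto simp: inverse_square_def)
  ultimately show "bij_betw inverse_square (nonzero UNIV) (nonzero UNIV)"
    by (simp add: bij_betw_def endo_inj_surj)
qed (simp add: inverse_square_def)

lemma bij_inverse_square: "bij inverse_square"
  by (rule permutes_bij[OF inverse_square_permutes])

lemma in_hyper: "x \<in> hyper y \<longleftrightarrow> x \<noteq> 0 \<and> \<not> form y x"
  by (simp add: hyper_def)

lemma U_block: "y \<noteq> 0 \<Longrightarrow> nonzero (U_set y) = hyper (inverse_square y)"
  by (rule Set.set_eqI, unfold in_hyper)
     (auto simp: form_def inverse_square_def nonzero_def in_U_set[of y] mult.commute)

text \<open>
  For \<open>x \<noteq> 0\<close> and in characteristic two, \<open>y = x + a / x\<close> is equivalent to \<open>a = x\<^sup>2 + y x\<close>.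
\<close>
lemma in_O_set:
  assumes "a \<noteq> 0"
  shows "y \<in> O_set a \<longleftrightarrow> (a::'a) \<in> U_set y"
proof -
  have *: "y = x + a * inverse x \<longleftrightarrow> a = x\<^sup>2 + y * x" if "x \<noteq> 0" for x
  proof -
    have "y = x + a * inverse x \<longleftrightarrow> y * x = x\<^sup>2 + a"
      using that by (auto simp: field_simps power2_eq_square)
    also have "\<dots> \<longleftrightarrow> a = x\<^sup>2 + y * x"
      by (metis add_cancel_self)
    finally show ?thesis .
  qed
  have "a = x\<^sup>2 + y * x \<Longrightarrow> x \<noteq> 0" for x using assms by auto
  then show ?thesis unfolding O_set_def U_set_def using * by (auto simp: nonzero_def)
qed

lemma O_block:
  assumes "a \<noteq> 0"
  shows "nonzero (O_set a) = Hilbert_Choice.inv inverse_square ` hyper a"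
proof -
  have "y \<in> nonzero (O_set a) \<longleftrightarrow> inverse_square y \<in> hyper a" for y
  proof (cases "y = 0")
    case True
    then show ?thesis by (auto simp: in_hyper inverse_square_def nonzero_def[of "O_set a"])
  next
    case False
    have "y \<in> nonzero (O_set a) \<longleftrightarrow> a \<in> nonzero (U_set y)"
      using False assms in_O_set by (auto simp: nonzero_def[of "O_set a"] nonzero_def[of "U_set y"])
    also have "\<dots> \<longleftrightarrow> inverse_square y \<in> hyper a"
      using False assms form_commute
      by (auto simp: U_block in_hyper inverse_square_def)
    finally show ?thesis .
  qed
  then have "nonzero (O_set a) = inverse_square -` hyper a" by auto
  then show ?thesis by (simp only: bij_vimage_eq_inv_image[OF bij_inverse_square])
qed

lemma blocks_image: "{nonzero (F a) | a. a \<in> nonzero UNIV} = (\<lambda>a. nonzero (F a)) ` nonzero UNIV"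
  by auto

lemma D_u_blocks: "snd (D_u :: 'a incidence) = hyper ` nonzero UNIV"
proof -
  have "(\<lambda>a. nonzero (U_set a)) ` nonzero UNIV = (\<lambda>a. hyper (inverse_square a)) ` nonzero UNIV"
    by (rule image_cong) (simp_all add: U_block)
  also have "\<dots> = hyper ` inverse_square ` nonzero UNIV" by (simp add: image_image)
  also have "inverse_square ` nonzero UNIV = nonzero UNIV"
    by (rule permutes_image[OF inverse_square_permutes])
  finally show ?thesis unfolding D_u_def snd_conv blocks_image .
qed

sublocale des_u: transported_design "nonzero (UNIV :: 'a set)" n form id
  by unfold_locales (simp add: permutes_id)

sublocale des_o: transported_design "nonzero (UNIV :: 'a set)" n form "Hilbert_Choice.inv inverse_square"
  by unfold_locales (rule permutes_inv[OF inverse_square_permutes])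

lemma D_u: "D_u = des_u.D"
  unfolding des_u.D_def using D_u_blocks by (simp add: D_u_def)

lemma D_o: "D_o = des_o.D"
proof -
  have "(\<lambda>a. nonzero (O_set a)) ` nonzero (UNIV :: 'a set)
    = (\<lambda>a. Hilbert_Choice.inv inverse_square ` hyper a) ` nonzero UNIV"
    by (rule image_cong) (simp_all add: O_block)
  then show ?thesis unfolding D_o_def des_o.D_def blocks_image by simp
qed

lemma Aut_D_u: "Aut (D_u :: 'a incidence) = additive_bijections"
  unfolding D_u des_u.Aut_D by (simp add: conj_by_def)

text \<open>
  The point \<open>y\<close> of the second design corresponds to the block \<open>U\<^sub>y\<close> of the first, because \<open>y\<close> lies in
  \<open>O\<^sub>a\<close> exactly if \<open>a\<close> lies in \<open>U\<^sub>y\<close>.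
\<close>
lemma D_o_iso_dual_D_u: "design_isomorphic (D_o :: 'a incidence) (dual (D_u :: 'a incidence))"
  unfolding design_isomorphic_def design_iso_def
proof (intro exI[of _ "hyper \<circ> inverse_square"] conjI ballI)
  have "inj_on hyper (nonzero UNIV)" by (simp add: inj_on_def hyper_inj)
  then have "bij_betw hyper (nonzero UNIV) (hyper ` nonzero UNIV)" by (simp add: bij_betw_def)
  then show "bij_betw (hyper \<circ> inverse_square) (fst D_o) (fst (dual D_u))"
    using bij_betw_trans[OF permutes_imp_bij[OF inverse_square_permutes]]
    by (simp add: D_o dual_def D_u_blocks)
  fix X assume "X \<in> snd (D_o :: 'a incidence)"
  then obtain a where a: "a \<in> nonzero UNIV" "X = Hilbert_Choice.inv inverse_square ` hyper a"
    by (auto simp: D_o des_o.D_def)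
  have "(hyper \<circ> inverse_square) ` X = hyper ` hyper a"
    using bij_inverse_square by (simp add: a(2) image_image bij_is_surj surj_f_inv_f)
  also have "\<dots> = {Y \<in> hyper ` nonzero UNIV. a \<in> Y}"
    using a(1) form_commute by (auto simp: hyper_def image_iff)
  finally have eq: "(hyper \<circ> inverse_square) ` X = {Y \<in> hyper ` nonzero UNIV. a \<in> Y}" .
  have points: "fst (D_u :: 'a incidence) = nonzero UNIV" by (simp only: D_u_def fst_conv)
  show "(hyper \<circ> inverse_square) ` X \<in> snd (dual D_u)"
    unfolding dual_def snd_conv D_u_blocks points eq using a(1) by (rule imageI)
qed

lemma GL_F2: "(GL_F2 :: ('a \<Rightarrow> 'a) set) = additive_bijections"
proof -
  have vs: "vector_space (scale2 :: bit \<Rightarrow> 'a \<Rightarrow> 'a)"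
    by (rule vector_space_scale2[OF char_2])
  have "Vector_Spaces.linear scale2 scale2 f \<longleftrightarrow> additive f" for f :: "'a \<Rightarrow> 'a"
  proof
    assume "Vector_Spaces.linear scale2 scale2 f"
    then interpret Vector_Spaces.linear "scale2 :: bit \<Rightarrow> 'a \<Rightarrow> 'a" "scale2 :: bit \<Rightarrow> 'a \<Rightarrow> 'a" f .
    show "additive f" by unfold_locales (rule add)
  next
    assume "additive f"
    then have add: "f (x + y) = f x + f y" and zero: "f 0 = 0" for x y
      by (simp_all add: additive.add additive.zero)
    show "Vector_Spaces.linear scale2 scale2 f"
      unfolding Vector_Spaces.linear_iff using vs by (simp add: add scale2_def zero)
  qed
  then show ?thesis by (simp add: GL_F2_def additive_bijections_def)
qed

end

theorem theorem1p1:
  fixes n q :: nat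
  assumes n: "n \<ge> 2" and q: "q = 2 ^ n" and card: "CARD('a::{field,finite}) = q"
  defines "P \<equiv> nonzero (UNIV :: 'a set)"
  defines "Du \<equiv> (D_u :: 'a incidence)" and "Do \<equiv> (D_o :: 'a incidence)"
  shows
    \<comment> \<open>(i)\<close>
    "(is_design 2 (q - 1) (q div 2 - 1) (q div 4 - 1) Du \<and>
      is_design 2 (q - 1) (q div 2 - 1) (q div 4 - 1) Do \<and>
      design_isomorphic Do (dual Du) \<and>
      aut_group Du \<cong> aut_group Do) \<and>
     \<comment> \<open>(ii)\<close>
     (Aut Du = GL_F2 \<and> (sym_group_on P)\<lparr>carrier := GL_F2\<rparr> \<cong> GL2 n) \<and>
     \<comment> \<open>(iii); the maximality claim is stated for \<open>n \<ge> 3\<close>, since for \<open>n = 2\<close> both groups are the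
       full symmetric group of degree 3\<close>
     (\<forall>D\<in>{Du, Do}.
        primitive_on P (Aut D) \<and>
        (n \<ge> 3 \<longrightarrow> maximal_subgroup (Aut D) (alt_group_on P)) \<and>
        (\<forall>p\<in>P. (aut_group D)\<lparr>carrier := point_stabilizer (aut_group D) p\<rparr> \<cong> AGL2 (n - 1)) \<and>
        (\<forall>B\<in>snd D. (aut_group D)\<lparr>carrier := block_stabilizer (aut_group D) B\<rparr> \<cong> AGL2 (n - 1)) \<and>
        (\<forall>p\<in>P. \<forall>B\<in>snd D.
           (n = 2 \<longrightarrow> conjugate_in (aut_group D)
                        (point_stabilizer (aut_group D) p) (block_stabilizer (aut_group D) B)) \<and>
           (n \<ge> 3 \<longrightarrow> \<not> conjugate_in (aut_group D)
                        (point_stabilizer (aut_group D) p) (block_stabilizer (aut_group D) B))))"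
proof -
  interpret binary_field "TYPE('a)" n
    by unfold_locales (use n q card in auto)
  have half: "q div 2 = 2 ^ (n - 1)" and quarter: "q div 4 = 2 ^ (n - 2)"
  proof -
    obtain m where "n = 2 + m" using n le_Suc_ex by blast
    then show "q div 2 = 2 ^ (n - 1)" "q div 4 = 2 ^ (n - 2)" by (simp_all add: q)
  qed
  have Du_group: "aut_group Du = (sym_group_on P)\<lparr>carrier := additive_bijections\<rparr>"
    by (simp add: Du_def P_def aut_group_def Aut_D_u) (simp add: D_u_def)
  have two: "(\<forall>D\<in>{D1, D2}. R D) \<longleftrightarrow> R D1 \<and> R D2" for D1 D2 :: "'a incidence" and R
    by blast
  show ?thesis
    unfolding half quarter
  proof (intro conjI)
    show "is_design 2 (q - 1) (2 ^ (n - 1) - 1) (2 ^ (n - 2) - 1) Du"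
      unfolding Du_def D_u q by (rule des_u.design)
    show "is_design 2 (q - 1) (2 ^ (n - 1) - 1) (2 ^ (n - 2) - 1) Do"
      unfolding Do_def D_o q by (rule des_o.design)
    show "design_isomorphic Do (dual Du)" unfolding Du_def Do_def by (rule D_o_iso_dual_D_u)
    show "aut_group Du \<cong> aut_group Do"
      unfolding Du_group Do_def D_o P_def by (rule des_o.aut_group_iso)
    show "Aut Du = GL_F2" by (simp only: Du_def Aut_D_u GL_F2)
    show "(sym_group_on P)\<lparr>carrier := GL_F2\<rparr> \<cong> GL2 n"
      unfolding GL_F2 P_def by (rule additive_bijections_iso_GL2)
  qed (unfold Du_def Do_def P_def D_u D_o two,
      rule conjI[OF des_u.automorphism_group_properties des_o.automorphism_group_properties])
qed

end
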